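(* Let $(\mathcal{A}_1,\rho_1,\pi_1)$ and $(\mathcal{A}_2,\rho_2,\pi_2)$ be compact quantum metric spaces and let $r$ be a real number with $r\geq\frac{1}{2}\max(\|\rho_1\|,\|\rho_2\|)$. Then $(\mathcal{A}_1\oplus\mathcal{A}_2,\rho,\pi_1\oplus\pi_2)$ is a compact quantum metric space, where $$\rho=\rho_1+\rho_2+r1_{\mathcal{A}_1\check{\otimes}\mathcal{A}_2}+r1_{\mathcal{A}_2\check{\otimes}\mathcal{A}_1}\in(\mathcal{A}_1\oplus\mathcal{A}_2)\check{\otimes}(\mathcal{A}_1\oplus\mathcal{A}_2)=\bigoplus_{i,j=1,2}\mathcal{A}_i\check{\otimes}\mathcal{A}_j.$$
   Context: Notation: $\check{\otimes}$ denotes the spatial (minimal) tensor product of C*-algebras; $\bar{\otimes}$ denotes the Hilbert space tensor product (for Hilbert spaces) and the von Neumann algebra tensor product (for von Neumann algebras); $\mathbf{L}(\mathcal{H})$ is the algebra of bounded operators on the Hilbert space $\mathcal{H}$. In the formula for $\rho$, each $\rho_i\in\mathcal{A}_i\check{\otimes}\mathcal{A}_i$ and each unit $1_{\mathcal{A}_i\check{\otimes}\mathcal{A}_j}$ is regarded as an element of the direct sum $\bigoplus_{i,j}\mathcal{A}_i\check{\otimes}\mathcal{A}_j$ via the corresponding summand. The representation $\pi_1\oplus\pi_2$ of $\mathcal{A}_1\oplus\mathcal{A}_2$ on $\mathcal{H}_1\oplus\mathcal{H}_2$ is $(a_1,a_2)\mapsto\pi_1(a_1)\oplus\pi_2(a_2)$,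 where $\mathcal{H}_k$ is the Hilbert space of $\pi_k$. Atomic representation: a representation $\pi$ of a unital C*-algebra $\mathcal{A}$ on a Hilbert space $\mathcal{H}$ is called atomic if there is a family $\{\pi_i:\mathcal{A}\to\mathbf{L}(\mathcal{H}_i)\}$ of pairwise inequivalent irreducible representations of $\mathcal{A}$ with $\pi=\bigoplus_i\pi_i$ (so $\pi(\mathcal{A})''=\bigoplus_i\mathbf{L}(\mathcal{H}_i)$). Let $\pi:\mathcal{A}\to\mathbf{L}(\mathcal{H})$ be a faithful atomic representation; regard $\mathcal{A}\subseteq\mathbf{L}(\mathcal{H})$ via $\pi$, write $\mathcal{A}''=\pi(\mathcal{A})''$, and regard $\mathcal{A}\check{\otimes}\mathcal{A}\subseteq\mathcal{A}''\bar{\otimes}\mathcal{A}''\subseteq\mathbf{L}(\mathcal{H}\bar{\otimes}\mathcal{H})$. Let $P_\delta\in\mathcal{A}''\bar{\otimes}\mathcal{A}''$ be the supremum of all projections of the form $p\otimes p$ with $p\in\mathcal{A}''$ a minimal projection, and let $\mathcal{H}_\delta\subseteq\mathcal{H}\bar{\otimes}\mathcal{H}$ be the image of $P_\delta$. Compact quantum metric space: a triple $(\mathcal{A},\rho,\pi)$ where $\mathcal{A}$ is a unital C*-algebra, $\pi:\mathcal{A}\to\mathbf{L}(\mathcal{H})$ is a faithful atomic representation, and $\rho\in\mathcal{A}\check{\otimes}\mathcal{A}$ satisfies: (i)$'$ $\rho$ is a positive element of $\mathcal{A}\check{\otimes}\mathcal{A}$; (ii)$'$ $\rho P_\delta=P_\delta\rho=0$;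 (iii)$'$ $0$ is not an eigenvalue of the operator $\rho|_{\mathcal{H}_\delta^\perp}\in\mathbf{L}(\mathcal{H}_\delta^\perp)$; (iv)$'$ $\mathfrak{F}(\rho)=\rho$, where $\mathfrak{F}:\mathcal{A}\check{\otimes}\mathcal{A}\to\mathcal{A}\check{\otimes}\mathcal{A}$ is the flip $a\otimes b\mapsto b\otimes a$; (v)$'$ $\mathfrak{M}(\rho)\leq\rho\otimes1+1\otimes\rho$ in $\mathcal{A}\check{\otimes}\mathcal{A}\check{\otimes}\mathcal{A}$, where $\mathfrak{M}:\mathcal{A}\check{\otimes}\mathcal{A}\to\mathcal{A}\check{\otimes}\mathcal{A}\check{\otimes}\mathcal{A}$ is the *-morphism with $\mathfrak{M}(a\otimes b)=a\otimes1\otimes b$.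
   Formalization: The formal theorem additionally assumes that r is nonzero unless one of the two algebras is zero; for two one-point spaces (both algebras C, both ρ's zero) and r = 0, condition (iii)' fails for the direct sum. *)

theory Defs
  imports "HOL-Analysis.Analysis"
begin

section \<open>Complex Hilbert spaces\<close>

class scaleC = scaleR +
  fixes scaleC :: "complex \<Rightarrow> 'a \<Rightarrow> 'a" (infixr \<open>*\<^sub>C\<close> 75)

class complex_vector = scaleC + real_vector +
  assumes scaleC_add_right: "c *\<^sub>C (x + y) = c *\<^sub>C x + c *\<^sub>C y"
    and scaleC_add_left: "(c + d) *\<^sub>C x = c *\<^sub>C x + d *\<^sub>C x"
    and scaleC_scaleC [simp]: "c *\<^sub>C (d *\<^sub>C x) = (c * d) *\<^sub>C x"
    and scaleR_scaleC: "r *\<^sub>R x = complex_of_real r *\<^sub>C x"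

lemma scaleC_one [simp]: "1 *\<^sub>C x = (x :: 'a :: complex_vector)"
  using scaleR_scaleC[of 1 x] by simp

text \<open>This provides \<open>cvs.span\<close> and \<open>cvs.subspace\<close> for complex linear spans and subspaces.\<close>

global_interpretation cvs: vector_space "scaleC :: complex \<Rightarrow> 'a \<Rightarrow> 'a :: complex_vector"
  by standard (simp_all add: scaleC_add_right scaleC_add_left)

text \<open>The complex inner product is linear in the second argument; its real part is the
  inner product from the library.\<close>

class complex_inner = complex_vector + real_inner +
  fixes cinner :: "'a \<Rightarrow> 'a \<Rightarrow> complex"
  assumes cinner_commute: "cinner x y = cnj (cinner y x)"
    and cinner_add_right: "cinner x (y + z) = cinner x y + cinner x z"
    and cinner_scaleC_right: "cinner x (c *\<^sub>C y) = c * cinner x y"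
    and inner_eq_Re_cinner: "inner x y = Re (cinner x y)"

class chilbert_space = complex_inner + complete_space

subclass (in chilbert_space) banach ..

lemma cinner_add_left: "cinner (x + y) z = cinner x z + cinner y (z :: 'a :: complex_inner)"
  by (metis cinner_add_right cinner_commute complex_cnj_add)

lemma cinner_scaleC_left: "cinner (c *\<^sub>C x) y = cnj c * cinner x (y :: 'a :: complex_inner)"
  by (metis cinner_scaleC_right cinner_commute complex_cnj_mult)

lemma cinner_zero_right [simp]: "cinner x (0 :: 'a :: complex_inner) = 0"
  using cinner_scaleC_right[of x 0 0] by simp

lemma cinner_zero_left [simp]: "cinner (0 :: 'a :: complex_inner) x = 0"
  using cinner_scaleC_left[of 0 0 x] by simp

lemma cinner_diff_right: "cinner x (y - z) = cinner x y - cinner x (z :: 'a :: complex_inner)"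
  by (metis add_diff_cancel_right' cinner_add_right diff_add_cancel)

lemma cinner_diff_left: "cinner (x - y) z = cinner x z - cinner y (z :: 'a :: complex_inner)"
  by (metis add_diff_cancel_right' cinner_add_left diff_add_cancel)

lemma cinner_sum_right: "cinner x (\<Sum>i\<in>F. f i) = (\<Sum>i\<in>F. cinner x (f i :: 'a :: complex_inner))"
  by (induction F rule: infinite_finite_induct) (auto simp: cinner_add_right)

lemma cinner_sum_left: "cinner (\<Sum>i\<in>F. f i) x = (\<Sum>i\<in>F. cinner (f i :: 'a :: complex_inner) x)"
  by (induction F rule: infinite_finite_induct) (auto simp: cinner_add_left)

lemma cinner_self: "cinner x x = complex_of_real ((norm x)\<^sup>2)" for x :: "'a :: complex_inner"
proof -
  have "Im (cinner x x) = 0"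
    using arg_cong[OF cinner_commute[of x x], of Im] by simp
  moreover have "Re (cinner x x) = (norm x)\<^sup>2"
    by (metis inner_eq_Re_cinner power2_norm_eq_inner)
  ultimately show ?thesis by (simp add: complex_eq_iff)
qed

lemma norm_scaleC: "norm (c *\<^sub>C x) = cmod c * norm x" for x :: "'a :: complex_inner"
proof -
  have "complex_of_real ((norm (c *\<^sub>C x))\<^sup>2) = cnj c * c * complex_of_real ((norm x)\<^sup>2)"
    by (metis cinner_self cinner_scaleC_left cinner_scaleC_right mult.left_commute mult.assoc)
  also have "\<dots> = complex_of_real ((cmod c * norm x)\<^sup>2)"
    using complex_norm_square[of c] by (simp add: power_mult_distrib mult.commute)
  finally have "(norm (c *\<^sub>C x))\<^sup>2 = (cmod c * norm x)\<^sup>2"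
    using of_real_eq_iff by blast
  then show ?thesis
    by (simp add: power2_eq_iff_nonneg)
qed

lemma cmod_cinner_le: "cmod (cinner x y) \<le> norm x * norm y" for x y :: "'a :: complex_inner"
proof (cases "cinner x y = 0")
  case False
  define c where "c = cnj (cinner x y) / cmod (cinner x y)"
  have c1: "cmod c = 1"
    using False by (simp add: c_def norm_divide)
  have "c * cinner x y = complex_of_real (cmod (cinner x y))"
    using False complex_norm_square[of "cinner x y"]
    by (simp add: c_def field_simps power2_eq_square)
  then have "cmod (cinner x y) = inner x (c *\<^sub>C y)"
    by (simp add: inner_eq_Re_cinner cinner_scaleC_right)
  also have "\<dots> \<le> norm x * norm (c *\<^sub>C y)"
    by (rule norm_cauchy_schwarz)
  finally show ?thesis by (simp add: norm_scaleC c1)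
qed simp

lemma bounded_linear_cinner_right: "bounded_linear (cinner (x :: 'a :: complex_inner))"
proof (rule bounded_linear_intro[where K = "norm x"])
  show "cinner x (r *\<^sub>R y) = r *\<^sub>R cinner x y" for r y
    by (simp add: scaleR_scaleC cinner_scaleC_right scaleR_conv_of_real)
qed (auto simp: cinner_add_right cmod_cinner_le mult.commute[of "norm _" "norm x"])

lemma bounded_linear_cinner_left: "bounded_linear (\<lambda>y. cinner y (x :: 'a :: complex_inner))"
proof -
  have "bounded_linear (\<lambda>y. cnj (cinner x y))"
    by (rule bounded_linear_compose[OF bounded_linear_cnj bounded_linear_cinner_right])
  then show ?thesis by (simp flip: cinner_commute)
qed

text \<open>The product type carries the \<open>l\<^sup>2\<close> norm in the library, so that it is the Hilbert space
  direct sum.\<close>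

instantiation prod :: (complex_vector, complex_vector) complex_vector
begin

definition scaleC_prod :: "complex \<Rightarrow> 'a \<times> 'b \<Rightarrow> 'a \<times> 'b" where
  "scaleC_prod c x = (c *\<^sub>C fst x, c *\<^sub>C snd x)"

instance
  by standard (auto simp: scaleC_prod_def scaleC_add_right scaleC_add_left scaleR_scaleC prod_eq_iff)

end

instantiation prod :: (complex_inner, complex_inner) complex_inner
begin

definition cinner_prod :: "'a \<times> 'b \<Rightarrow> 'a \<times> 'b \<Rightarrow> complex" where
  "cinner_prod x y = cinner (fst x) (fst y) + cinner (snd x) (snd y)"

instance
proof
  fix x y z :: "'a \<times> 'b" and c :: complex
  show "cinner x y = cnj (cinner y x)"
    by (simp add: cinner_prod_def flip: cinner_commute)
qed (auto simp: cinner_prod_def scaleC_prod_def cinner_add_right cinner_scaleC_right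
       inner_prod_def inner_eq_Re_cinner algebra_simps)

end

instance prod :: (chilbert_space, chilbert_space) chilbert_space ..

subsection \<open>Orthonormal bases\<close>

definition orthonormal :: "'a :: complex_inner set \<Rightarrow> bool" where
  "orthonormal B \<longleftrightarrow> (\<forall>x\<in>B. norm x = 1) \<and> (\<forall>x\<in>B. \<forall>y\<in>B. x \<noteq> y \<longrightarrow> cinner x y = 0)"

definition some_onb :: "'a :: chilbert_space set" where
  "some_onb = (SOME B. orthonormal B \<and> (\<forall>v. (\<forall>b\<in>B. cinner b v = 0) \<longrightarrow> v = 0))"

lemma some_onb:
  "orthonormal (some_onb :: 'a :: chilbert_space set)"
  "(\<And>b. b \<in> some_onb \<Longrightarrow> cinner b v = 0) \<Longrightarrow> v = (0 :: 'a)"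
proof -
  let ?\<A> = "{B :: 'a set. orthonormal B}"
  have "\<exists>B\<in>?\<A>. \<forall>X\<in>?\<A>. B \<subseteq> X \<longrightarrow> X = B"
  proof (rule subset_Zorn')
    fix \<C> assume C: "subset.chain ?\<A> \<C>"
    show "\<Union>\<C> \<in> ?\<A>"
      unfolding orthonormal_def mem_Collect_eq
    proof (intro conjI ballI impI)
      fix x assume "x \<in> \<Union>\<C>"
      then show "norm x = 1"
        using C by (auto simp: subset_chain_def orthonormal_def)
    next
      fix x y assume "x \<in> \<Union>\<C>" "y \<in> \<Union>\<C>" "x \<noteq> y"
      then obtain X Y where "X \<in> \<C>" "Y \<in> \<C>" "x \<in> X" "y \<in> Y" by blast
      moreover from this have "X \<subseteq> Y \<or> Y \<subseteq> X"
        using C by (auto simp: subset_chain_def)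
      moreover have "orthonormal X" "orthonormal Y"
        using C \<open>X \<in> \<C>\<close> \<open>Y \<in> \<C>\<close> by (auto simp: subset_chain_def)
      ultimately show "cinner x y = 0"
        using \<open>x \<noteq> y\<close> unfolding orthonormal_def by blast
    qed
  qed
  then obtain B :: "'a set" where B: "orthonormal B"
    and max: "\<And>X. orthonormal X \<Longrightarrow> B \<subseteq> X \<Longrightarrow> X = B" by auto
  have "v = 0" if v: "\<forall>b\<in>B. cinner b v = 0" for v
  proof (rule ccontr)
    assume "v \<noteq> 0"
    define w where "w = complex_of_real (1 / norm v) *\<^sub>C v"
    have nw: "norm w = 1" using \<open>v \<noteq> 0\<close> by (simp add: w_def norm_scaleC norm_divide)
    have bw: "cinner b w = 0" if "b \<in> B" for b
      using v that by (simp add: w_def cinner_scaleC_right)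
    then have wb: "cinner w b = 0" if "b \<in> B" for b
      using that cinner_commute[of w b] by simp
    have "orthonormal (insert w B)"
      using B nw bw wb unfolding orthonormal_def by auto
    then have "w \<in> B" using max by blast
    then show False using bw[of w] nw by (simp add: cinner_self)
  qed
  with B have "\<exists>B :: 'a set. orthonormal B \<and> (\<forall>v. (\<forall>b\<in>B. cinner b v = 0) \<longrightarrow> v = 0)"
    by blast
  from someI_ex[OF this]
  show "orthonormal (some_onb :: 'a set)"
    "(\<And>b. b \<in> some_onb \<Longrightarrow> cinner b v = 0) \<Longrightarrow> v = (0 :: 'a)"
    unfolding some_onb_def by blast+
qed

lemma orthonormal_norm_sum:
  fixes B :: "'a :: complex_inner set"
  assumes "orthonormal B" "finite F" "F \<subseteq> B"
  shows "(norm (\<Sum>b\<in>F. c b *\<^sub>C b))\<^sup>2 = (\<Sum>b\<in>F. (cmod (c b))\<^sup>2)"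
proof -
  have "cinner b (\<Sum>b\<in>F. c b *\<^sub>C b) = c b" if "b \<in> F" for b
  proof -
    have "cinner b (\<Sum>b\<in>F. c b *\<^sub>C b) = (\<Sum>b'\<in>F. if b' = b then c b else 0)"
      unfolding cinner_sum_right cinner_scaleC_right
      using assms that by (intro sum.cong) (auto simp: orthonormal_def cinner_self subset_iff)
    then show ?thesis using assms that by simp
  qed
  then have "cinner (\<Sum>b\<in>F. c b *\<^sub>C b) (\<Sum>b\<in>F. c b *\<^sub>C b) = (\<Sum>b\<in>F. cnj (c b) * c b)"
    by (simp add: cinner_sum_left cinner_scaleC_left)
  also have "\<dots> = complex_of_real (\<Sum>b\<in>F. (cmod (c b))\<^sup>2)"
    unfolding of_real_sum complex_norm_square by (simp add: mult.commute)
  finally show ?thesis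
    unfolding cinner_self of_real_eq_iff .
qed

lemma orthonormal_summable:
  fixes B :: "'a :: chilbert_space set"
  assumes B: "orthonormal B" and c: "(\<lambda>b. (cmod (c b))\<^sup>2) summable_on B"
  shows "(\<lambda>b. c b *\<^sub>C b) summable_on B"
proof -
  let ?F = "finite_subsets_at_top B"
  let ?s = "sum (\<lambda>b. c b *\<^sub>C b)"
  let ?q = "sum (\<lambda>b. (cmod (c b))\<^sup>2)"
  have "cauchy_filter (filtermap ?s ?F)"
    unfolding cauchy_filter_metric_filtermap
  proof (intro allI impI)
    fix e :: real assume e: "e > 0"
    obtain l where l: "(?q \<longlongrightarrow> l) ?F"
      using c by (auto simp: summable_on_def has_sum_def)
    have "\<forall>\<^sub>F S in ?F. dist (?q S) l < (e/2)\<^sup>2 / 2"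
      using e by (intro tendstoD[OF l]) auto
    then obtain S0 where S0: "finite S0" "S0 \<subseteq> B"
      "\<And>S. finite S \<Longrightarrow> S0 \<subseteq> S \<Longrightarrow> S \<subseteq> B \<Longrightarrow> dist (?q S) l < (e/2)\<^sup>2 / 2"
      unfolding eventually_finite_subsets_at_top by auto
    have *: "norm (?s S - ?s S0) < e / 2" if S: "finite S" "S0 \<subseteq> S" "S \<subseteq> B" for S
    proof -
      have "?s S - ?s S0 = ?s (S - S0)"
        using S by (simp add: sum_diff)
      then have "(norm (?s S - ?s S0))\<^sup>2 = ?q (S - S0)"
        using orthonormal_norm_sum[OF B, of "S - S0" c] S by auto
      also have "\<dots> = ?q S - ?q S0"
        using S by (simp add: sum_diff)
      also have "\<dots> < (e/2)\<^sup>2"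
        using S0(3)[OF S] S0(3)[OF S0(1) order.refl S0(2)]
        unfolding dist_real_def by linarith
      finally show ?thesis
        using e by (meson half_gt_zero power2_less_imp_less less_imp_le)
    qed
    show "\<exists>P. eventually P ?F \<and> (\<forall>x y. P x \<and> P y \<longrightarrow> dist (?s x) (?s y) < e)"
    proof (intro exI conjI allI impI)
      show "\<forall>\<^sub>F S in ?F. finite S \<and> S0 \<subseteq> S \<and> S \<subseteq> B"
        using S0 unfolding eventually_finite_subsets_at_top by blast
      fix S T assume "(finite S \<and> S0 \<subseteq> S \<and> S \<subseteq> B) \<and> (finite T \<and> S0 \<subseteq> T \<and> T \<subseteq> B)"
      then have "norm (?s S - ?s S0) < e / 2" "norm (?s T - ?s S0) < e / 2"
        using * by auto
      then show "dist (?s S) (?s T) < e"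
        using dist_triangle2[of "?s S" "?s T" "?s S0"] by (simp add: dist_norm)
    qed
  qed
  moreover have "complete (UNIV :: 'a set)"
    by (meson Cauchy_convergent UNIV_I complete_def convergent_def)
  ultimately have "\<exists>L. (?s \<longlongrightarrow> L) ?F"
    using cauchy_filter_complete_converges[of "filtermap ?s ?F" UNIV]
    by (auto simp: filterlim_def filtermap_bot_iff)
  then show ?thesis
    by (auto simp: summable_on_def has_sum_def)
qed

lemma bessel:
  fixes x :: "'a :: complex_inner"
  assumes "orthonormal B" "finite F" "F \<subseteq> B"
  shows "(\<Sum>b\<in>F. (cmod (cinner b x))\<^sup>2) \<le> (norm x)\<^sup>2"
proof -
  define y where "y = (\<Sum>b\<in>F. cinner b x *\<^sub>C b)"
  define s where "s = (\<Sum>b\<in>F. (cmod (cinner b x))\<^sup>2)"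
  have s0: "s \<ge> 0" by (simp add: s_def sum_nonneg)
  have "cinner y x = complex_of_real s"
    unfolding y_def s_def cinner_sum_left cinner_scaleC_left of_real_sum complex_norm_square
    by (simp add: mult.commute)
  then have "s \<le> norm y * norm x"
    using cmod_cinner_le[of y x] s0 by simp
  moreover have ny: "(norm y)\<^sup>2 = s"
    unfolding y_def s_def by (rule orthonormal_norm_sum[OF assms])
  ultimately have "norm y * norm y \<le> norm y * norm x"
    by (simp add: power2_eq_square)
  then have "norm y \<le> norm x"
    by (cases "norm y = 0") auto
  then show ?thesis
    using ny power_mono[of "norm y" "norm x" 2] by (simp add: s_def)
qed

lemma bessel_summable:
  assumes "orthonormal B"
  shows "(\<lambda>b. (cmod (cinner b (x :: 'a :: complex_inner)))\<^sup>2) summable_on B"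
  by (rule nonneg_bounded_partial_sums_imp_summable_on[where C = "(norm x)\<^sup>2"])
     (auto intro!: eventually_finite_subsets_at_top_weakI bessel[OF assms])

lemma onb_expansion:
  "((\<lambda>b. cinner b x *\<^sub>C b) has_sum (x :: 'a :: chilbert_space)) some_onb"
proof -
  let ?f = "\<lambda>b. cinner b x *\<^sub>C b"
  define y where "y = infsum ?f some_onb"
  have y: "(?f has_sum y) some_onb"
    unfolding y_def
    by (intro has_sum_infsum orthonormal_summable bessel_summable some_onb(1))
  have "cinner b (x - y) = 0" if b: "b \<in> some_onb" for b
  proof -
    have "((\<lambda>b'. cinner b (?f b')) has_sum cinner b y) some_onb"
      by (rule has_sum_bounded_linear[OF bounded_linear_cinner_right y])
    moreover have nb: "norm b = 1" using b some_onb(1) by (auto simp: orthonormal_def)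
    have "((\<lambda>b'. cinner b (?f b')) has_sum cinner b x) some_onb"
    proof (rule has_sum_cong_neutral[THEN iffD1, rotated -1])
      show "((\<lambda>b'. cinner b (?f b')) has_sum cinner b x) {b}"
        using has_sum_finite[of "{b}" "\<lambda>b'. cinner b (?f b')"]
        by (simp add: cinner_scaleC_right cinner_self nb)
      show "cinner b (cinner b' x *\<^sub>C b') = 0" if "b' \<in> some_onb - {b}" for b'
        using that b some_onb(1) by (auto simp: orthonormal_def cinner_scaleC_right)
    qed (use b in auto)
    ultimately have "cinner b x = cinner b y"
      using has_sum_unique by blast
    then show ?thesis by (simp add: cinner_diff_right)
  qed
  then have "x - y = 0" by (rule some_onb(2))
  with y show ?thesis by simp
qed

lemma parseval:
  "((\<lambda>b. cinner x b * cinner b y) has_sum cinner x (y :: 'a :: chilbert_space)) some_onb"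
  using has_sum_bounded_linear[OF bounded_linear_cinner_right onb_expansion, of x y]
  by (simp add: cinner_scaleC_right mult.commute)

subsection \<open>The Hilbert space tensor product\<close>

text \<open>Square summable coefficient families with respect to the product of two orthonormal bases.
  The elementary tensors are \<open>htens\<close> below; the lemmas \<open>cinner_htens\<close>, \<open>htens_add_left\<close> etc.
  and \<open>htens_dense\<close> characterize the construction up to a unique unitary isomorphism, so that the
  choice of the bases is immaterial.\<close>

typedef (overloaded) ('a, 'b) htensor (infixr \<open>\<otimes>\<^sub>H\<close> 21) =
  "{f :: 'a :: chilbert_space \<times> 'b :: chilbert_space \<Rightarrow> complex.
     (\<forall>p. p \<notin> some_onb \<times> some_onb \<longrightarrow> f p = 0) \<and> (\<lambda>p. (cmod (f p))\<^sup>2) summable_on UNIV}"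
  by (rule exI[of _ "\<lambda>_. 0"]) auto

setup_lifting type_definition_htensor

lemma sqsum_mult:
  fixes f g :: "'i \<Rightarrow> complex"
  assumes "(\<lambda>i. (cmod (f i))\<^sup>2) summable_on A" "(\<lambda>i. (cmod (g i))\<^sup>2) summable_on A"
  shows "(\<lambda>i. cnj (f i) * g i) summable_on A"
proof (rule abs_summable_summable, rule summable_on_comparison_test)
  show "(\<lambda>i. (cmod (f i))\<^sup>2 + (cmod (g i))\<^sup>2) summable_on A"
    by (rule summable_on_add[OF assms])
  show "norm (cnj (f i) * g i) \<le> (cmod (f i))\<^sup>2 + (cmod (g i))\<^sup>2" for i
    using sum_squares_bound[of "cmod (f i)" "cmod (g i)"]
      mult_nonneg_nonneg[OF norm_ge_zero[of "f i"] norm_ge_zero[of "g i"]]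
    unfolding norm_mult complex_mod_cnj by linarith
qed auto

lemma sqsum_add:
  fixes f g :: "'i \<Rightarrow> complex"
  assumes "(\<lambda>i. (cmod (f i))\<^sup>2) summable_on A" "(\<lambda>i. (cmod (g i))\<^sup>2) summable_on A"
  shows "(\<lambda>i. (cmod (f i + g i))\<^sup>2) summable_on A"
proof (rule summable_on_comparison_test)
  show "(\<lambda>i. 2 * ((cmod (f i))\<^sup>2 + (cmod (g i))\<^sup>2)) summable_on A"
    by (intro summable_on_cmult_right summable_on_add assms)
  show "(cmod (f i + g i))\<^sup>2 \<le> 2 * ((cmod (f i))\<^sup>2 + (cmod (g i))\<^sup>2)" for i
  proof -
    have "(cmod (f i + g i))\<^sup>2 \<le> (cmod (f i) + cmod (g i))\<^sup>2"
      by (intro power_mono norm_triangle_ineq) auto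
    also have "\<dots> \<le> 2 * ((cmod (f i))\<^sup>2 + (cmod (g i))\<^sup>2)"
      using sum_squares_bound[of "cmod (f i)" "cmod (g i)"] by (simp add: power2_sum)
    finally show ?thesis .
  qed
qed auto

lemma sqsum_cmult:
  fixes f :: "'i \<Rightarrow> complex"
  assumes "(\<lambda>i. (cmod (f i))\<^sup>2) summable_on A"
  shows "(\<lambda>i. (cmod (c * f i))\<^sup>2) summable_on A"
  unfolding norm_mult power_mult_distrib by (rule summable_on_cmult_right[OF assms])

lemma infsum_cnj_mult_self:
  fixes f :: "'i \<Rightarrow> complex"
  assumes "(\<lambda>i. (cmod (f i))\<^sup>2) summable_on A"
  shows "(\<Sum>\<^sub>\<infinity>i\<in>A. cnj (f i) * f i) = complex_of_real (\<Sum>\<^sub>\<infinity>i\<in>A. (cmod (f i))\<^sup>2)"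
proof (rule infsumI)
  have "((\<lambda>i. complex_of_real ((cmod (f i))\<^sup>2)) has_sum complex_of_real (\<Sum>\<^sub>\<infinity>i\<in>A. (cmod (f i))\<^sup>2)) A"
    by (rule has_sum_bounded_linear[OF bounded_linear_of_real has_sum_infsum[OF assms]])
  then show "((\<lambda>i. cnj (f i) * f i) has_sum complex_of_real (\<Sum>\<^sub>\<infinity>i\<in>A. (cmod (f i))\<^sup>2)) A"
    unfolding complex_norm_square by (simp add: mult.commute)
qed

lemma sqsum_htensor: "(\<lambda>p. (cmod (Rep_htensor f p))\<^sup>2) summable_on UNIV"
  using Rep_htensor[of f] by simp

instantiation htensor :: (chilbert_space, chilbert_space) complex_inner
begin

lift_definition zero_htensor :: "('a, 'b) htensor" is "\<lambda>_. 0"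
  by simp

lift_definition plus_htensor :: "('a, 'b) htensor \<Rightarrow> ('a, 'b) htensor \<Rightarrow> ('a, 'b) htensor"
  is "\<lambda>f g p. f p + g p"
  by (auto intro: sqsum_add)

lift_definition scaleC_htensor :: "complex \<Rightarrow> ('a, 'b) htensor \<Rightarrow> ('a, 'b) htensor"
  is "\<lambda>c f p. c * f p"
  by (auto intro: sqsum_cmult)

lift_definition uminus_htensor :: "('a, 'b) htensor \<Rightarrow> ('a, 'b) htensor"
  is "\<lambda>f p. - f p"
  by auto

definition minus_htensor :: "('a, 'b) htensor \<Rightarrow> ('a, 'b) htensor \<Rightarrow> ('a, 'b) htensor" where
  "f - g = f + - g" for f g :: "('a, 'b) htensor"

definition scaleR_htensor :: "real \<Rightarrow> ('a, 'b) htensor \<Rightarrow> ('a, 'b) htensor" where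
  "r *\<^sub>R f = complex_of_real r *\<^sub>C f" for f :: "('a, 'b) htensor"

lift_definition cinner_htensor :: "('a, 'b) htensor \<Rightarrow> ('a, 'b) htensor \<Rightarrow> complex"
  is "\<lambda>f g. \<Sum>\<^sub>\<infinity>p. cnj (f p) * g p" .

definition inner_htensor :: "('a, 'b) htensor \<Rightarrow> ('a, 'b) htensor \<Rightarrow> real" where
  "inner f g = Re (cinner f g)" for f g :: "('a, 'b) htensor"

definition norm_htensor :: "('a, 'b) htensor \<Rightarrow> real" where
  "norm f = sqrt (inner f f)" for f :: "('a, 'b) htensor"

definition sgn_htensor :: "('a, 'b) htensor \<Rightarrow> ('a, 'b) htensor" where
  "sgn f = inverse (norm f) *\<^sub>R f" for f :: "('a, 'b) htensor"

definition dist_htensor :: "('a, 'b) htensor \<Rightarrow> ('a, 'b) htensor \<Rightarrow> real" where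
  "dist f g = norm (f - g)" for f g :: "('a, 'b) htensor"

definition uniformity_htensor :: "(('a, 'b) htensor \<times> ('a, 'b) htensor) filter" where
  "uniformity_htensor = (INF e\<in>{0 <..}. principal {(x, y). dist x y < e})"

definition open_htensor :: "('a, 'b) htensor set \<Rightarrow> bool" where
  "open_htensor U \<longleftrightarrow> (\<forall>x\<in>U. eventually (\<lambda>(x', y). x' = x \<longrightarrow> y \<in> U) uniformity)"

instance
proof
  fix x y z :: "('a, 'b) htensor" and a b :: real and c d :: complex
  show "x + y + z = x + (y + z)" by transfer (auto simp: algebra_simps)
  show "x + y = y + x" by transfer (auto simp: algebra_simps)
  show "0 + x = x" by transfer auto
  show nx: "- x + x = 0" by transfer auto
  show "x - y = x + - y" by (simp add: minus_htensor_def)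
  show Cr: "c *\<^sub>C (x + y) = c *\<^sub>C x + c *\<^sub>C y" for c by transfer (auto simp: algebra_simps)
  show Cl: "(c + d) *\<^sub>C x = c *\<^sub>C x + d *\<^sub>C x" for c d by transfer (auto simp: algebra_simps)
  show CC: "c *\<^sub>C d *\<^sub>C x = (c * d) *\<^sub>C x" for c d by transfer (auto simp: algebra_simps)
  show "a *\<^sub>R x = complex_of_real a *\<^sub>C x" by (simp add: scaleR_htensor_def)
  show "a *\<^sub>R (x + y) = a *\<^sub>R x + a *\<^sub>R y" by (simp add: scaleR_htensor_def Cr)
  show "(a + b) *\<^sub>R x = a *\<^sub>R x + b *\<^sub>R x" by (simp add: scaleR_htensor_def Cl)
  show "a *\<^sub>R b *\<^sub>R x = (a * b) *\<^sub>R x" by (simp add: scaleR_htensor_def CC)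
  show "1 *\<^sub>R x = x" unfolding scaleR_htensor_def by transfer auto
  show "sgn x = inverse (norm x) *\<^sub>R x" by (rule sgn_htensor_def)
  show "dist x y = norm (x - y)" by (rule dist_htensor_def)
  show "uniformity = (INF e\<in>{0 <..}. principal {(x :: ('a, 'b) htensor, y). dist x y < e})"
    by (rule uniformity_htensor_def)
  show "open U \<longleftrightarrow> (\<forall>x\<in>U. eventually (\<lambda>(x', y). x' = x \<longrightarrow> y \<in> U) uniformity)"
    for U :: "('a, 'b) htensor set"
    by (rule open_htensor_def)
  show com: "cinner x y = cnj (cinner y x)" for x y :: "('a, 'b) htensor"
    by transfer (simp add: mult.commute flip: infsum_cnj)
  show add: "cinner x (y + z) = cinner x y + cinner x z" for x y z :: "('a, 'b) htensor"
    by transfer (auto simp: distrib_left intro!: infsum_add sqsum_mult)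
  show sc: "cinner x (c *\<^sub>C y) = c * cinner x y" for x y :: "('a, 'b) htensor" and c
  proof transfer
    fix c :: complex and f g :: "'a \<times> 'b \<Rightarrow> complex"
    show "(\<Sum>\<^sub>\<infinity>p. cnj (f p) * (c * g p)) = c * (\<Sum>\<^sub>\<infinity>p. cnj (f p) * g p)"
      by (simp add: mult.left_commute infsum_cmult_right')
  qed
  show "inner x y = Re (cinner x y)" by (rule inner_htensor_def)
  show sym: "inner x y = inner y x" for x y :: "('a, 'b) htensor"
    unfolding inner_htensor_def by (subst com) simp
  show "inner (x + y) z = inner x z + inner y z"
    unfolding sym[of _ z] by (simp add: inner_htensor_def add)
  show "inner (a *\<^sub>R x) y = a * inner x y"
    unfolding sym[of _ y] by (simp add: inner_htensor_def scaleR_htensor_def sc)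
  have sq: "cinner x x = complex_of_real (\<Sum>\<^sub>\<infinity>p. (cmod (Rep_htensor x p))\<^sup>2)"
    unfolding cinner_htensor.rep_eq by (rule infsum_cnj_mult_self[OF sqsum_htensor])
  show "0 \<le> inner x x"
    by (simp add: inner_htensor_def sq infsum_nonneg)
  show "inner x x = 0 \<longleftrightarrow> x = 0"
  proof
    assume "inner x x = 0"
    then have "(\<Sum>\<^sub>\<infinity>p. (cmod (Rep_htensor x p))\<^sup>2) = 0"
      by (simp add: inner_htensor_def sq)
    then have "(cmod (Rep_htensor x p))\<^sup>2 = 0" for p
      using nonneg_infsum_le_0D[of "\<lambda>p. (cmod (Rep_htensor x p))\<^sup>2" UNIV p] sqsum_htensor[of x]
      by simp
    then show "x = 0"
      by (simp add: Rep_htensor_inject[symmetric] zero_htensor.rep_eq fun_eq_iff)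
  next
    show "x = 0 \<Longrightarrow> inner x x = 0"
      by (simp add: inner_htensor_def cinner_htensor.rep_eq zero_htensor.rep_eq)
  qed
  show "norm x = sqrt (inner x x)" by (rule norm_htensor_def)
qed

end

lemma Rep_htensor_diff: "Rep_htensor (f - g) p = Rep_htensor f p - Rep_htensor g p"
  unfolding minus_htensor_def plus_htensor.rep_eq uminus_htensor.rep_eq by simp

lemma norm_htensor_sq: "(norm f)\<^sup>2 = (\<Sum>\<^sub>\<infinity>p. (cmod (Rep_htensor f p))\<^sup>2)"
proof -
  have "complex_of_real ((norm f)\<^sup>2) = complex_of_real (\<Sum>\<^sub>\<infinity>p. (cmod (Rep_htensor f p))\<^sup>2)"
    unfolding cinner_self[symmetric] cinner_htensor.rep_eq
    by (rule infsum_cnj_mult_self[OF sqsum_htensor])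
  then show ?thesis unfolding of_real_eq_iff .
qed

lemma sum_le_norm_htensor:
  assumes "finite F"
  shows "(\<Sum>p\<in>F. (cmod (Rep_htensor f p))\<^sup>2) \<le> (norm f)\<^sup>2"
  unfolding norm_htensor_sq
  by (rule finite_sum_le_infsum[OF sqsum_htensor assms]) auto

instance htensor :: (chilbert_space, chilbert_space) chilbert_space
proof
  fix X :: "nat \<Rightarrow> ('a, 'b) htensor"
  assume X: "Cauchy X"
  let ?R = "\<lambda>n p. Rep_htensor (X n) p"
  have coord: "cmod (Rep_htensor f p) \<le> norm f" for f :: "('a, 'b) htensor" and p
    using sum_le_norm_htensor[of "{p}" f] by (simp add: power2_le_iff_abs_le)
  have "Cauchy (\<lambda>n. ?R n p)" for p
  proof (rule CauchyI)
    fix e :: real assume "e > 0"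
    then obtain M where "\<And>m n. m \<ge> M \<Longrightarrow> n \<ge> M \<Longrightarrow> norm (X m - X n) < e"
      using CauchyD[OF X] by blast
    then have "norm (?R m p - ?R n p) < e" if "m \<ge> M" "n \<ge> M" for m n
      using coord[of "X m - X n" p] that unfolding Rep_htensor_diff by (blast intro: le_less_trans)
    then show "\<exists>M. \<forall>m\<ge>M. \<forall>n\<ge>M. norm (?R m p - ?R n p) < e" by blast
  qed
  then have "\<exists>l. (\<lambda>n. ?R n p) \<longlonglongrightarrow> l" for p
    using Cauchy_convergent convergent_def by blast
  then obtain L where L: "\<And>p. (\<lambda>n. ?R n p) \<longlonglongrightarrow> L p" by metis
  have bound: "\<exists>N. \<forall>n\<ge>N. \<forall>F. finite F \<longrightarrow> (\<Sum>p\<in>F. (cmod (?R n p - L p))\<^sup>2) \<le> e\<^sup>2"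
    if e: "e > 0" for e :: real
  proof -
    obtain N where N: "\<And>m n. m \<ge> N \<Longrightarrow> n \<ge> N \<Longrightarrow> norm (X m - X n) < e"
      using CauchyD[OF X e] by blast
    have "(\<Sum>p\<in>F. (cmod (?R n p - L p))\<^sup>2) \<le> e\<^sup>2" if n: "n \<ge> N" and F: "finite F" for n F
    proof (rule tendsto_upperbound)
      show "(\<lambda>m. \<Sum>p\<in>F. (cmod (?R n p - ?R m p))\<^sup>2) \<longlonglongrightarrow> (\<Sum>p\<in>F. (cmod (?R n p - L p))\<^sup>2)"
        by (intro tendsto_intros L)
      show "\<forall>\<^sub>F m in sequentially. (\<Sum>p\<in>F. (cmod (?R n p - ?R m p))\<^sup>2) \<le> e\<^sup>2"
        unfolding eventually_sequentially
      proof (intro exI allI impI)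
        fix m assume "m \<ge> N"
        then have "norm (X n - X m) < e" using N n by blast
        then have "(norm (X n - X m))\<^sup>2 \<le> e\<^sup>2" by (intro power_mono) auto
        then show "(\<Sum>p\<in>F. (cmod (?R n p - ?R m p))\<^sup>2) \<le> e\<^sup>2"
          using sum_le_norm_htensor[OF F, of "X n - X m"] by (simp add: Rep_htensor_diff)
      qed
    qed simp
    then show ?thesis by blast
  qed
  have summ: "(\<lambda>p. (cmod (g p))\<^sup>2) summable_on UNIV"
    if "\<And>F. finite F \<Longrightarrow> (\<Sum>p\<in>F. (cmod (g p))\<^sup>2) \<le> C" for g :: "'a \<times> 'b \<Rightarrow> complex" and C
    by (rule nonneg_bounded_partial_sums_imp_summable_on[where C = C])
       (auto intro!: eventually_finite_subsets_at_top_weakI that)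
  have "(\<lambda>p. (cmod (L p))\<^sup>2) summable_on UNIV"
  proof -
    obtain N where N: "\<And>F. finite F \<Longrightarrow> (\<Sum>p\<in>F. (cmod (?R N p - L p))\<^sup>2) \<le> 1\<^sup>2"
      using bound[of 1] by auto
    have "(\<lambda>p. (cmod (?R N p + (- 1) * (?R N p - L p)))\<^sup>2) summable_on UNIV"
      by (intro sqsum_add sqsum_cmult sqsum_htensor) (rule summ[OF N])
    then show ?thesis by simp
  qed
  moreover have "L p = 0" if "p \<notin> some_onb \<times> some_onb" for p
  proof (rule LIMSEQ_unique[OF L])
    have "?R n p = 0" for n using Rep_htensor[of "X n"] that by blast
    then show "(\<lambda>n. ?R n p) \<longlonglongrightarrow> 0" by simp
  qed
  ultimately obtain l :: "('a, 'b) htensor" where l: "Rep_htensor l = L"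
    using Abs_htensor_inverse[of L] by blast
  have "X \<longlonglongrightarrow> l"
  proof (rule LIMSEQ_I)
    fix r :: real assume r: "r > 0"
    obtain N where N: "\<And>n F. n \<ge> N \<Longrightarrow> finite F \<Longrightarrow> (\<Sum>p\<in>F. (cmod (?R n p - L p))\<^sup>2) \<le> (r/2)\<^sup>2"
      using bound[of "r/2"] r by auto
    have "norm (X n - l) < r" if "n \<ge> N" for n
    proof -
      have "(norm (X n - l))\<^sup>2 \<le> (r/2)\<^sup>2"
        unfolding norm_htensor_sq
      proof (rule infsum_le_finite_sums[OF sqsum_htensor])
        fix F :: "('a \<times> 'b) set" assume "finite F"
        then show "(\<Sum>p\<in>F. (cmod (Rep_htensor (X n - l) p))\<^sup>2) \<le> (r/2)\<^sup>2"
          unfolding Rep_htensor_diff l by (rule N[OF that])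
      qed
      from power2_le_imp_le[OF this] r have "norm (X n - l) \<le> r/2" by simp
      then show ?thesis using r by simp
    qed
    then show "\<exists>N. \<forall>n\<ge>N. norm (X n - l) < r" by blast
  qed
  then show "convergent X" by (rule convergentI)
qed

lemma sqsum_product:
  assumes f: "(\<lambda>b. (cmod (f b))\<^sup>2) summable_on A" and g: "(\<lambda>c. (cmod (g c))\<^sup>2) summable_on B"
  shows "(\<lambda>(b, c). (cmod (f b * g c))\<^sup>2) summable_on A \<times> B"
proof -
  have "(\<lambda>(b, c). (cmod (f b))\<^sup>2 * (cmod (g c))\<^sup>2) summable_on A \<times> B"
    by (rule summable_on_SigmaI[where g = "\<lambda>b. (cmod (f b))\<^sup>2 * (\<Sum>\<^sub>\<infinity>c\<in>B. (cmod (g c))\<^sup>2)"])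
       (auto intro!: has_sum_cmult_right has_sum_infsum summable_on_cmult_left f g)
  then show ?thesis by (simp add: norm_mult power_mult_distrib case_prod_unfold)
qed

lift_definition htens :: "'a :: chilbert_space \<Rightarrow> 'b :: chilbert_space \<Rightarrow> ('a, 'b) htensor"
    (infixr \<open>\<otimes>\<^sub>h\<close> 70)
  is "\<lambda>x y (b, c). if b \<in> some_onb \<and> c \<in> some_onb then cinner b x * cinner c y else 0"
proof (intro CollectI conjI allI impI)
  fix x :: 'a and y :: 'b
  let ?f = "\<lambda>(b, c). if b \<in> some_onb \<and> c \<in> some_onb then cinner b x * cinner c y else 0"
  show "?f p = 0" if "p \<notin> some_onb \<times> some_onb" for p
    using that by (cases p) auto
  have "(\<lambda>(b, c). (cmod (cinner b x * cinner c y))\<^sup>2) summable_on some_onb \<times> some_onb"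
    by (intro sqsum_product bessel_summable some_onb(1))
  then show "(\<lambda>p. (cmod (?f p))\<^sup>2) summable_on UNIV"
    by (rule summable_on_cong_neutral[THEN iffD1, rotated -1]) (auto split: if_splits)
qed

lemma htens_add_left: "(x + x') \<otimes>\<^sub>h y = x \<otimes>\<^sub>h y + x' \<otimes>\<^sub>h y"
  by transfer (auto simp: cinner_add_right algebra_simps)

lemma htens_add_right: "x \<otimes>\<^sub>h (y + y') = x \<otimes>\<^sub>h y + x \<otimes>\<^sub>h y'"
  by transfer (auto simp: cinner_add_right algebra_simps)

lemma htens_scaleC_left: "(c *\<^sub>C x) \<otimes>\<^sub>h y = c *\<^sub>C (x \<otimes>\<^sub>h y)"
  by transfer (auto simp: cinner_scaleC_right)

lemma htens_scaleC_right: "x \<otimes>\<^sub>h (c *\<^sub>C y) = c *\<^sub>C (x \<otimes>\<^sub>h y)"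
  by transfer (auto simp: cinner_scaleC_right)

lemma cinner_htens: "cinner (x \<otimes>\<^sub>h y) (x' \<otimes>\<^sub>h y') = cinner x x' * cinner y y'"
proof -
  let ?B = "some_onb :: 'a set" and ?C = "some_onb :: 'b set"
  let ?g = "\<lambda>(b, c). (cinner x b * cinner b x') * (cinner y c * cinner c y')"
  have "cinner (x \<otimes>\<^sub>h y) (x' \<otimes>\<^sub>h y') = infsum ?g (?B \<times> ?C)"
    unfolding cinner_htensor.rep_eq htens.rep_eq
    by (rule infsum_cong_neutral) (auto split: if_splits simp flip: cinner_commute)
  also have "\<dots> = (\<Sum>\<^sub>\<infinity>b\<in>?B. \<Sum>\<^sub>\<infinity>c\<in>?C. (cinner x b * cinner b x') * (cinner y c * cinner c y'))"
  proof (rule infsum_Sigma'_banach[symmetric])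
    let ?h = "\<lambda>p. Rep_htensor (x \<otimes>\<^sub>h y) p" and ?k = "\<lambda>p. Rep_htensor (x' \<otimes>\<^sub>h y') p"
    have "(\<lambda>p. cnj (?h p) * ?k p) summable_on UNIV"
      by (intro sqsum_mult sqsum_htensor)
    then show "(\<lambda>(b, c). (cinner x b * cinner b x') * (cinner y c * cinner c y')) summable_on ?B \<times> ?C"
      by (rule summable_on_cong_neutral[THEN iffD1, rotated -1])
         (auto simp: htens.rep_eq split: if_splits simp flip: cinner_commute)
  qed
  also have "\<dots> = (\<Sum>\<^sub>\<infinity>b\<in>?B. (cinner x b * cinner b x') * cinner y y')"
    by (simp add: infsum_cmult_right' infsumI[OF parseval])
  also have "\<dots> = cinner x x' * cinner y y'"
    by (simp add: infsum_cmult_left' infsumI[OF parseval])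
  finally show ?thesis .
qed

lemma norm_htens: "norm (x \<otimes>\<^sub>h y) = norm x * norm y"
proof -
  have "complex_of_real ((norm (x \<otimes>\<^sub>h y))\<^sup>2) = complex_of_real ((norm x * norm y)\<^sup>2)"
    unfolding cinner_self[symmetric] cinner_htens by (simp add: cinner_self power_mult_distrib)
  then show ?thesis
    unfolding of_real_eq_iff by (simp add: power2_eq_iff_nonneg)
qed

lemma htens_onb_expansion:
  "((\<lambda>(b, c). Rep_htensor f (b, c) *\<^sub>C (b \<otimes>\<^sub>h c)) has_sum f) (some_onb \<times> some_onb)"
proof -
  let ?D = "some_onb \<times> some_onb :: ('a \<times> 'b) set"
  let ?t = "\<lambda>p. fst p \<otimes>\<^sub>h snd p"
  let ?r = "Rep_htensor f"
  have Rt: "Rep_htensor (?t p) q = (if q = p then 1 else 0)" if p: "p \<in> ?D" for p q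
  proof -
    obtain b c b' c' where pq: "p = (b, c)" "q = (b', c')" by (cases p, cases q)
    show ?thesis
      using p some_onb(1)[where 'a = 'a] some_onb(1)[where 'a = 'b]
      unfolding pq htens.rep_eq orthonormal_def
      by (auto simp: cinner_self)
  qed
  have coord: "cinner (?t p) g = Rep_htensor g p" if p: "p \<in> ?D" for p g
  proof -
    have "cinner (?t p) g = infsum (\<lambda>q. cnj (Rep_htensor (?t p) q) * Rep_htensor g q) {p}"
      unfolding cinner_htensor.rep_eq by (rule infsum_cong_neutral) (auto simp: Rt[OF p])
    then show ?thesis by (simp add: Rt[OF p])
  qed
  have ortho: "orthonormal (?t ` ?D)"
    unfolding orthonormal_def
  proof (intro conjI ballI impI)
    show "norm x = 1" if "x \<in> ?t ` ?D" for x
      using that some_onb(1)[where 'a = 'a] some_onb(1)[where 'a = 'b]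
      by (auto simp: norm_htens orthonormal_def)
    fix x y assume "x \<in> ?t ` ?D" "y \<in> ?t ` ?D" "x \<noteq> y"
    then obtain p q where "x = ?t p" "y = ?t q" "p \<in> ?D" "q \<in> ?D" "p \<noteq> q" by blast
    then show "cinner x y = 0" by (simp add: coord Rt)
  qed
  have inj: "inj_on ?t ?D"
  proof (rule inj_onI)
    fix p q assume "p \<in> ?D" "q \<in> ?D" "?t p = ?t q"
    then show "p = q" by (metis Rt zero_neq_one)
  qed
  have "(\<lambda>x. cinner x f *\<^sub>C x) summable_on ?t ` ?D"
    by (intro orthonormal_summable bessel_summable ortho)
  then have "(\<lambda>p. cinner (?t p) f *\<^sub>C ?t p) summable_on ?D"
    by (simp add: summable_on_reindex[OF inj] o_def)
  then have "(\<lambda>p. ?r p *\<^sub>C ?t p) summable_on ?D"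
    by (simp add: coord cong: summable_on_cong)
  then obtain g where g: "((\<lambda>p. ?r p *\<^sub>C ?t p) has_sum g) ?D"
    by (auto simp: summable_on_def)
  have "Rep_htensor g q = ?r q" for q
  proof (cases "q \<in> ?D")
    case False
    then have "Rep_htensor g q = 0" "?r q = 0"
      using Rep_htensor[of g] Rep_htensor[of f] by blast+
    then show ?thesis by simp
  next
    case True
    have "((\<lambda>p. cinner (?t q) (?r p *\<^sub>C ?t p)) has_sum cinner (?t q) g) ?D"
      by (rule has_sum_bounded_linear[OF bounded_linear_cinner_right g])
    moreover have "((\<lambda>p. cinner (?t q) (?r p *\<^sub>C ?t p)) has_sum ?r q) ?D"
    proof (rule has_sum_cong_neutral[THEN iffD1, rotated -1])
      show "((\<lambda>p. cinner (?t q) (?r p *\<^sub>C ?t p)) has_sum ?r q) {q}"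
        using has_sum_finite[of "{q}" "\<lambda>p. cinner (?t q) (?r p *\<^sub>C ?t p)"] True
        by (simp add: cinner_scaleC_right coord Rt)
    qed (use True in \<open>auto simp: cinner_scaleC_right coord Rt\<close>)
    ultimately have "cinner (?t q) g = ?r q"
      by (rule has_sum_unique)
    then show ?thesis by (simp only: coord[OF True])
  qed
  then have "g = f" by (simp add: Rep_htensor_inject[symmetric] fun_eq_iff)
  with g show ?thesis by (simp add: case_prod_unfold)
qed

lemma htens_dense: "closure (cvs.span {x \<otimes>\<^sub>h y |x y. True}) = UNIV"
proof -
  let ?S = "cvs.span {x \<otimes>\<^sub>h y |x y. True}"
  have "f \<in> closure ?S" for f
  proof -
    let ?s = "sum (\<lambda>(b, c). Rep_htensor f (b, c) *\<^sub>C (b \<otimes>\<^sub>h c))"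
    have "(?s \<longlongrightarrow> f) (finite_subsets_at_top (some_onb \<times> some_onb))"
      using htens_onb_expansion[of f] by (simp add: has_sum_def)
    moreover have "?s F \<in> ?S" for F
      unfolding case_prod_unfold
      by (intro cvs.span_sum cvs.span_scale cvs.span_base) auto
    then have "\<forall>\<^sub>F F in finite_subsets_at_top (some_onb \<times> some_onb). ?s F \<in> closure ?S"
      using closure_subset by (intro always_eventually) blast
    ultimately show ?thesis
      by (intro Lim_in_closed_set[of "closure ?S" ?s]) auto
  qed
  then show ?thesis by blast
qed

section \<open>C*-algebras\<close>

text \<open>The zero algebra is not excluded.\<close>

class unital_cstar_algebra = complex_vector + banach + real_normed_algebra + monoid_mult +
  fixes star :: "'a \<Rightarrow> 'a" (\<open>_\<^sup>\<star>\<close> [1000] 999)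
  assumes mult_scaleC_left: "(c *\<^sub>C x) * y = c *\<^sub>C (x * y)"
    and mult_scaleC_right: "x * (c *\<^sub>C y) = c *\<^sub>C (x * y)"
    and norm_scaleC_cstar: "norm (c *\<^sub>C x) = cmod c * norm x"
    and star_star [simp]: "(x\<^sup>\<star>)\<^sup>\<star> = x"
    and star_add: "(x + y)\<^sup>\<star> = x\<^sup>\<star> + y\<^sup>\<star>"
    and star_scaleC: "(c *\<^sub>C x)\<^sup>\<star> = cnj c *\<^sub>C x\<^sup>\<star>"
    and star_mult: "(x * y)\<^sup>\<star> = y\<^sup>\<star> * x\<^sup>\<star>"
    and cstar_identity: "norm (x\<^sup>\<star> * x) = (norm x)\<^sup>2"

text \<open>\<open>x\<close> is a positive element of the C*-subalgebra \<open>B\<close>.\<close>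

definition positive_in :: "'a :: unital_cstar_algebra set \<Rightarrow> 'a \<Rightarrow> bool" where
  "positive_in B x \<longleftrightarrow> (\<exists>b\<in>B. x = b\<^sup>\<star> * b)"

definition star_hom_on ::
    "'a :: unital_cstar_algebra set \<Rightarrow> ('a \<Rightarrow> 'b :: unital_cstar_algebra) \<Rightarrow> bool" where
  "star_hom_on B \<phi> \<longleftrightarrow>
     (\<forall>x\<in>B. \<forall>y\<in>B. \<phi> (x + y) = \<phi> x + \<phi> y) \<and>
     (\<forall>c. \<forall>x\<in>B. \<phi> (c *\<^sub>C x) = c *\<^sub>C \<phi> x) \<and>
     (\<forall>x\<in>B. \<forall>y\<in>B. \<phi> (x * y) = \<phi> x * \<phi> y) \<and>
     (\<forall>x\<in>B. \<phi> (x\<^sup>\<star>) = (\<phi> x)\<^sup>\<star>)"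

subsection \<open>Direct sums\<close>

datatype ('a, 'b) dsum (infixr \<open>\<oplus>\<^sub>A\<close> 20) = DSum (dfst: 'a) (dsnd: 'b)

instantiation dsum :: (complex_vector, complex_vector) complex_vector
begin

definition zero_dsum :: "('a, 'b) dsum" where "0 = DSum 0 0"
definition plus_dsum :: "('a, 'b) dsum \<Rightarrow> ('a, 'b) dsum \<Rightarrow> ('a, 'b) dsum" where
  "x + y = DSum (dfst x + dfst y) (dsnd x + dsnd y)"
definition minus_dsum :: "('a, 'b) dsum \<Rightarrow> ('a, 'b) dsum \<Rightarrow> ('a, 'b) dsum" where
  "x - y = DSum (dfst x - dfst y) (dsnd x - dsnd y)"
definition uminus_dsum :: "('a, 'b) dsum \<Rightarrow> ('a, 'b) dsum" where
  "- x = DSum (- dfst x) (- dsnd x)"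
definition scaleR_dsum :: "real \<Rightarrow> ('a, 'b) dsum \<Rightarrow> ('a, 'b) dsum" where
  "r *\<^sub>R x = DSum (r *\<^sub>R dfst x) (r *\<^sub>R dsnd x)"
definition scaleC_dsum :: "complex \<Rightarrow> ('a, 'b) dsum \<Rightarrow> ('a, 'b) dsum" where
  "c *\<^sub>C x = DSum (c *\<^sub>C dfst x) (c *\<^sub>C dsnd x)"

instance
  by standard (auto simp: zero_dsum_def plus_dsum_def minus_dsum_def uminus_dsum_def
      scaleR_dsum_def scaleC_dsum_def dsum.expand scaleR_add_left scaleR_add_right
      scaleC_add_left scaleC_add_right scaleR_scaleC)

end

lemma dsum_vector_sel [simp]:
  "dfst 0 = 0" "dsnd 0 = 0"
  "dfst (x + y) = dfst x + dfst y" "dsnd (x + y) = dsnd x + dsnd y"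
  "dfst (x - y) = dfst x - dfst y" "dsnd (x - y) = dsnd x - dsnd y"
  "dfst (- x) = - dfst x" "dsnd (- x) = - dsnd x"
  "dfst (r *\<^sub>R x) = r *\<^sub>R dfst x" "dsnd (r *\<^sub>R x) = r *\<^sub>R dsnd x"
  "dfst (c *\<^sub>C x) = c *\<^sub>C dfst x" "dsnd (c *\<^sub>C x) = c *\<^sub>C dsnd x"
  by (simp_all add: zero_dsum_def plus_dsum_def minus_dsum_def uminus_dsum_def
      scaleR_dsum_def scaleC_dsum_def)

instantiation dsum :: (unital_cstar_algebra, unital_cstar_algebra) real_normed_vector
begin

definition norm_dsum :: "('a, 'b) dsum \<Rightarrow> real" where
  "norm x = max (norm (dfst x)) (norm (dsnd x))"
definition sgn_dsum :: "('a, 'b) dsum \<Rightarrow> ('a, 'b) dsum" where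
  "sgn x = inverse (norm x) *\<^sub>R x" for x :: "('a, 'b) dsum"
definition dist_dsum :: "('a, 'b) dsum \<Rightarrow> ('a, 'b) dsum \<Rightarrow> real" where
  "dist x y = norm (x - y)" for x y :: "('a, 'b) dsum"
definition uniformity_dsum :: "(('a, 'b) dsum \<times> ('a, 'b) dsum) filter" where
  "uniformity_dsum = (INF e\<in>{0 <..}. principal {(x, y). dist x y < e})"
definition open_dsum :: "('a, 'b) dsum set \<Rightarrow> bool" where
  "open_dsum U \<longleftrightarrow> (\<forall>x\<in>U. eventually (\<lambda>(x', y). x' = x \<longrightarrow> y \<in> U) uniformity)"

instance
proof
  fix x y :: "('a, 'b) dsum" and r :: real
  show "norm x = 0 \<longleftrightarrow> x = 0"
  proof
    assume "norm x = 0"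
    then have "norm (dfst x) \<le> 0" "norm (dsnd x) \<le> 0"
      by (simp_all add: norm_dsum_def max_def split: if_splits)
    then show "x = 0" by (simp add: dsum.expand)
  qed (simp add: norm_dsum_def)
  show "norm (x + y) \<le> norm x + norm y"
    using norm_triangle_ineq[of "dfst x" "dfst y"] norm_triangle_ineq[of "dsnd x" "dsnd y"]
    by (simp add: norm_dsum_def max_def)
  show "norm (r *\<^sub>R x) = \<bar>r\<bar> * norm x"
    by (simp add: norm_dsum_def max_mult_distrib_left)
qed (auto simp: sgn_dsum_def dist_dsum_def uniformity_dsum_def open_dsum_def)

end

instantiation dsum :: (unital_cstar_algebra, unital_cstar_algebra) unital_cstar_algebra
begin

definition times_dsum :: "('a, 'b) dsum \<Rightarrow> ('a, 'b) dsum \<Rightarrow> ('a, 'b) dsum" where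
  "x * y = DSum (dfst x * dfst y) (dsnd x * dsnd y)"
definition one_dsum :: "('a, 'b) dsum" where "1 = DSum 1 1"
definition star_dsum :: "('a, 'b) dsum \<Rightarrow> ('a, 'b) dsum" where
  "x\<^sup>\<star> = DSum ((dfst x)\<^sup>\<star>) ((dsnd x)\<^sup>\<star>)"

instance
proof
  fix x y z :: "('a, 'b) dsum" and r :: real and c :: complex
  show "x * y * z = x * (y * z)" by (simp add: times_dsum_def mult.assoc)
  show "1 * x = x" "x * 1 = x" by (simp_all add: times_dsum_def one_dsum_def)
  show "(x + y) * z = x * z + y * z" "x * (y + z) = x * y + x * z"
    by (simp_all add: times_dsum_def dsum.expand distrib_left distrib_right)
  show "r *\<^sub>R x * y = r *\<^sub>R (x * y)" "x * r *\<^sub>R y = r *\<^sub>R (x * y)"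
    by (simp_all add: times_dsum_def dsum.expand)
  show "c *\<^sub>C x * y = c *\<^sub>C (x * y)" "x * c *\<^sub>C y = c *\<^sub>C (x * y)"
    by (simp_all add: times_dsum_def dsum.expand mult_scaleC_left mult_scaleC_right)
  show "norm (c *\<^sub>C x) = cmod c * norm x"
    by (simp add: norm_dsum_def norm_scaleC_cstar max_mult_distrib_left)
  show "(x\<^sup>\<star>)\<^sup>\<star> = x" by (simp add: star_dsum_def)
  show "(x + y)\<^sup>\<star> = x\<^sup>\<star> + y\<^sup>\<star>" by (simp add: star_dsum_def dsum.expand star_add)
  show "(c *\<^sub>C x)\<^sup>\<star> = cnj c *\<^sub>C x\<^sup>\<star>" by (simp add: star_dsum_def dsum.expand star_scaleC)
  show "(x * y)\<^sup>\<star> = y\<^sup>\<star> * x\<^sup>\<star>" by (simp add: star_dsum_def times_dsum_def star_mult)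
  show "norm (x * y) \<le> norm x * norm y"
  proof -
    have "norm (dfst x * dfst y) \<le> norm x * norm y"
      by (rule order_trans[OF norm_mult_ineq]) (auto simp: norm_dsum_def le_max_iff_disj intro!: mult_mono)
    moreover have "norm (dsnd x * dsnd y) \<le> norm x * norm y"
      by (rule order_trans[OF norm_mult_ineq]) (auto simp: norm_dsum_def le_max_iff_disj intro!: mult_mono)
    ultimately show ?thesis by (simp add: times_dsum_def norm_dsum_def)
  qed
  have "max a b ^ 2 = max (a ^ 2) (b ^ 2)" if "0 \<le> a" "0 \<le> b" for a b :: real
    using that by (auto simp: max_def)
  then show "norm (x\<^sup>\<star> * x) = (norm x)\<^sup>2"
    by (simp add: times_dsum_def star_dsum_def norm_dsum_def cstar_identity)
next
  fix X :: "nat \<Rightarrow> ('a, 'b) dsum"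
  assume X: "Cauchy X"
  have le: "norm (dfst x) \<le> norm x" "norm (dsnd x) \<le> norm x" for x :: "('a, 'b) dsum"
    by (auto simp: norm_dsum_def)
  have "Cauchy (\<lambda>n. dfst (X n))" "Cauchy (\<lambda>n. dsnd (X n))"
  proof -
    have *: "\<exists>M. \<forall>m\<ge>M. \<forall>n\<ge>M. norm (dfst (X m) - dfst (X n)) < e \<and> norm (dsnd (X m) - dsnd (X n)) < e"
      if e: "e > 0" for e
    proof -
      obtain M where M: "\<And>m n. m \<ge> M \<Longrightarrow> n \<ge> M \<Longrightarrow> norm (X m - X n) < e"
        using CauchyD[OF X e] by blast
      have "norm (dfst (X m) - dfst (X n)) < e \<and> norm (dsnd (X m) - dsnd (X n)) < e"
        if "m \<ge> M" "n \<ge> M" for m n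
        using M[OF that] le[of "X m - X n"] by simp
      then show ?thesis by blast
    qed
    show "Cauchy (\<lambda>n. dfst (X n))"
    proof (rule CauchyI)
      fix e :: real assume "e > 0"
      from *[OF this] show "\<exists>M. \<forall>m\<ge>M. \<forall>n\<ge>M. norm (dfst (X m) - dfst (X n)) < e" by blast
    qed
    show "Cauchy (\<lambda>n. dsnd (X n))"
    proof (rule CauchyI)
      fix e :: real assume "e > 0"
      from *[OF this] show "\<exists>M. \<forall>m\<ge>M. \<forall>n\<ge>M. norm (dsnd (X m) - dsnd (X n)) < e" by blast
    qed
  qed
  then obtain a b where ab: "(\<lambda>n. dfst (X n)) \<longlonglongrightarrow> a" "(\<lambda>n. dsnd (X n)) \<longlonglongrightarrow> b"
    using Cauchy_convergent convergent_def by metis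
  have "(\<lambda>n. max (norm (dfst (X n) - a)) (norm (dsnd (X n) - b))) \<longlonglongrightarrow> max 0 0"
    using ab by (intro tendsto_max) (simp_all add: LIM_zero tendsto_norm_zero)
  then have "(\<lambda>n. norm (X n - DSum a b)) \<longlonglongrightarrow> 0"
    by (simp add: norm_dsum_def)
  then have "X \<longlonglongrightarrow> DSum a b"
    by (simp add: tendsto_norm_zero_iff LIM_zero_iff)
  then show "convergent X" by (rule convergentI)
qed

end

subsection \<open>Bounded operators on a Hilbert space\<close>

typedef (overloaded) 'a bop =
  "{f :: 'a :: chilbert_space \<Rightarrow> 'a. bounded_linear f \<and> (\<forall>c x. f (c *\<^sub>C x) = c *\<^sub>C f x)}"
  morphisms bop_apply Bop
  by (rule exI[of _ "\<lambda>_. 0"]) (simp add: bounded_linear_zero)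

setup_lifting type_definition_bop

notation bop_apply (infixr \<open>*\<^sub>V\<close> 70)

lemma bop_eqI: "(\<And>x. S *\<^sub>V x = T *\<^sub>V x) \<Longrightarrow> S = T"
  by transfer auto

lemma bop_bounded_linear: "bounded_linear (bop_apply T)"
  and bop_scaleC: "T *\<^sub>V (c *\<^sub>C x) = c *\<^sub>C (T *\<^sub>V x)"
  using bop_apply[of T] by auto

lemmas bop_add = linear_add[OF bounded_linear.linear[OF bop_bounded_linear]]
lemmas bop_zero [simp] = linear_0[OF bounded_linear.linear[OF bop_bounded_linear]]

lemma bounded_linear_scaleC: "bounded_linear (\<lambda>x :: 'a :: complex_inner. c *\<^sub>C x)"
  by (rule bounded_linear_intro[where K = "cmod c"])
     (auto simp: scaleC_add_right scaleR_scaleC norm_scaleC mult.commute)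

instantiation bop :: (chilbert_space) complex_vector
begin

lift_definition zero_bop :: "'a bop" is "\<lambda>_. 0"
  by (simp add: bounded_linear_zero)
lift_definition plus_bop :: "'a bop \<Rightarrow> 'a bop \<Rightarrow> 'a bop" is "\<lambda>S T x. S x + T x"
  by (simp add: bounded_linear_add scaleC_add_right)
lift_definition minus_bop :: "'a bop \<Rightarrow> 'a bop \<Rightarrow> 'a bop" is "\<lambda>S T x. S x - T x"
  by (simp add: bounded_linear_sub cvs.scale_right_diff_distrib)
lift_definition uminus_bop :: "'a bop \<Rightarrow> 'a bop" is "\<lambda>S x. - S x"
  by (simp add: bounded_linear_minus)
lift_definition scaleR_bop :: "real \<Rightarrow> 'a bop \<Rightarrow> 'a bop" is "\<lambda>r S x. r *\<^sub>R S x"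
  by (auto simp: scaleR_scaleC mult.commute intro: bounded_linear_compose[OF bounded_linear_scaleC])
lift_definition scaleC_bop :: "complex \<Rightarrow> 'a bop \<Rightarrow> 'a bop" is "\<lambda>c S x. c *\<^sub>C S x"
  by (auto simp: mult.commute intro: bounded_linear_compose[OF bounded_linear_scaleC])

instance
  by standard
     (transfer; auto simp: scaleC_add_left scaleC_add_right scaleR_add_left scaleR_add_right
        scaleR_scaleC)+

end

instantiation bop :: (chilbert_space) real_normed_vector
begin

lift_definition norm_bop :: "'a bop \<Rightarrow> real" is onorm .
definition sgn_bop :: "'a bop \<Rightarrow> 'a bop" where
  "sgn T = inverse (norm T) *\<^sub>R T" for T :: "'a bop"
definition dist_bop :: "'a bop \<Rightarrow> 'a bop \<Rightarrow> real" where
  "dist S T = norm (S - T)" for S T :: "'a bop"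
definition uniformity_bop :: "('a bop \<times> 'a bop) filter" where
  "uniformity_bop = (INF e\<in>{0 <..}. principal {(x, y). dist x y < e})"
definition open_bop :: "'a bop set \<Rightarrow> bool" where
  "open_bop U \<longleftrightarrow> (\<forall>x\<in>U. eventually (\<lambda>(x', y). x' = x \<longrightarrow> y \<in> U) uniformity)"

instance
proof
  fix S T :: "'a bop" and r :: real
  show "norm T = 0 \<longleftrightarrow> T = 0"
    by transfer (auto simp: onorm_eq_0 fun_eq_iff)
  show "norm (S + T) \<le> norm S + norm T"
    by transfer (auto intro: onorm_triangle)
  show "norm (r *\<^sub>R T) = \<bar>r\<bar> * norm T"
    by transfer (auto intro: onorm_scaleR)
qed (auto simp: sgn_bop_def dist_bop_def uniformity_bop_def open_bop_def)

end

lemma norm_bop_apply: "norm (T *\<^sub>V x) \<le> norm T * norm x"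
  by transfer (auto intro: onorm)

lemma norm_bop_bound: "(\<And>x. norm (T *\<^sub>V x) \<le> b * norm x) \<Longrightarrow> 0 \<le> b \<Longrightarrow> norm T \<le> b"
  by transfer (auto intro: onorm_bound)

lemma riesz:
  fixes f :: "'a :: chilbert_space \<Rightarrow> complex"
  assumes f: "bounded_linear f" and fC: "\<And>c x. f (c *\<^sub>C x) = c * f x"
  shows "\<exists>y. \<forall>x. f x = cinner y x"
proof -
  let ?B = "some_onb :: 'a set"
  interpret f: bounded_linear f by (rule f)
  obtain K where K: "K > 0" "\<And>x. norm (f x) \<le> norm x * K"
    using f.pos_bounded by blast
  have bound: "(\<Sum>b\<in>F. (cmod (cnj (f b)))\<^sup>2) \<le> K\<^sup>2" if F: "finite F" "F \<subseteq> ?B" for F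
  proof -
    define v where "v = (\<Sum>b\<in>F. cnj (f b) *\<^sub>C b)"
    have nv: "(norm v)\<^sup>2 = (\<Sum>b\<in>F. (cmod (cnj (f b)))\<^sup>2)"
      unfolding v_def by (rule orthonormal_norm_sum[OF some_onb(1) F])
    have "f v = complex_of_real ((norm v)\<^sup>2)"
      unfolding nv of_real_sum complex_norm_square by (simp add: v_def f.sum fC)
    then have "cmod (f v) = (norm v)\<^sup>2"
      by (metis abs_of_nonneg norm_of_real zero_le_power2)
    then have "norm v * norm v \<le> norm v * K"
      using K(2)[of v] by (simp add: power2_eq_square)
    then have "norm v \<le> K"
      using K(1) by (cases "norm v = 0") auto
    then have "(norm v)\<^sup>2 \<le> K\<^sup>2" by (intro power_mono) auto
    then show ?thesis by (simp add: nv)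
  qed
  have "(\<lambda>b. (cmod (cnj (f b)))\<^sup>2) summable_on ?B"
    by (rule nonneg_bounded_partial_sums_imp_summable_on[where C = "K\<^sup>2"])
       (auto intro!: eventually_finite_subsets_at_top_weakI simp: bound simp del: complex_mod_cnj)
  then have "(\<lambda>b. cnj (f b) *\<^sub>C b) summable_on ?B"
    by (rule orthonormal_summable[OF some_onb(1)])
  then obtain y where y: "((\<lambda>b. cnj (f b) *\<^sub>C b) has_sum y) ?B"
    by (auto simp: summable_on_def)
  have "f x = cinner y x" for x
  proof (rule has_sum_unique)
    show "((\<lambda>b. f (cinner b x *\<^sub>C b)) has_sum f x) ?B"
      by (rule has_sum_bounded_linear[OF f onb_expansion])
    show "((\<lambda>b. f (cinner b x *\<^sub>C b)) has_sum cinner y x) ?B"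
      using has_sum_bounded_linear[OF bounded_linear_cinner_left y, of x]
      by (simp add: fC cinner_scaleC_left mult.commute)
  qed
  then show ?thesis by blast
qed

lemma cinner_eqI: "(\<And>z. cinner x z = cinner y z) \<Longrightarrow> x = (y :: 'a :: complex_inner)"
proof -
  assume "\<And>z. cinner x z = cinner y z"
  then have "cinner (x - y) (x - y) = 0" by (simp add: cinner_diff_left)
  then show "x = y" by (simp add: cinner_self)
qed

lemma adjoint_exists:
  "\<exists>S :: 'a :: chilbert_space bop. \<forall>x y. cinner (S *\<^sub>V x) y = cinner x (T *\<^sub>V y)"
proof -
  have "\<exists>z. \<forall>y. cinner x (T *\<^sub>V y) = cinner z y" for x
    by (rule riesz)
       (auto intro: bounded_linear_compose[OF bounded_linear_cinner_right bop_bounded_linear]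
         simp: bop_scaleC cinner_scaleC_right)
  then obtain S where S: "\<And>x y. cinner x (T *\<^sub>V y) = cinner (S x) y" by metis
  have add: "S (x + y) = S x + S y" for x y
    by (rule cinner_eqI) (simp add: cinner_add_left flip: S)
  have sc: "S (c *\<^sub>C x) = c *\<^sub>C S x" for c x
    by (rule cinner_eqI) (simp add: cinner_scaleC_left flip: S)
  have bnd: "norm (S x) \<le> norm x * norm T" for x
  proof -
    have "norm (S x) * norm (S x) = cmod (cinner (S x) (S x))"
      unfolding cinner_self norm_of_real by (simp add: power2_eq_square)
    also have "\<dots> = cmod (cinner x (T *\<^sub>V S x))" by (simp add: S)
    also have "\<dots> \<le> norm x * norm (T *\<^sub>V S x)" by (rule cmod_cinner_le)
    also have "\<dots> \<le> norm x * (norm T * norm (S x))"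
      by (intro mult_left_mono norm_bop_apply) auto
    finally have "norm (S x) * norm (S x) \<le> norm x * norm T * norm (S x)"
      by (simp add: mult.assoc)
    then show ?thesis
      by (cases "norm (S x) = 0") auto
  qed
  have "bounded_linear S"
    by (rule bounded_linear_intro[where K = "norm T"]) (auto simp: add sc scaleR_scaleC bnd)
  then have "bop_apply (Bop S) = S"
    by (intro Bop_inverse) (simp add: sc)
  then show ?thesis using S by metis
qed

lemma adjoint_ex1:
  "\<exists>!S :: 'a :: chilbert_space bop. \<forall>x y. cinner (S *\<^sub>V x) y = cinner x (T *\<^sub>V y)"
proof (rule ex_ex1I[OF adjoint_exists])
  fix S S' :: "'a bop"
  assume *: "\<forall>x y. cinner (S *\<^sub>V x) y = cinner x (T *\<^sub>V y)"
    "\<forall>x y. cinner (S' *\<^sub>V x) y = cinner x (T *\<^sub>V y)"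
  show "S = S'"
    by (rule bop_eqI, rule cinner_eqI) (simp only: *)
qed

instantiation bop :: (chilbert_space) unital_cstar_algebra
begin

lift_definition one_bop :: "'a bop" is "\<lambda>x. x"
  by (simp add: bounded_linear_ident)
lift_definition times_bop :: "'a bop \<Rightarrow> 'a bop \<Rightarrow> 'a bop" is "\<lambda>S T x. S (T x)"
  by (auto intro: bounded_linear_compose)
definition star_bop :: "'a bop \<Rightarrow> 'a bop" where
  "T\<^sup>\<star> = (THE S. \<forall>x y. cinner (S *\<^sub>V x) y = cinner x (T *\<^sub>V y))"

instance
proof
  have st: "cinner (T\<^sup>\<star> *\<^sub>V x) y = cinner x (T *\<^sub>V y)" for T :: "'a bop" and x y
    using theI'[OF adjoint_ex1[of T]] by (simp add: star_bop_def)
  have st': "cinner x (T\<^sup>\<star> *\<^sub>V y) = cinner (T *\<^sub>V x) y" for T :: "'a bop" and x y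
    by (subst (1 2) cinner_commute) (simp add: st)
  have starI: "S = T\<^sup>\<star>" if "\<And>x y. cinner (S *\<^sub>V x) y = cinner x (T *\<^sub>V y)" for S T :: "'a bop"
    by (rule bop_eqI, rule cinner_eqI) (simp only: that st)
  fix R S T :: "'a bop" and r :: real and c :: complex
  show "R * S * T = R * (S * T)" "1 * T = T" "T * 1 = T" "(R + S) * T = R * T + S * T"
    by (transfer; simp)+
  show "R * (S + T) = R * S + R * T"
    by transfer (auto simp: fun_eq_iff bounded_linear.linear linear_add)
  show "r *\<^sub>R S * T = r *\<^sub>R (S * T)" "c *\<^sub>C S * T = c *\<^sub>C (S * T)" "S * c *\<^sub>C T = c *\<^sub>C (S * T)"
    by (transfer; simp)+
  show "S * r *\<^sub>R T = r *\<^sub>R (S * T)"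
    by transfer (auto simp: fun_eq_iff bounded_linear.linear linear_cmul)
  show nm: "norm (S * T) \<le> norm S * norm T" for S T :: "'a bop"
    by transfer (use onorm_compose in \<open>auto simp: o_def\<close>)
  show "norm (c *\<^sub>C T) = cmod c * norm T"
  proof (rule antisym)
    have le: "norm (c *\<^sub>C T) \<le> cmod c * norm T" for c and T :: "'a bop"
      by (rule norm_bop_bound)
         (use norm_bop_apply[of T] in
           \<open>auto simp: scaleC_bop.rep_eq norm_scaleC mult.assoc intro!: mult_left_mono\<close>)
    show "norm (c *\<^sub>C T) \<le> cmod c * norm T" by (rule le)
    show "cmod c * norm T \<le> norm (c *\<^sub>C T)"
    proof (cases "c = 0")
      case False
      have "norm T \<le> cmod (1 / c) * norm (c *\<^sub>C T)"
        using le[of "1 / c" "c *\<^sub>C T"] False by simp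
      then show ?thesis using False by (simp add: norm_divide field_simps)
    qed simp
  qed
  show "(T\<^sup>\<star>)\<^sup>\<star> = T" by (rule starI[symmetric]) (simp add: st')
  show "(S + T)\<^sup>\<star> = S\<^sup>\<star> + T\<^sup>\<star>"
    by (rule starI[symmetric])
       (simp add: plus_bop.rep_eq cinner_add_left cinner_add_right st)
  show "(c *\<^sub>C T)\<^sup>\<star> = cnj c *\<^sub>C T\<^sup>\<star>"
    by (rule starI[symmetric])
       (simp add: scaleC_bop.rep_eq cinner_scaleC_left cinner_scaleC_right st)
  show "(S * T)\<^sup>\<star> = T\<^sup>\<star> * S\<^sup>\<star>"
    by (rule starI[symmetric]) (simp add: times_bop.rep_eq st)
  have sn: "norm (T\<^sup>\<star>) \<le> norm T" for T :: "'a bop"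
  proof (rule norm_bop_bound)
    fix x
    have "norm (T\<^sup>\<star> *\<^sub>V x) * norm (T\<^sup>\<star> *\<^sub>V x) = cmod (cinner (T\<^sup>\<star> *\<^sub>V x) (T\<^sup>\<star> *\<^sub>V x))"
      unfolding cinner_self norm_of_real by (simp add: power2_eq_square)
    also have "\<dots> = cmod (cinner x (T *\<^sub>V T\<^sup>\<star> *\<^sub>V x))" by (simp add: st)
    also have "\<dots> \<le> norm x * norm (T *\<^sub>V T\<^sup>\<star> *\<^sub>V x)" by (rule cmod_cinner_le)
    also have "\<dots> \<le> norm x * (norm T * norm (T\<^sup>\<star> *\<^sub>V x))"
      by (intro mult_left_mono norm_bop_apply) auto
    finally have "norm (T\<^sup>\<star> *\<^sub>V x) * norm (T\<^sup>\<star> *\<^sub>V x) \<le> norm T * norm x * norm (T\<^sup>\<star> *\<^sub>V x)"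
      by (simp add: mult.assoc mult.left_commute)
    then show "norm (T\<^sup>\<star> *\<^sub>V x) \<le> norm T * norm x"
      by (cases "norm (T\<^sup>\<star> *\<^sub>V x) = 0") auto
  qed auto
  show "norm (T\<^sup>\<star> * T) = (norm T)\<^sup>2"
  proof (rule antisym)
    show "norm (T\<^sup>\<star> * T) \<le> (norm T)\<^sup>2"
      unfolding power2_eq_square
      by (rule order_trans[OF nm]) (intro mult_right_mono sn norm_ge_zero)
    have "norm T \<le> sqrt (norm (T\<^sup>\<star> * T))"
    proof (rule norm_bop_bound)
      fix x
      have "(norm (T *\<^sub>V x))\<^sup>2 = cmod (cinner (T *\<^sub>V x) (T *\<^sub>V x))"
        unfolding cinner_self norm_of_real by simp
      also have "\<dots> = cmod (cinner x ((T\<^sup>\<star> * T) *\<^sub>V x))"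
        by (simp add: times_bop.rep_eq st')
      also have "\<dots> \<le> norm x * norm ((T\<^sup>\<star> * T) *\<^sub>V x)" by (rule cmod_cinner_le)
      also have "\<dots> \<le> norm x * (norm (T\<^sup>\<star> * T) * norm x)"
        by (intro mult_left_mono norm_bop_apply) auto
      also have "\<dots> = (sqrt (norm (T\<^sup>\<star> * T)) * norm x)\<^sup>2"
        by (simp add: power_mult_distrib power2_eq_square[of "norm x"])
      finally have "(norm (T *\<^sub>V x))\<^sup>2 \<le> (sqrt (norm (T\<^sup>\<star> * T)) * norm x)\<^sup>2" .
      then show "norm (T *\<^sub>V x) \<le> sqrt (norm (T\<^sup>\<star> * T)) * norm x"
        by (rule power2_le_imp_le) auto
    qed auto
    then have "(norm T)\<^sup>2 \<le> (sqrt (norm (T\<^sup>\<star> * T)))\<^sup>2"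
      by (intro power_mono) auto
    then show "(norm T)\<^sup>2 \<le> norm (T\<^sup>\<star> * T)" by simp
  qed
next
  fix X :: "nat \<Rightarrow> 'a bop"
  assume X: "Cauchy X"
  let ?Y = "\<lambda>n. Blinfun (bop_apply (X n))"
  have Y: "blinfun_apply (?Y n) = bop_apply (X n)" for n
    by (rule bounded_linear_Blinfun_apply[OF bop_bounded_linear])
  have nY: "norm (?Y n - ?Y m) = norm (X n - X m)" for m n
    by (simp add: norm_blinfun.rep_eq norm_bop.rep_eq minus_blinfun.rep_eq minus_bop.rep_eq Y)
  have "Cauchy ?Y"
    using X by (simp add: Cauchy_iff nY)
  then obtain L where L: "?Y \<longlonglongrightarrow> L"
    using Cauchy_convergent convergent_def by blast
  have lim: "(\<lambda>n. X n *\<^sub>V x) \<longlonglongrightarrow> blinfun_apply L x" for x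
    using blinfun.tendsto[OF L tendsto_const, of x] by (simp add: Y)
  have "blinfun_apply L (c *\<^sub>C x) = c *\<^sub>C blinfun_apply L x" for c x
  proof (rule LIMSEQ_unique[OF lim])
    show "(\<lambda>n. X n *\<^sub>V c *\<^sub>C x) \<longlonglongrightarrow> c *\<^sub>C blinfun_apply L x"
      unfolding bop_scaleC by (rule bounded_linear.tendsto[OF bounded_linear_scaleC lim])
  qed
  then have BL: "bop_apply (Bop (blinfun_apply L)) = blinfun_apply L"
    by (intro Bop_inverse) (simp add: blinfun.bounded_linear_right)
  have "norm (X n - Bop (blinfun_apply L)) = norm (?Y n - L)" for n
    by (simp add: norm_blinfun.rep_eq norm_bop.rep_eq minus_blinfun.rep_eq minus_bop.rep_eq Y BL)
  then have "X \<longlonglongrightarrow> Bop (blinfun_apply L)"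
    using L by (simp add: LIMSEQ_iff)
  then show "convergent X" by (rule convergentI)
qed

end

lemma cinner_star: "cinner (T\<^sup>\<star> *\<^sub>V x) y = cinner x (T *\<^sub>V y)"
  using theI'[OF adjoint_ex1[of T]] by (simp add: star_bop_def)

lift_definition bop_sum ::
    "'a :: chilbert_space bop \<Rightarrow> 'b :: chilbert_space bop \<Rightarrow> ('a \<times> 'b) bop" (infixr \<open>\<oplus>\<^sub>o\<close> 65)
  is "\<lambda>S T x. (S (fst x), T (snd x))"
  by (auto simp: scaleC_prod_def intro!: bounded_linear_Pair
      intro: bounded_linear_compose[OF _ bounded_linear_fst] bounded_linear_compose[OF _ bounded_linear_snd])

definition bop_tensor ::
    "'a :: chilbert_space bop \<Rightarrow> 'b :: chilbert_space bop \<Rightarrow> ('a \<otimes>\<^sub>H 'b) bop" (infixr \<open>\<otimes>\<^sub>o\<close> 70)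
  where "S \<otimes>\<^sub>o T = (THE R. \<forall>x y. R *\<^sub>V (x \<otimes>\<^sub>h y) = (S *\<^sub>V x) \<otimes>\<^sub>h (T *\<^sub>V y))"

lemma onb_coeff_exists:
  assumes "(\<lambda>c. (cmod (g c))\<^sup>2) summable_on (some_onb :: 'a :: chilbert_space set)"
  shows "\<exists>v :: 'a. \<forall>c\<in>some_onb. cinner c v = g c"
proof -
  obtain v :: 'a where v: "((\<lambda>c. g c *\<^sub>C c) has_sum v) some_onb"
    using orthonormal_summable[OF some_onb(1) assms] by (auto simp: summable_on_def)
  have "cinner b v = g b" if b: "b \<in> some_onb" for b
  proof (rule has_sum_unique)
    show "((\<lambda>c. cinner b (g c *\<^sub>C c)) has_sum cinner b v) some_onb"
      by (rule has_sum_bounded_linear[OF bounded_linear_cinner_right v])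
    have nb: "norm b = 1" using b some_onb(1) by (auto simp: orthonormal_def)
    show "((\<lambda>c. cinner b (g c *\<^sub>C c)) has_sum g b) some_onb"
    proof (rule has_sum_cong_neutral[THEN iffD1, rotated -1])
      show "((\<lambda>c. cinner b (g c *\<^sub>C c)) has_sum g b) {b}"
        using has_sum_finite[of "{b}" "\<lambda>c. cinner b (g c *\<^sub>C c)"]
        by (simp add: cinner_scaleC_right cinner_self nb)
      show "cinner b (g c *\<^sub>C c) = 0" if "c \<in> some_onb - {b}" for c
        using that b some_onb(1) by (auto simp: orthonormal_def cinner_scaleC_right)
    qed (use b in auto)
  qed
  then show ?thesis by blast
qed

lemma onb_eqI:
  "(\<And>c. c \<in> some_onb \<Longrightarrow> cinner c v = cinner c w) \<Longrightarrow> v = (w :: 'a :: chilbert_space)"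
  using some_onb(2)[of "v - w"] by (simp add: cinner_diff_right)

lemma norm_parseval:
  "((\<lambda>b. (cmod (cinner b x))\<^sup>2) has_sum (norm (x :: 'a :: chilbert_space))\<^sup>2) some_onb"
proof -
  have "Re (cinner x b * cinner b x) = (cmod (cinner b x))\<^sup>2" for b
  proof -
    have "cinner x b * cinner b x = complex_of_real ((cmod (cinner b x))\<^sup>2)"
      unfolding complex_norm_square by (subst cinner_commute[of x b]) (simp only: mult.commute)
    then show ?thesis by simp
  qed
  with has_sum_bounded_linear[OF bounded_linear_Re parseval[of x x]]
  show ?thesis by (simp add: cinner_self)
qed

lemma norm_htensor_sq_onb:
  "((\<lambda>p. (cmod (Rep_htensor f p))\<^sup>2) has_sum (norm f)\<^sup>2) (some_onb \<times> some_onb)"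
proof -
  have "((\<lambda>p. (cmod (Rep_htensor f p))\<^sup>2) has_sum (norm f)\<^sup>2) UNIV"
    unfolding norm_htensor_sq by (rule has_sum_infsum[OF sqsum_htensor])
  moreover have "Rep_htensor f p = 0" if "p \<notin> some_onb \<times> some_onb" for p
    using Rep_htensor[of f] that by blast
  ultimately show ?thesis
    by (subst has_sum_cong_neutral[where T = UNIV and g = "\<lambda>p. (cmod (Rep_htensor f p))\<^sup>2"]) auto
qed

lemma Rep_htensor_scaleC: "Rep_htensor (c *\<^sub>C f) p = c * Rep_htensor f p"
  by (simp add: scaleC_htensor.rep_eq)

lemma Rep_htensor_add: "Rep_htensor (f + g) p = Rep_htensor f p + Rep_htensor g p"
  by (simp add: plus_htensor.rep_eq)

lemma htensor_eqI:
  assumes "\<And>b c. b \<in> some_onb \<Longrightarrow> c \<in> some_onb \<Longrightarrow> Rep_htensor f (b, c) = Rep_htensor g (b, c)"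
  shows "f = g"
proof -
  have "Rep_htensor f p = Rep_htensor g p" for p
  proof (cases "p \<in> some_onb \<times> some_onb")
    case True
    then show ?thesis using assms by (cases p) auto
  next
    case False
    then have "Rep_htensor f p = 0" "Rep_htensor g p = 0"
      using Rep_htensor[of f] Rep_htensor[of g] by blast+
    then show ?thesis by simp
  qed
  then show ?thesis by (simp add: Rep_htensor_inject[symmetric] fun_eq_iff)
qed

lemma bop_tensor_right_exists:
  fixes T :: "'b :: chilbert_space bop"
  shows "\<exists>R :: ('a :: chilbert_space \<otimes>\<^sub>H 'b) bop. \<forall>x y. R *\<^sub>V (x \<otimes>\<^sub>h y) = x \<otimes>\<^sub>h (T *\<^sub>V y)"
proof -
  let ?B = "some_onb :: 'a set" and ?C = "some_onb :: 'b set"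
  have summ: "(\<lambda>c. (cmod (Rep_htensor f (b, c)))\<^sup>2) summable_on ?C" if "b \<in> ?B"
    for f :: "'a \<otimes>\<^sub>H 'b" and b
    using summable_on_SigmaD1[of "\<lambda>b c. (cmod (Rep_htensor f (b, c)))\<^sup>2" ?B "\<lambda>_. ?C"]
      has_sum_imp_summable[OF norm_htensor_sq_onb[of f]] that by (simp add: case_prod_unfold)
  have "\<forall>f :: 'a \<otimes>\<^sub>H 'b. \<forall>b\<in>?B. \<exists>v. \<forall>c\<in>?C. cinner c v = Rep_htensor f (b, c)"
    by (intro allI ballI onb_coeff_exists summ)
  then obtain row where
    row: "\<And>(f :: 'a \<otimes>\<^sub>H 'b) b c. b \<in> ?B \<Longrightarrow> c \<in> ?C \<Longrightarrow> cinner c (row f b) = Rep_htensor f (b, c)"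
    by metis
  have rowI: "row f b = v"
    if "b \<in> ?B" "\<And>c. c \<in> ?C \<Longrightarrow> cinner c v = Rep_htensor f (b, c)" for f b v
    by (rule onb_eqI) (simp add: row that)
  let ?g = "\<lambda>f (b, c). if b \<in> ?B \<and> c \<in> ?C then cinner c (T *\<^sub>V row f b) else 0"
  have rowsum: "((\<lambda>b. (norm (row f b))\<^sup>2) has_sum (norm f)\<^sup>2) ?B" for f
  proof (rule has_sum_SigmaD[OF norm_htensor_sq_onb])
    fix b assume b: "b \<in> ?B"
    show "((\<lambda>c. (cmod (Rep_htensor f (b, c)))\<^sup>2) has_sum (norm (row f b))\<^sup>2) ?C"
      using norm_parseval[of "row f b"] row[OF b] by (simp cong: has_sum_cong)
  qed
  have Trow: "(\<lambda>b. (norm (T *\<^sub>V row f b))\<^sup>2) summable_on ?B" for f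
  proof (rule summable_on_comparison_test)
    show "(\<lambda>b. (norm T)\<^sup>2 * (norm (row f b))\<^sup>2) summable_on ?B"
      by (rule summable_on_cmult_right) (rule has_sum_imp_summable[OF rowsum])
    show "(norm (T *\<^sub>V row f b))\<^sup>2 \<le> (norm T)\<^sup>2 * (norm (row f b))\<^sup>2" for b
      unfolding power_mult_distrib[symmetric] by (intro power_mono norm_bop_apply) auto
  qed auto
  have gsum: "(\<lambda>p. (cmod (?g f p))\<^sup>2) summable_on ?B \<times> ?C" for f
    by (rule summable_on_SigmaI[where g = "\<lambda>b. (norm (T *\<^sub>V row f b))\<^sup>2", OF _ Trow])
       (auto intro: norm_parseval cong: has_sum_cong)
  have "?g f \<in> {h. (\<forall>p. p \<notin> ?B \<times> ?C \<longrightarrow> h p = 0) \<and> (\<lambda>p. (cmod (h p))\<^sup>2) summable_on UNIV}" for f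
  proof (intro CollectI conjI allI impI)
    show "?g f p = 0" if "p \<notin> ?B \<times> ?C" for p using that by (cases p) auto
    show "(\<lambda>p. (cmod (?g f p))\<^sup>2) summable_on UNIV"
      using gsum[of f]
      by (rule summable_on_cong_neutral[THEN iffD1, rotated -1]) (auto split: if_splits)
  qed
  from Abs_htensor_inverse[OF this]
  have "\<forall>f. \<exists>h. Rep_htensor h = ?g f" by blast
  then obtain R :: "('a \<otimes>\<^sub>H 'b) \<Rightarrow> ('a \<otimes>\<^sub>H 'b)" where R: "\<And>f. Rep_htensor (R f) = ?g f" by metis
  have Rbc: "Rep_htensor (R f) (b, c) = cinner c (T *\<^sub>V row f b)" if "b \<in> ?B" "c \<in> ?C" for f b c
    using that by (simp add: R)
  have add: "R (f + g) = R f + R g" for f g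
  proof (rule htensor_eqI)
    fix b c assume bc: "b \<in> ?B" "c \<in> ?C"
    have "row (f + g) b = row f b + row g b"
      by (rule rowI) (use bc in \<open>auto simp: cinner_add_right row Rep_htensor_add\<close>)
    then show "Rep_htensor (R (f + g)) (b, c) = Rep_htensor (R f + R g) (b, c)"
      using bc by (simp add: Rbc Rep_htensor_add bop_add cinner_add_right)
  qed
  have sc: "R (k *\<^sub>C f) = k *\<^sub>C R f" for k f
  proof (rule htensor_eqI)
    fix b c assume bc: "b \<in> ?B" "c \<in> ?C"
    have "row (k *\<^sub>C f) b = k *\<^sub>C row f b"
      by (rule rowI) (use bc in \<open>auto simp: cinner_scaleC_right row Rep_htensor_scaleC\<close>)
    then show "Rep_htensor (R (k *\<^sub>C f)) (b, c) = Rep_htensor (k *\<^sub>C R f) (b, c)"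
      using bc by (simp add: Rbc Rep_htensor_scaleC bop_scaleC cinner_scaleC_right)
  qed
  have bnd: "norm (R f) \<le> norm f * norm T" for f
  proof -
    have Rs: "((\<lambda>b. (norm (T *\<^sub>V row f b))\<^sup>2) has_sum (norm (R f))\<^sup>2) ?B"
    proof (rule has_sum_SigmaD[OF norm_htensor_sq_onb])
      fix b assume b: "b \<in> ?B"
      show "((\<lambda>c. (cmod (Rep_htensor (R f) (b, c)))\<^sup>2) has_sum (norm (T *\<^sub>V row f b))\<^sup>2) ?C"
        using norm_parseval[of "T *\<^sub>V row f b"] Rbc[OF b] by (simp cong: has_sum_cong)
    qed
    have "(norm (R f))\<^sup>2 \<le> (norm T)\<^sup>2 * (norm f)\<^sup>2"
    proof (rule has_sum_mono[OF Rs has_sum_cmult_right[OF rowsum]])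
      show "(norm (T *\<^sub>V row f b))\<^sup>2 \<le> (norm T)\<^sup>2 * (norm (row f b))\<^sup>2" for b
        unfolding power_mult_distrib[symmetric] by (intro power_mono norm_bop_apply) auto
    qed
    then have "(norm (R f))\<^sup>2 \<le> (norm f * norm T)\<^sup>2"
      by (simp add: power_mult_distrib mult.commute)
    then show ?thesis by (rule power2_le_imp_le) auto
  qed
  have "bounded_linear R"
    by (rule bounded_linear_intro[where K = "norm T"]) (auto simp: add sc scaleR_scaleC bnd)
  then have BR: "bop_apply (Bop R) = R"
    by (intro Bop_inverse) (simp add: sc)
  have "R (x \<otimes>\<^sub>h y) = x \<otimes>\<^sub>h (T *\<^sub>V y)" for x y
  proof (rule htensor_eqI)
    fix b c assume bc: "b \<in> ?B" "c \<in> ?C"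
    have "row (x \<otimes>\<^sub>h y) b = cinner b x *\<^sub>C y"
      by (rule rowI) (use bc in \<open>auto simp: cinner_scaleC_right htens.rep_eq\<close>)
    then show "Rep_htensor (R (x \<otimes>\<^sub>h y)) (b, c) = Rep_htensor (x \<otimes>\<^sub>h (T *\<^sub>V y)) (b, c)"
      using bc by (simp add: Rbc bop_scaleC cinner_scaleC_right htens.rep_eq)
  qed
  then show ?thesis by (metis BR)
qed

lemma htensor_swap_exists:
  "\<exists>W :: ('a :: chilbert_space \<otimes>\<^sub>H 'b :: chilbert_space) \<Rightarrow> ('b \<otimes>\<^sub>H 'a).
     \<forall>f b c. Rep_htensor (W f) (c, b) = Rep_htensor f (b, c)"
proof -
  have "(\<lambda>p. Rep_htensor f (snd p, fst p)) \<in>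
      {h :: 'b \<times> 'a \<Rightarrow> complex. (\<forall>p. p \<notin> some_onb \<times> some_onb \<longrightarrow> h p = 0) \<and>
        (\<lambda>p. (cmod (h p))\<^sup>2) summable_on UNIV}" for f :: "'a \<otimes>\<^sub>H 'b"
  proof (intro CollectI conjI allI impI)
    show "Rep_htensor f (snd p, fst p) = 0" if "p \<notin> some_onb \<times> some_onb" for p
      using Rep_htensor[of f] that by (cases p) auto
    have "bij (\<lambda>p :: 'b \<times> 'a. (snd p, fst p))"
      by (rule bij_betw_byWitness[where f' = "\<lambda>p. (snd p, fst p)"]) auto
    then show "(\<lambda>p. (cmod (Rep_htensor f (snd p, fst p)))\<^sup>2) summable_on UNIV"
      using summable_on_reindex_bij_betw[of "\<lambda>p. (snd p, fst p)" UNIV UNIV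
          "\<lambda>p. (cmod (Rep_htensor f p))\<^sup>2"] sqsum_htensor[of f] by simp
  qed
  from Abs_htensor_inverse[OF this]
  have "\<forall>f :: 'a \<otimes>\<^sub>H 'b. \<exists>h :: 'b \<otimes>\<^sub>H 'a. Rep_htensor h = (\<lambda>p. Rep_htensor f (snd p, fst p))"
    by blast
  then obtain W :: "('a \<otimes>\<^sub>H 'b) \<Rightarrow> ('b \<otimes>\<^sub>H 'a)" where
    W: "\<And>f. Rep_htensor (W f) = (\<lambda>p. Rep_htensor f (snd p, fst p))" by metis
  have "\<forall>f b c. Rep_htensor (W f) (c, b) = Rep_htensor f (b, c)" by (simp add: W)
  then show ?thesis by blast
qed

lemma bop_tensor_left_exists:
  fixes S :: "'a :: chilbert_space bop"
  shows "\<exists>R :: ('a \<otimes>\<^sub>H 'b :: chilbert_space) bop. \<forall>x y. R *\<^sub>V (x \<otimes>\<^sub>h y) = (S *\<^sub>V x) \<otimes>\<^sub>h y"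
proof -
  obtain W :: "('a \<otimes>\<^sub>H 'b) \<Rightarrow> ('b \<otimes>\<^sub>H 'a)" where
    W: "\<And>f b c. Rep_htensor (W f) (c, b) = Rep_htensor f (b, c)"
    using htensor_swap_exists by blast
  obtain V :: "('b \<otimes>\<^sub>H 'a) \<Rightarrow> ('a \<otimes>\<^sub>H 'b)" where
    V: "\<And>f b c. Rep_htensor (V f) (c, b) = Rep_htensor f (b, c)"
    using htensor_swap_exists by blast
  obtain Q :: "('b \<otimes>\<^sub>H 'a) bop" where Q: "\<And>x y. Q *\<^sub>V (x \<otimes>\<^sub>h y) = x \<otimes>\<^sub>h (S *\<^sub>V y)"
    using bop_tensor_right_exists by blast
  have lin: "W (f + f') = W f + W f'" "W (k *\<^sub>C f) = k *\<^sub>C W f"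
    "V (g + g') = V g + V g'" "V (k *\<^sub>C g) = k *\<^sub>C V g" for f f' g g' k
    by (rule htensor_eqI, simp add: W V Rep_htensor_add Rep_htensor_scaleC)+
  have te: "W (x \<otimes>\<^sub>h y) = y \<otimes>\<^sub>h x" "V (y \<otimes>\<^sub>h x) = x \<otimes>\<^sub>h y" for x y
    by (rule htensor_eqI, simp add: W V htens.rep_eq)+
  have nrm: "norm (V g) = norm g" "norm (W f) = norm f" for f g
  proof -
    have sw: "infsum (\<lambda>p. h (snd p, fst p)) UNIV = infsum h UNIV" for h :: "'c \<times> 'd \<Rightarrow> real"
      by (rule infsum_reindex_bij_betw)
         (rule bij_betw_byWitness[where f' = "\<lambda>p. (snd p, fst p)"]; auto)
    have "Rep_htensor (V g) = (\<lambda>p. Rep_htensor g (snd p, fst p))"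
      "Rep_htensor (W f) = (\<lambda>p. Rep_htensor f (snd p, fst p))"
      using V W by (auto simp: fun_eq_iff)
    then have "(norm (V g))\<^sup>2 = (norm g)\<^sup>2" "(norm (W f))\<^sup>2 = (norm f)\<^sup>2"
      unfolding norm_htensor_sq
      using sw[of "\<lambda>p. (cmod (Rep_htensor g p))\<^sup>2"] sw[of "\<lambda>p. (cmod (Rep_htensor f p))\<^sup>2"]
      by simp_all
    then show "norm (V g) = norm g" "norm (W f) = norm f"
      by (simp_all add: power2_eq_iff_nonneg)
  qed
  define R where "R f = V (Q *\<^sub>V W f)" for f
  have "bounded_linear R"
  proof (rule bounded_linear_intro[where K = "norm Q"])
    show "norm (R f) \<le> norm f * norm Q" for f
      using norm_bop_apply[of Q "W f"] by (simp add: R_def nrm mult.commute)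
  qed (simp_all add: R_def lin bop_add bop_scaleC scaleR_scaleC)
  then have "bop_apply (Bop R) = R"
    by (intro Bop_inverse) (simp add: R_def lin bop_scaleC)
  moreover have "R (x \<otimes>\<^sub>h y) = (S *\<^sub>V x) \<otimes>\<^sub>h y" for x y
    by (simp add: R_def te Q)
  ultimately show ?thesis by metis
qed

lemma bop_tensor_unique:
  fixes R R' :: "('a :: chilbert_space \<otimes>\<^sub>H 'b :: chilbert_space) bop"
  assumes "\<And>x y. R *\<^sub>V (x \<otimes>\<^sub>h y) = R' *\<^sub>V (x \<otimes>\<^sub>h y)"
  shows "R = R'"
proof (rule bop_eqI)
  fix f :: "'a \<otimes>\<^sub>H 'b"
  let ?D = "some_onb \<times> some_onb :: ('a \<times> 'b) set"
  let ?h = "\<lambda>(b, c). Rep_htensor f (b, c) *\<^sub>C (b \<otimes>\<^sub>h c)"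
  have "((\<lambda>p. R *\<^sub>V ?h p) has_sum R *\<^sub>V f) ?D" "((\<lambda>p. R' *\<^sub>V ?h p) has_sum R' *\<^sub>V f) ?D"
    by (rule has_sum_bounded_linear[OF bop_bounded_linear htens_onb_expansion])+
  moreover have "R *\<^sub>V ?h p = R' *\<^sub>V ?h p" for p
    by (simp add: case_prod_unfold bop_scaleC assms)
  ultimately show "R *\<^sub>V f = R' *\<^sub>V f"
    using has_sum_unique by fastforce
qed

lemma bop_tensor_apply:
  fixes S :: "'a :: chilbert_space bop" and T :: "'b :: chilbert_space bop"
  shows "(S \<otimes>\<^sub>o T) *\<^sub>V (x \<otimes>\<^sub>h y) = (S *\<^sub>V x) \<otimes>\<^sub>h (T *\<^sub>V y)"
proof -
  obtain P Q :: "('a \<otimes>\<^sub>H 'b) bop" where "\<And>x y. P *\<^sub>V (x \<otimes>\<^sub>h y) = (S *\<^sub>V x) \<otimes>\<^sub>h y"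
    "\<And>x y. Q *\<^sub>V (x \<otimes>\<^sub>h y) = x \<otimes>\<^sub>h (T *\<^sub>V y)"
    using bop_tensor_left_exists[of S] bop_tensor_right_exists[of T] by blast
  then have PQ: "\<forall>x y. (P * Q) *\<^sub>V (x \<otimes>\<^sub>h y) = (S *\<^sub>V x) \<otimes>\<^sub>h (T *\<^sub>V y)"
    by (simp add: times_bop.rep_eq)
  then have "\<exists>!R. \<forall>x y. R *\<^sub>V (x \<otimes>\<^sub>h y) = (S *\<^sub>V x) \<otimes>\<^sub>h (T *\<^sub>V y)"
  proof (rule ex1I)
    fix R :: "('a \<otimes>\<^sub>H 'b) bop"
    assume "\<forall>x y. R *\<^sub>V (x \<otimes>\<^sub>h y) = (S *\<^sub>V x) \<otimes>\<^sub>h (T *\<^sub>V y)"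
    with PQ show "R = P * Q"
      by (intro bop_tensor_unique) simp
  qed
  from theI'[OF this] show ?thesis by (simp add: bop_tensor_def)
qed

section \<open>Tensor products of operator algebras\<close>

definition commutant :: "'a :: unital_cstar_algebra set \<Rightarrow> 'a set" where
  "commutant A = {x. \<forall>a\<in>A. x * a = a * x}"

abbreviation bicommutant :: "'a :: unital_cstar_algebra set \<Rightarrow> 'a set" where
  "bicommutant A \<equiv> commutant (commutant A)"

definition vn_tensor ::
    "'a :: chilbert_space bop set \<Rightarrow> 'b :: chilbert_space bop set \<Rightarrow> ('a \<otimes>\<^sub>H 'b) bop set" where
  "vn_tensor M N = bicommutant {S \<otimes>\<^sub>o T |S T. S \<in> M \<and> T \<in> N}"

text \<open>The spatial tensor product of concrete C*-algebras.\<close>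

definition spatial_tensor ::
    "'a :: chilbert_space bop set \<Rightarrow> 'b :: chilbert_space bop set \<Rightarrow> ('a \<otimes>\<^sub>H 'b) bop set" where
  "spatial_tensor A B = closure (cvs.span {S \<otimes>\<^sub>o T |S T. S \<in> A \<and> T \<in> B})"

text \<open>The *-morphism on the spatial tensor product of \<open>A\<close> and \<open>B\<close> that maps \<open>a \<otimes>\<^sub>o b\<close> to \<open>f a b\<close>.
  It is unique on this set, and it is meant to be used only where it exists and only on this set.
  The continuity requirement is redundant for *-morphisms of C*-algebras.\<close>

definition tensor_hom ::
    "'a :: chilbert_space bop set \<Rightarrow> 'b :: chilbert_space bop set \<Rightarrow>
      ('a bop \<Rightarrow> 'b bop \<Rightarrow> 'c :: unital_cstar_algebra) \<Rightarrow> ('a \<otimes>\<^sub>H 'b) bop \<Rightarrow> 'c" where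
  "tensor_hom A B f = (SOME \<phi>. star_hom_on (spatial_tensor A B) \<phi> \<and>
     continuous_on (spatial_tensor A B) \<phi> \<and> (\<forall>a\<in>A. \<forall>b\<in>B. \<phi> (a \<otimes>\<^sub>o b) = f a b))"

section \<open>Atomic representations\<close>

definition representation ::
    "('a :: unital_cstar_algebra \<Rightarrow> 'h :: chilbert_space bop) \<Rightarrow> bool" where
  "representation \<pi> \<longleftrightarrow> star_hom_on UNIV \<pi> \<and> \<pi> 1 = 1"

definition invariant_subspace ::
    "('a :: unital_cstar_algebra \<Rightarrow> 'h :: chilbert_space bop) \<Rightarrow> 'h set \<Rightarrow> bool" where
  "invariant_subspace \<pi> K \<longleftrightarrow> cvs.subspace K \<and> closed K \<and> (\<forall>a. \<forall>x\<in>K. \<pi> a *\<^sub>V x \<in> K)"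

text \<open>The subrepresentation on \<open>K\<close> is irreducible, and the subrepresentations on \<open>K\<close> and \<open>L\<close>
  are unitarily equivalent, respectively.\<close>

definition irreducible_on ::
    "('a :: unital_cstar_algebra \<Rightarrow> 'h :: chilbert_space bop) \<Rightarrow> 'h set \<Rightarrow> bool" where
  "irreducible_on \<pi> K \<longleftrightarrow> invariant_subspace \<pi> K \<and> K \<noteq> {0} \<and>
     (\<forall>L. invariant_subspace \<pi> L \<and> L \<subseteq> K \<longrightarrow> L = {0} \<or> L = K)"

definition equivalent_on ::
    "('a :: unital_cstar_algebra \<Rightarrow> 'h :: chilbert_space bop) \<Rightarrow> 'h set \<Rightarrow> 'h set \<Rightarrow> bool" where
  "equivalent_on \<pi> K L \<longleftrightarrow> (\<exists>U. U ` K = L \<and>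
     (\<forall>x\<in>K. \<forall>y\<in>K. U (x + y) = U x + U y) \<and>
     (\<forall>c. \<forall>x\<in>K. U (c *\<^sub>C x) = c *\<^sub>C U x) \<and>
     (\<forall>x\<in>K. \<forall>y\<in>K. cinner (U x) (U y) = cinner x y) \<and>
     (\<forall>a. \<forall>x\<in>K. U (\<pi> a *\<^sub>V x) = \<pi> a *\<^sub>V U x))"

text \<open>\<open>\<pi>\<close> is the (internal Hilbert space) direct sum of its subrepresentations on the members
  of \<open>\<K>\<close>.\<close>

definition atomic ::
    "('a :: unital_cstar_algebra \<Rightarrow> 'h :: chilbert_space bop) \<Rightarrow> bool" where
  "atomic \<pi> \<longleftrightarrow> (\<exists>\<K>.
     (\<forall>K\<in>\<K>. irreducible_on \<pi> K) \<and>
     (\<forall>K\<in>\<K>. \<forall>L\<in>\<K>. K \<noteq> L \<longrightarrow> \<not> equivalent_on \<pi> K L) \<and>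
     (\<forall>K\<in>\<K>. \<forall>L\<in>\<K>. K \<noteq> L \<longrightarrow> (\<forall>x\<in>K. \<forall>y\<in>L. cinner x y = 0)) \<and>
     closure (cvs.span (\<Union>\<K>)) = UNIV)"

definition faithful_atomic ::
    "('a :: unital_cstar_algebra \<Rightarrow> 'h :: chilbert_space bop) \<Rightarrow> bool" where
  "faithful_atomic \<pi> \<longleftrightarrow> representation \<pi> \<and> inj \<pi> \<and> atomic \<pi>"

definition rep_sum ::
    "('a \<Rightarrow> 'h :: chilbert_space bop) \<Rightarrow> ('b \<Rightarrow> 'k :: chilbert_space bop) \<Rightarrow>
      ('a \<oplus>\<^sub>A 'b) \<Rightarrow> ('h \<times> 'k) bop" where
  "rep_sum \<pi>\<^sub>1 \<pi>\<^sub>2 x = \<pi>\<^sub>1 (dfst x) \<oplus>\<^sub>o \<pi>\<^sub>2 (dsnd x)"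

section \<open>Compact quantum metric spaces\<close>

definition projection :: "'a :: unital_cstar_algebra \<Rightarrow> bool" where
  "projection p \<longleftrightarrow> p * p = p \<and> p\<^sup>\<star> = p"

definition proj_le :: "'a :: unital_cstar_algebra \<Rightarrow> 'a \<Rightarrow> bool" where
  "proj_le p q \<longleftrightarrow> p * q = p"

definition minimal_projection :: "'a :: unital_cstar_algebra set \<Rightarrow> 'a \<Rightarrow> bool" where
  "minimal_projection M p \<longleftrightarrow> p \<in> M \<and> projection p \<and> p \<noteq> 0 \<and>
     (\<forall>q\<in>M. projection q \<and> proj_le q p \<longrightarrow> q = 0 \<or> q = p)"

definition proj_Sup :: "'a :: unital_cstar_algebra set \<Rightarrow> 'a set \<Rightarrow> 'a" where
  "proj_Sup M \<P> = (THE P. P \<in> M \<and> projection P \<and> (\<forall>p\<in>\<P>. proj_le p P) \<and>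
     (\<forall>Q\<in>M. projection Q \<and> (\<forall>p\<in>\<P>. proj_le p Q) \<longrightarrow> proj_le P Q))"

definition P_delta ::
    "('a :: unital_cstar_algebra \<Rightarrow> 'h :: chilbert_space bop) \<Rightarrow> ('h \<otimes>\<^sub>H 'h) bop" where
  "P_delta \<pi> = (let M = bicommutant (range \<pi>)
     in proj_Sup (vn_tensor M M) {p \<otimes>\<^sub>o p |p. minimal_projection M p})"

definition H_delta ::
    "('a :: unital_cstar_algebra \<Rightarrow> 'h :: chilbert_space bop) \<Rightarrow> ('h \<otimes>\<^sub>H 'h) set" where
  "H_delta \<pi> = range (bop_apply (P_delta \<pi>))"

definition orthogonal_complement :: "'a :: complex_inner set \<Rightarrow> 'a set" where
  "orthogonal_complement K = {v. \<forall>w\<in>K. cinner w v = 0}"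

text \<open>\<open>c\<close> is an eigenvalue of the restriction of \<open>T\<close> to \<open>K\<close>.\<close>

definition eigenvalue_on :: "'a :: chilbert_space set \<Rightarrow> 'a bop \<Rightarrow> complex \<Rightarrow> bool" where
  "eigenvalue_on K T c \<longleftrightarrow> (\<exists>v\<in>K. v \<noteq> 0 \<and> T *\<^sub>V v = c *\<^sub>C v)"

text \<open>In the following definitions \<open>A\<close> is a concrete C*-algebra. Its threefold spatial tensor
  product is formed with the bracketing \<open>(A \<otimes> A) \<otimes> A\<close>; \<open>one_tensor A \<rho>\<close> is \<open>1 \<otimes> \<rho>\<close> under the
  associativity isomorphism.\<close>

definition flip_map :: "'h :: chilbert_space bop set \<Rightarrow> ('h \<otimes>\<^sub>H 'h) bop \<Rightarrow> ('h \<otimes>\<^sub>H 'h) bop" where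
  "flip_map A = tensor_hom A A (\<lambda>a b. b \<otimes>\<^sub>o a)"

definition middle_map ::
    "'h :: chilbert_space bop set \<Rightarrow> ('h \<otimes>\<^sub>H 'h) bop \<Rightarrow> (('h \<otimes>\<^sub>H 'h) \<otimes>\<^sub>H 'h) bop" where
  "middle_map A = tensor_hom A A (\<lambda>a b. (a \<otimes>\<^sub>o 1) \<otimes>\<^sub>o b)"

definition one_tensor ::
    "'h :: chilbert_space bop set \<Rightarrow> ('h \<otimes>\<^sub>H 'h) bop \<Rightarrow> (('h \<otimes>\<^sub>H 'h) \<otimes>\<^sub>H 'h) bop" where
  "one_tensor A = tensor_hom A A (\<lambda>a b. (1 \<otimes>\<^sub>o a) \<otimes>\<^sub>o b)"

text \<open>The C*-algebra is the whole type \<open>'a\<close>; it is identified with its image under \<open>\<pi>\<close>.\<close>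

definition compact_quantum_metric_space ::
    "('h \<otimes>\<^sub>H 'h) bop \<Rightarrow> ('a :: unital_cstar_algebra \<Rightarrow> 'h :: chilbert_space bop) \<Rightarrow> bool" where
  "compact_quantum_metric_space \<rho> \<pi> \<longleftrightarrow>
     (let A = range \<pi>; AA = spatial_tensor A A; AAA = spatial_tensor AA A in
       faithful_atomic \<pi> \<and>
       \<rho> \<in> AA \<and>
       positive_in AA \<rho> \<and>
       \<rho> * P_delta \<pi> = 0 \<and> P_delta \<pi> * \<rho> = 0 \<and>
       \<not> eigenvalue_on (orthogonal_complement (H_delta \<pi>)) \<rho> 0 \<and>
       flip_map A \<rho> = \<rho> \<and>
       positive_in AAA (\<rho> \<otimes>\<^sub>o 1 + one_tensor A \<rho> - middle_map A \<rho>))"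

text \<open>The embeddings of \<open>A\<^sub>i \<otimes> A\<^sub>j\<close> as direct summands of
  \<open>(A\<^sub>1 \<oplus> A\<^sub>2) \<otimes> (A\<^sub>1 \<oplus> A\<^sub>2)\<close>, where \<open>A\<^sub>i\<close> and \<open>A\<^sub>j\<close> are concrete C*-algebras and
  the embeddings \<open>i\<close> and \<open>j\<close> of \<open>A\<^sub>i\<close> and \<open>A\<^sub>j\<close> into \<open>A\<^sub>1 \<oplus> A\<^sub>2\<close> are \<open>in_fst\<close> or \<open>in_snd\<close>.\<close>

definition in_fst :: "'h :: chilbert_space bop \<Rightarrow> ('h \<times> 'k :: chilbert_space) bop" where
  "in_fst a = a \<oplus>\<^sub>o 0"

definition in_snd :: "'k :: chilbert_space bop \<Rightarrow> ('h :: chilbert_space \<times> 'k) bop" where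
  "in_snd b = 0 \<oplus>\<^sub>o b"

definition summand ::
    "'a :: chilbert_space bop set \<Rightarrow> 'b :: chilbert_space bop set \<Rightarrow>
      ('a bop \<Rightarrow> 'h :: chilbert_space bop) \<Rightarrow> ('b bop \<Rightarrow> 'h bop) \<Rightarrow>
      ('a \<otimes>\<^sub>H 'b) bop \<Rightarrow> ('h \<otimes>\<^sub>H 'h) bop" where
  "summand A B i j = tensor_hom A B (\<lambda>a b. i a \<otimes>\<^sub>o j b)"

end

theory Submission
  imports Defs
begin

text \<open>
  Write \<open>H = H\<^sub>1 \<times> H\<^sub>2\<close>, let \<open>V\<^sub>i\<close> be the isometric embedding of \<open>H\<^sub>i\<close> into \<open>H\<close>, and let
  \<open>E\<^sub>i\<close> be the projection onto its range, so that \<open>E\<^sub>1 + E\<^sub>2 = 1\<close>. Conjugation with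
  \<open>V\<^sub>i \<otimes> V\<^sub>j\<close> embeds the operators on \<open>H\<^sub>i \<otimes> H\<^sub>j\<close> as a corner of the operators on
  \<open>H \<otimes> H\<close>. With \<open>R\<^sub>i\<close> the image of \<open>\<rho>\<^sub>i\<close>, the operator of the theorem is
  \<open>\<rho> = R\<^sub>1 + R\<^sub>2 + r (E\<^sub>1 \<otimes> E\<^sub>2) + r (E\<^sub>2 \<otimes> E\<^sub>1)\<close>,
  a block diagonal operator with four blocks. Positivity, flip invariance and membership in the
  tensor product are checked on each block.

  For the diagonal projection, two facts are used. The supremum of a set of projections of a
  von Neumann algebra is the projection whose kernel is the common kernel of the members of the
  set (\<open>proj_Sup_commutant\<close>). So the conditions on \<open>P\<^sub>\<delta>\<close> speak only of the
  projections \<open>p \<otimes> p\<close> with \<open>p\<close> minimal (\<open>compact_quantum_metric_space_iff\<close>). Since the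
  algebra contains \<open>E\<^sub>1\<close>, its bicommutant is the direct sum of the two bicommutants, and the
  minimal projections of a direct sum are those of the two summands
  (\<open>minimal_projection_bop_sum\<close>). Hence \<open>\<rho>\<close> vanishes on
  \<open>H\<^sub>\<delta>\<close>, and a vector of the kernel of \<open>\<rho>\<close> that is orthogonal to \<open>H\<^sub>\<delta>\<close> has zero
  component in each block: in the two diagonal blocks by hypothesis, in the other two because
  \<open>r \<noteq> 0\<close> or the block is zero.

  For the triangle inequality, write \<open>E\<^sub>i\<^sub>j\<^sub>k = E\<^sub>i \<otimes> E\<^sub>j \<otimes> E\<^sub>k\<close>. The operators involved commute with
  these eight projections, and on the blocks the difference of the two sides is: on \<open>111\<close> the corresponding
  difference for \<open>\<rho>\<^sub>1\<close>; on \<open>112\<close> and \<open>211\<close> a copy of \<open>\<rho>\<^sub>1\<close>, since the two terms \<open>r\<close>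
  cancel; on \<open>121\<close> the operator \<open>2 r\<close> minus a copy of \<open>\<rho>\<^sub>1\<close>, which is positive because
  \<open>2 r \<ge> norm \<rho>\<^sub>1\<close>; the other four blocks are symmetric (\<open>triangle_block\<close>).

  To turn positivity of quadratic forms into positivity in a C*-algebra, square
  roots are constructed inside any closed unital *-subalgebra by the binomial series
  (\<open>psd_imp_positive_in\<close>). This also shows that *-homomorphisms are contractive, so that
  identities between them need to be verified on elementary tensors only
  (\<open>spatial_tensor_eqI\<close>).
\<close>

section \<open>Dense spans and isometries of Hilbert spaces\<close>

lemma subspace_closure:
  fixes S :: "'a :: {complex_vector, real_normed_vector} set"
  assumes cont: "\<And>c. continuous_on UNIV (\<lambda>x :: 'a. c *\<^sub>C x)" and S: "cvs.subspace S"
  shows "cvs.subspace (closure S)"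
proof (rule cvs.subspaceI)
  show "0 \<in> closure S"
    using cvs.subspace_0[OF S] closure_subset by blast
  show "x + y \<in> closure S" if xy: "x \<in> closure S" "y \<in> closure S" for x y
  proof -
    obtain f g where "\<forall>n. f n \<in> S" "f \<longlonglongrightarrow> x" "\<forall>n. g n \<in> S" "g \<longlonglongrightarrow> y"
      using xy unfolding closure_sequential by blast
    then show ?thesis
      unfolding closure_sequential
      by (intro exI[of _ "\<lambda>n. f n + g n"]) (auto intro: tendsto_add cvs.subspace_add[OF S])
  qed
  show "c *\<^sub>C x \<in> closure S" if x: "x \<in> closure S" for c x
  proof -
    obtain f where f: "\<And>n. f n \<in> S" "f \<longlonglongrightarrow> x"
      using x unfolding closure_sequential by blast
    have "(\<lambda>n. c *\<^sub>C f n) \<longlonglongrightarrow> c *\<^sub>C x"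
      using continuous_on_tendsto_compose[OF cont f(2)] by simp
    then show ?thesis
      using f unfolding closure_sequential
      by (intro exI[of _ "\<lambda>n. c *\<^sub>C f n"]) (auto intro: cvs.subspace_scale[OF S])
  qed
qed

lemma continuous_on_scaleC: "continuous_on S (\<lambda>x :: 'a :: complex_inner. c *\<^sub>C x)"
  by (rule bounded_linear.continuous_on[OF bounded_linear_scaleC continuous_on_id])

definition dense_span :: "'a :: complex_inner set \<Rightarrow> bool" where
  "dense_span S \<longleftrightarrow> closure (cvs.span S) = UNIV"

lemma dense_span_subspace:
  assumes "dense_span S" "closed K" "cvs.subspace K" "S \<subseteq> K"
  shows "x \<in> K"
proof -
  have "closure (cvs.span S) \<subseteq> K"
    using assms by (intro closure_minimal cvs.span_minimal) auto
  with assms(1) show ?thesis by (auto simp: dense_span_def)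
qed

lemma dense_spanI:
  fixes S :: "'a :: complex_inner set"
  assumes "\<And>K. closed K \<Longrightarrow> cvs.subspace K \<Longrightarrow> S \<subseteq> K \<Longrightarrow> K = UNIV"
  shows "dense_span S"
  unfolding dense_span_def
proof (rule assms)
  show "cvs.subspace (closure (cvs.span S))"
    by (intro subspace_closure continuous_on_scaleC cvs.subspace_span)
  show "S \<subseteq> closure (cvs.span S)"
    using closure_subset cvs.span_superset by blast
qed simp

lemma dense_span_htens: "dense_span {x \<otimes>\<^sub>h y |x y. True}"
  unfolding dense_span_def by (rule htens_dense)

lemma htens_zero [simp]: "x \<otimes>\<^sub>h 0 = 0" "0 \<otimes>\<^sub>h y = 0"
  using htens_scaleC_right[of x 0 0] htens_scaleC_left[of 0 0 y] by simp_all

lemma bounded_linear_htens_left: "bounded_linear (\<lambda>x. x \<otimes>\<^sub>h y)"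
  by (rule bounded_linear_intro[where K = "norm y"])
    (auto simp: htens_add_left htens_scaleC_left scaleR_scaleC norm_htens)

text \<open>Closed subspaces that contain the elementary threefold tensors contain \<open>f \<otimes>\<^sub>h z\<close> for arbitrary
  \<open>f\<close>, because \<open>f\<close> is a limit of combinations of elementary tensors and \<open>_ \<otimes>\<^sub>h z\<close> is continuous.\<close>

lemma dense_span_htens3: "dense_span {(x \<otimes>\<^sub>h y) \<otimes>\<^sub>h z |x y z. True}"
proof (rule dense_spanI)
  fix K :: "(('a \<otimes>\<^sub>H 'b) \<otimes>\<^sub>H 'c) set"
  assume K: "closed K" "cvs.subspace K" "{(x \<otimes>\<^sub>h y) \<otimes>\<^sub>h z |x y z. True} \<subseteq> K"
  have "f \<otimes>\<^sub>h z \<in> K" for f :: "'a \<otimes>\<^sub>H 'b" and z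
  proof -
    have "f \<in> (\<lambda>f. f \<otimes>\<^sub>h z) -` K"
    proof (rule dense_span_subspace[OF dense_span_htens])
      show "closed ((\<lambda>f. f \<otimes>\<^sub>h z) -` K)"
        by (intro continuous_closed_vimage K bounded_linear.isCont[OF bounded_linear_htens_left]
            continuous_ident)
      show "cvs.subspace ((\<lambda>f. f \<otimes>\<^sub>h z) -` K)"
        using K(2) by (auto simp: cvs.subspace_def htens_add_left htens_scaleC_left)
    qed (use K(3) in blast)
    then show ?thesis by simp
  qed
  then have "v \<in> K" for v
    by (intro dense_span_subspace[OF dense_span_htens K(1,2)]) auto
  then show "K = UNIV" by blast
qed

definition isometry :: "('a :: complex_inner \<Rightarrow> 'b :: complex_inner) \<Rightarrow> bool" where
  "isometry V \<longleftrightarrow> (\<forall>x y. V (x + y) = V x + V y) \<and> (\<forall>c x. V (c *\<^sub>C x) = c *\<^sub>C V x) \<and>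
     (\<forall>x y. cinner (V x) (V y) = cinner x y)"

lemma isometry_simps:
  assumes "isometry V"
  shows "V (x + y) = V x + V y" "V (c *\<^sub>C x) = c *\<^sub>C V x" "cinner (V x) (V y) = cinner x y"
  using assms by (auto simp: isometry_def)

lemma norm_eq_iff_cinner: "cinner x x = cinner y y \<Longrightarrow> norm x = norm y"
  by (simp add: cinner_self power2_eq_iff_nonneg flip: of_real_power)

lemma isometry_norm:
  assumes "isometry V"
  shows "norm (V x) = norm x"
  by (rule norm_eq_iff_cinner) (simp add: isometry_simps[OF assms])

lemma isometry_bounded_linear:
  assumes "isometry V"
  shows "bounded_linear V"
  by (rule bounded_linear_intro[where K = 1])
    (simp_all add: isometry_simps[OF assms] isometry_norm[OF assms] scaleR_scaleC)

text \<open>A family with a dense span can be moved to any family with the same inner products. The closed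
  span \<open>G\<close> of the pairs \<open>(g i, f i)\<close> is the graph of the required map: by sesquilinearity and
  continuity, the two components of elements of \<open>G\<close> have equal inner products, so the second
  component is determined by the first; and the set of first components is closed,
  because a sequence in \<open>G\<close> is Cauchy as soon as its first components are.\<close>

lemma isometry_extension:
  fixes g :: "'i \<Rightarrow> 'a :: chilbert_space" and f :: "'i \<Rightarrow> 'b :: chilbert_space"
  assumes tot: "dense_span (range g)"
    and gram: "\<And>i j. cinner (f i) (f j) = cinner (g i) (g j)"
  shows "\<exists>V. isometry V \<and> (\<forall>i. V (g i) = f i)"
proof -
  define S where "S = cvs.span (range (\<lambda>i. (g i, f i)))"
  let ?G = "closure S"
  have sub: "cvs.subspace ?G"
    unfolding S_def by (intro subspace_closure continuous_on_scaleC cvs.subspace_span)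
  define B where "B p q = cinner (fst p) (fst q) - cinner (snd p) (snd q)" for p q :: "'a \<times> 'b"
  have B: "B p q = 0" if "p \<in> ?G" "q \<in> ?G" for p q
  proof -
    have closed1: "closed {q. B p q = 0}" "cvs.subspace {q. B p q = 0}" for p
    proof -
      show "closed {q. B p q = 0}"
        unfolding B_def
        by (intro closed_Collect_eq continuous_intros
            bounded_linear.continuous_on[OF bounded_linear_cinner_right])
      show "cvs.subspace {q. B p q = 0}"
        by (auto simp: cvs.subspace_def B_def scaleC_prod_def cinner_add_right cinner_scaleC_right
            algebra_simps simp flip: distrib_left)
    qed
    have sym: "B p q = cnj (B q p)" for p q
      by (simp add: B_def flip: cinner_commute)
    have S1: "?G \<subseteq> {q. B p q = 0}" if "\<And>i. B p (g i, f i) = 0" for p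
      unfolding S_def using that closed1[of p]
      by (intro closure_minimal cvs.span_minimal) auto
    have "B p (g i, f i) = 0" if "p \<in> ?G" for p i
    proof -
      have "B (g i, f i) p = 0"
        using S1[of "(g i, f i)"] that gram by (auto simp: B_def)
      then show ?thesis by (subst sym) simp
    qed
    with S1 that show ?thesis by blast
  qed
  have norm_G: "norm (snd p) = norm (fst p)" if "p \<in> ?G" for p
    using B[OF that that] by (intro norm_eq_iff_cinner) (simp add: B_def)
  have "closed (fst ` ?G)"
  proof (rule complete_imp_closed, unfold complete_def, intro allI impI)
    fix X assume X: "(\<forall>n. X n \<in> fst ` ?G) \<and> Cauchy X"
    then have "\<forall>n. \<exists>p\<in>?G. X n = fst p" by (auto simp: image_iff)
    then obtain P where P: "\<And>n. P n \<in> ?G" "\<And>n. X n = fst (P n)" by metis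
    have "norm (P m - P n) \<le> 2 * norm (X m - X n)" for m n
    proof -
      have "P m - P n \<in> ?G" using P sub by (intro cvs.subspace_diff) auto
      then have "norm (snd (P m - P n)) = norm (X m - X n)"
        using norm_G[of "P m - P n"] by (simp add: P(2))
      then show ?thesis
        using norm_Pair_le[of "fst (P m - P n)" "snd (P m - P n)"]
        by (simp add: P(2) del: fst_diff snd_diff) (simp add: P(2))
    qed
    then have "Cauchy P"
    proof (intro CauchyI)
      fix e :: real assume le: "\<And>m n. norm (P m - P n) \<le> 2 * norm (X m - X n)" and "e > 0"
      then obtain M where M: "\<And>m n. m \<ge> M \<Longrightarrow> n \<ge> M \<Longrightarrow> norm (X m - X n) < e / 2"
        using X CauchyD[of X "e / 2"] half_gt_zero by blast
      have "norm (P m - P n) < e" if "m \<ge> M" "n \<ge> M" for m n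
        using M[OF that] le[of m n] by linarith
      then show "\<exists>M. \<forall>m\<ge>M. \<forall>n\<ge>M. norm (P m - P n) < e" by blast
    qed
    then obtain p where p: "P \<longlonglongrightarrow> p"
      using Cauchy_convergent convergent_def by blast
    then have "p \<in> ?G"
      using P closed_sequentially[OF closed_closure] by blast
    moreover have "X \<longlonglongrightarrow> fst p"
      using tendsto_fst[OF p] by (simp flip: P(2))
    ultimately show "\<exists>l\<in>fst ` ?G. X \<longlonglongrightarrow> l" by blast
  qed
  moreover have "cvs.subspace (fst ` ?G)"
  proof (rule cvs.subspaceI)
    show "0 \<in> fst ` ?G" using cvs.subspace_0[OF sub] by force
    show "x + y \<in> fst ` ?G" if xy: "x \<in> fst ` ?G" "y \<in> fst ` ?G" for x y
    proof -
      obtain x' y' where "(x, x') \<in> ?G" "(y, y') \<in> ?G" using xy by auto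
      then show ?thesis using cvs.subspace_add[OF sub] by (force simp: image_iff)
    qed
    show "c *\<^sub>C x \<in> fst ` ?G" if x: "x \<in> fst ` ?G" for c x
    proof -
      obtain x' where "(x, x') \<in> ?G" using x by auto
      from cvs.subspace_scale[OF sub this, of c] show ?thesis
        by (force simp: scaleC_prod_def image_iff)
    qed
  qed
  moreover have gf: "(g i, f i) \<in> ?G" for i
    unfolding S_def by (intro subsetD[OF closure_subset] cvs.span_base) simp
  then have "range g \<subseteq> fst ` ?G" by force
  ultimately have "x \<in> fst ` ?G" for x
    by (intro dense_span_subspace[OF tot]) auto
  then have "\<forall>x. \<exists>y. (x, y) \<in> ?G" by (force simp: image_iff)
  then obtain V where V: "\<And>x. (x, V x) \<in> ?G" by metis
  have uniq: "y = V x" if "(x, y) \<in> ?G" for x y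
    using norm_G[OF cvs.subspace_diff[OF sub that V[of x]]] by simp
  have "isometry V"
    unfolding isometry_def
  proof (intro conjI allI)
    show "V (x + y) = V x + V y" for x y
      using cvs.subspace_add[OF sub V V] by (intro uniq[symmetric]) simp
    show "V (c *\<^sub>C x) = c *\<^sub>C V x" for c x
      using cvs.subspace_scale[OF sub V[of x], of c]
      by (intro uniq[symmetric]) (simp add: scaleC_prod_def)
    show "cinner (V x) (V y) = cinner x y" for x y
      using B[OF V V, of x y] by (simp add: B_def)
  qed
  moreover have "V (g i) = f i" for i
    using uniq[OF gf] by simp
  ultimately show ?thesis by (intro exI[of _ V] conjI allI)
qed

text \<open>The Hilbert space adjoint, as a function because \<open>bop\<close> contains only operators from a space to
  itself.\<close>

definition iso_adj :: "('a :: chilbert_space \<Rightarrow> 'b :: chilbert_space) \<Rightarrow> 'b \<Rightarrow> 'a" where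
  "iso_adj V y = (SOME x. \<forall>z. cinner y (V z) = cinner x z)"

lemma cinner_iso_adj:
  assumes V: "isometry V"
  shows "cinner (iso_adj V y) z = cinner y (V z)"
proof -
  have "\<exists>x. \<forall>z. cinner y (V z) = cinner x z"
  proof (rule riesz)
    show "bounded_linear (\<lambda>z. cinner y (V z))"
      by (rule bounded_linear_compose[OF bounded_linear_cinner_right isometry_bounded_linear[OF V]])
  qed (simp only: isometry_simps[OF V] cinner_scaleC_right)
  from someI_ex[OF this, folded iso_adj_def] show ?thesis by metis
qed

lemma cinner_iso_adj_right:
  assumes V: "isometry V"
  shows "cinner z (iso_adj V y) = cinner (V z) y"
  by (subst (1 2) cinner_commute) (simp add: cinner_iso_adj[OF V])

lemma iso_adj_cancel:
  assumes "isometry V"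
  shows "iso_adj V (V x) = x"
  by (rule cinner_eqI) (simp add: cinner_iso_adj[OF assms] isometry_simps[OF assms])

lemma iso_adj_linear:
  assumes "isometry V"
  shows "iso_adj V (x + y) = iso_adj V x + iso_adj V y" "iso_adj V (c *\<^sub>C x) = c *\<^sub>C iso_adj V x"
  by (rule cinner_eqI;
      simp add: cinner_iso_adj[OF assms] cinner_add_left cinner_scaleC_left)+

lemma norm_iso_adj_le:
  assumes V: "isometry V"
  shows "norm (iso_adj V y) \<le> norm y"
proof -
  have "cmod (cinner (iso_adj V y) (iso_adj V y)) \<le> norm y * norm (V (iso_adj V y))"
    unfolding cinner_iso_adj[OF V, of y "iso_adj V y"] by (rule cmod_cinner_le)
  then have "norm (iso_adj V y) * norm (iso_adj V y) \<le> norm y * norm (iso_adj V y)"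
    by (simp add: cinner_self isometry_norm[OF V] power2_eq_square norm_mult)
  then show ?thesis by (cases "iso_adj V y = 0") auto
qed

definition iso_tensor :: "('a :: chilbert_space \<Rightarrow> 'c :: chilbert_space) \<Rightarrow>
    ('b :: chilbert_space \<Rightarrow> 'd :: chilbert_space) \<Rightarrow> ('a \<otimes>\<^sub>H 'b) \<Rightarrow> ('c \<otimes>\<^sub>H 'd)" where
  "iso_tensor V W = (SOME J. isometry J \<and> (\<forall>x y. J (x \<otimes>\<^sub>h y) = V x \<otimes>\<^sub>h W y))"

text \<open>The family \<open>V x \<otimes>\<^sub>h W y\<close> has the same inner products as \<open>x \<otimes>\<^sub>h y\<close>.\<close>

lemma iso_tensor:
  fixes V :: "'a :: chilbert_space \<Rightarrow> 'c :: chilbert_space"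
    and W :: "'b :: chilbert_space \<Rightarrow> 'd :: chilbert_space"
  assumes V: "isometry V" and W: "isometry W"
  shows isometry_iso_tensor: "isometry (iso_tensor V W)"
    and iso_tensor_htens: "iso_tensor V W (x \<otimes>\<^sub>h y) = V x \<otimes>\<^sub>h W y"
proof -
  have "range (\<lambda>p :: 'a \<times> 'b. fst p \<otimes>\<^sub>h snd p) = {x \<otimes>\<^sub>h y |x y. True}"
    by (auto simp: image_iff) metis
  then have "dense_span (range (\<lambda>p :: 'a \<times> 'b. fst p \<otimes>\<^sub>h snd p))"
    by (simp only: dense_span_htens)
  then have "\<exists>J. isometry J \<and> (\<forall>p. J (fst p \<otimes>\<^sub>h snd p) = V (fst p) \<otimes>\<^sub>h W (snd p))"
    by (rule isometry_extension[where f = "\<lambda>p. V (fst p) \<otimes>\<^sub>h W (snd p)"]) (simp add: cinner_htens isometry_simps[OF V] isometry_simps[OF W])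
  then have "\<exists>J. isometry J \<and> (\<forall>x y. J (x \<otimes>\<^sub>h y) = V x \<otimes>\<^sub>h W y)" by simp
  from someI_ex[OF this, folded iso_tensor_def]
  show "isometry (iso_tensor V W)" "iso_tensor V W (x \<otimes>\<^sub>h y) = V x \<otimes>\<^sub>h W y"
    by simp_all
qed

lemma iso_adj_eqI: "isometry V \<Longrightarrow> (\<And>z. cinner y (V z) = cinner x z) \<Longrightarrow> iso_adj V y = x"
  by (rule cinner_eqI) (simp add: cinner_iso_adj)

lemma iso_adj_tensor_htens:
  assumes V: "isometry V" and W: "isometry W"
  shows "iso_adj (iso_tensor V W) (x \<otimes>\<^sub>h y) = iso_adj V x \<otimes>\<^sub>h iso_adj W y"
proof -
  let ?J = "iso_tensor V W"
  have J: "isometry ?J" by (rule isometry_iso_tensor[OF V W])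
  let ?K = "{z. cinner (x \<otimes>\<^sub>h y) (?J z) = cinner (iso_adj V x \<otimes>\<^sub>h iso_adj W y) z}"
  have "z \<in> ?K" for z
  proof (rule dense_span_subspace[OF dense_span_htens])
    show "closed ?K"
      by (intro closed_Collect_eq continuous_intros
          bounded_linear.continuous_on[OF bounded_linear_cinner_right]
          bounded_linear.continuous_on[OF isometry_bounded_linear[OF J]])
    show "cvs.subspace ?K"
      using bounded_linear.linear[OF isometry_bounded_linear[OF J], THEN linear_0]
      by (auto simp: cvs.subspace_def isometry_simps[OF J] cinner_add_right cinner_scaleC_right)
    show "{x \<otimes>\<^sub>h y |x y. True} \<subseteq> ?K"
      by (auto simp: iso_tensor_htens[OF V W] cinner_htens cinner_iso_adj V W)
  qed
  then show ?thesis by (intro iso_adj_eqI[OF J]) simp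
qed

section \<open>Operators and *-homomorphisms\<close>

lemmas bop_rep_eqs = plus_bop.rep_eq minus_bop.rep_eq uminus_bop.rep_eq zero_bop.rep_eq
  scaleC_bop.rep_eq scaleR_bop.rep_eq times_bop.rep_eq one_bop.rep_eq

lemma bop_diff: "T *\<^sub>V (x - y) = T *\<^sub>V x - T *\<^sub>V y"
  by (rule linear_diff[OF bounded_linear.linear[OF bop_bounded_linear]])

lemma bop_star_eqI:
  assumes "\<And>x y. cinner (S *\<^sub>V x) y = cinner x (T *\<^sub>V y)"
  shows "T\<^sup>\<star> = S"
  by (rule bop_eqI, rule cinner_eqI) (simp add: assms cinner_star)

lemma star_zero [simp]: "(0 :: 'a :: unital_cstar_algebra)\<^sup>\<star> = 0"
  using star_scaleC[of 0 "0 :: 'a"] by simp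

lemma star_one [simp]: "(1 :: 'a :: unital_cstar_algebra)\<^sup>\<star> = 1"
  by (metis mult_1_left mult_1_right star_mult star_star)

lemma star_uminus: "(- x)\<^sup>\<star> = - (x :: 'a :: unital_cstar_algebra)\<^sup>\<star>"
  using star_scaleC[of "-1" x] by simp

lemma star_diff: "(x - y)\<^sup>\<star> = (x :: 'a :: unital_cstar_algebra)\<^sup>\<star> - y\<^sup>\<star>"
  using star_add[of x "- y"] by (simp add: star_uminus)

lemma star_scaleR: "(r *\<^sub>R x)\<^sup>\<star> = r *\<^sub>R (x :: 'a :: unital_cstar_algebra)\<^sup>\<star>"
  by (simp add: scaleR_scaleC star_scaleC)

lemma norm_star: "norm (x\<^sup>\<star>) = norm (x :: 'a :: unital_cstar_algebra)"
proof -
  have le: "norm x \<le> norm (x\<^sup>\<star>)" for x :: 'a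
  proof -
    have "norm x * norm x \<le> norm (x\<^sup>\<star>) * norm x"
      using norm_mult_ineq[of "x\<^sup>\<star>" x] by (simp add: cstar_identity power2_eq_square)
    then show ?thesis by (cases "x = 0") auto
  qed
  from le[of x] le[of "x\<^sup>\<star>"] show ?thesis by simp
qed

lemma bounded_linear_star: "bounded_linear (star :: 'a :: unital_cstar_algebra \<Rightarrow> 'a)"
  by (rule bounded_linear_intro[where K = 1]) (simp_all add: star_add star_scaleR norm_star)

lemma continuous_on_scaleC_cstar:
  "continuous_on S (\<lambda>x :: 'a :: unital_cstar_algebra. c *\<^sub>C x)"
proof (rule bounded_linear.continuous_on[OF _ continuous_on_id])
  show "bounded_linear (\<lambda>x :: 'a. c *\<^sub>C x)"
    by (rule bounded_linear_intro[where K = "cmod c"])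
      (auto simp: scaleC_add_right scaleR_scaleC norm_scaleC_cstar mult.commute)
qed

definition star_hom :: "('a :: unital_cstar_algebra \<Rightarrow> 'b :: unital_cstar_algebra) \<Rightarrow> bool" where
  "star_hom \<phi> \<longleftrightarrow> star_hom_on UNIV \<phi>"

lemma star_hom_simps:
  assumes "star_hom \<phi>"
  shows "\<phi> (x + y) = \<phi> x + \<phi> y" "\<phi> (c *\<^sub>C x) = c *\<^sub>C \<phi> x" "\<phi> (x * y) = \<phi> x * \<phi> y"
    "\<phi> (x\<^sup>\<star>) = (\<phi> x)\<^sup>\<star>" "\<phi> (r *\<^sub>R x) = r *\<^sub>R \<phi> x" "\<phi> 0 = 0" "\<phi> (x - y) = \<phi> x - \<phi> y"
proof -
  have *: "\<phi> (x + y) = \<phi> x + \<phi> y" "\<phi> (c *\<^sub>C x) = c *\<^sub>C \<phi> x" for x y c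
    using assms by (auto simp: star_hom_def star_hom_on_def)
  show "\<phi> (x + y) = \<phi> x + \<phi> y" "\<phi> (c *\<^sub>C x) = c *\<^sub>C \<phi> x" "\<phi> (x * y) = \<phi> x * \<phi> y"
    "\<phi> (x\<^sup>\<star>) = (\<phi> x)\<^sup>\<star>"
    using assms by (auto simp: star_hom_def star_hom_on_def)
  show "\<phi> (r *\<^sub>R x) = r *\<^sub>R \<phi> x" unfolding scaleR_scaleC by (rule *)
  show "\<phi> 0 = 0" using *(2)[of 0 0] by simp
  show "\<phi> (x - y) = \<phi> x - \<phi> y" using *(1)[of "x - y" y] by simp
qed

lemma star_homI:
  assumes "\<And>x y. \<phi> (x + y) = \<phi> x + \<phi> y" "\<And>c x. \<phi> (c *\<^sub>C x) = c *\<^sub>C \<phi> x"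
    "\<And>x y. \<phi> (x * y) = \<phi> x * \<phi> y" "\<And>x. \<phi> (x\<^sup>\<star>) = (\<phi> x)\<^sup>\<star>"
  shows "star_hom \<phi>"
  using assms by (simp add: star_hom_def star_hom_on_def)

lemma star_hom_comp:
  assumes "star_hom \<phi>" "star_hom \<psi>"
  shows "star_hom (\<lambda>x. \<psi> (\<phi> x))"
  by (rule star_homI) (simp_all add: star_hom_simps[OF assms(1)] star_hom_simps[OF assms(2)])

text \<open>The map \<open>T \<mapsto> V T V\<^sup>*\<close>. It is multiplicative for isometries \<open>V\<close>, but in general it maps \<open>1\<close> to the
  projection onto the range of \<open>V\<close>.\<close>

definition conj_by :: "('a :: chilbert_space \<Rightarrow> 'b :: chilbert_space) \<Rightarrow> 'a bop \<Rightarrow> 'b bop" where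
  "conj_by V T = Bop (\<lambda>y. V (T *\<^sub>V iso_adj V y))"

lemma conj_by_apply:
  assumes V: "isometry V"
  shows "conj_by V T *\<^sub>V y = V (T *\<^sub>V iso_adj V y)"
proof -
  have "bounded_linear (\<lambda>y. V (T *\<^sub>V iso_adj V y))"
  proof (rule bounded_linear_intro[where K = "norm T"])
    show "norm (V (T *\<^sub>V iso_adj V y)) \<le> norm y * norm T" for y
      using norm_bop_apply[of T "iso_adj V y"] norm_iso_adj_le[OF V, of y]
        mult_left_mono[OF norm_iso_adj_le[OF V, of y] norm_ge_zero[of T]]
      by (simp add: isometry_norm[OF V] mult.commute)
  qed (simp_all add: iso_adj_linear[OF V] isometry_simps[OF V] bop_add bop_scaleC scaleR_scaleC)
  then have "bop_apply (Bop (\<lambda>y. V (T *\<^sub>V iso_adj V y))) = (\<lambda>y. V (T *\<^sub>V iso_adj V y))"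
    by (intro Bop_inverse)
      (simp add: iso_adj_linear[OF V] isometry_simps[OF V] bop_scaleC)
  then show ?thesis by (simp add: conj_by_def)
qed

lemma star_hom_conj_by:
  assumes V: "isometry V"
  shows "star_hom (conj_by V)"
proof (rule star_homI)
  show "conj_by V (x + y) = conj_by V x + conj_by V y" for x y
    by (rule bop_eqI) (simp add: conj_by_apply[OF V] bop_rep_eqs isometry_simps[OF V])
  show "conj_by V (c *\<^sub>C x) = c *\<^sub>C conj_by V x" for c x
    by (rule bop_eqI) (simp add: conj_by_apply[OF V] bop_rep_eqs isometry_simps[OF V])
  show "conj_by V (x * y) = conj_by V x * conj_by V y" for x y
    by (rule bop_eqI) (simp add: conj_by_apply[OF V] bop_rep_eqs iso_adj_cancel[OF V])
  show "conj_by V (x\<^sup>\<star>) = (conj_by V x)\<^sup>\<star>" for x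
    by (rule bop_star_eqI[symmetric])
      (simp add: conj_by_apply[OF V] cinner_star
        cinner_iso_adj[OF V] flip: cinner_iso_adj_right[OF V])
qed

subsection \<open>Tensor products of operators\<close>

lemma bop_tensor_add_left: "(S + S') \<otimes>\<^sub>o T = S \<otimes>\<^sub>o T + S' \<otimes>\<^sub>o T"
  and bop_tensor_add_right: "S \<otimes>\<^sub>o (T + T') = S \<otimes>\<^sub>o T + S \<otimes>\<^sub>o T'"
  and bop_tensor_scaleC_left: "(c *\<^sub>C S) \<otimes>\<^sub>o T = c *\<^sub>C (S \<otimes>\<^sub>o T)"
  and bop_tensor_scaleC_right: "S \<otimes>\<^sub>o (c *\<^sub>C T) = c *\<^sub>C (S \<otimes>\<^sub>o T)"
  and bop_tensor_mult: "(S \<otimes>\<^sub>o T) * (S' \<otimes>\<^sub>o T') = (S * S') \<otimes>\<^sub>o (T * T')"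
  and bop_tensor_one: "1 \<otimes>\<^sub>o 1 = 1"
  by (rule bop_tensor_unique; simp add: bop_tensor_apply bop_rep_eqs htens_add_left htens_add_right
      htens_scaleC_left htens_scaleC_right)+

lemma bop_tensor_zero [simp]: "0 \<otimes>\<^sub>o T = 0" "S \<otimes>\<^sub>o 0 = 0"
  using bop_tensor_scaleC_left[of 0 0 T] bop_tensor_scaleC_right[of S 0 0] by simp_all

lemma bop_tensor_star: "(S \<otimes>\<^sub>o T)\<^sup>\<star> = S\<^sup>\<star> \<otimes>\<^sub>o T\<^sup>\<star>"
proof (rule bop_tensor_unique)
  fix x y
  let ?L = "(S \<otimes>\<^sub>o T)\<^sup>\<star> *\<^sub>V (x \<otimes>\<^sub>h y)" and ?R = "(S\<^sup>\<star> \<otimes>\<^sub>o T\<^sup>\<star>) *\<^sub>V (x \<otimes>\<^sub>h y)"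
  let ?K = "{z. cinner ?L z = cinner ?R z}"
  have "z \<in> ?K" for z
  proof (rule dense_span_subspace[OF dense_span_htens])
    show "closed ?K"
      by (intro closed_Collect_eq bounded_linear.continuous_on[OF bounded_linear_cinner_right]
          continuous_on_id)
    show "cvs.subspace ?K"
      by (auto simp: cvs.subspace_def cinner_add_right cinner_scaleC_right)
    show "{x \<otimes>\<^sub>h y |x y. True} \<subseteq> ?K"
      by (auto simp: cinner_star bop_tensor_apply cinner_htens)
  qed
  then show "?L = ?R" by (intro cinner_eqI) simp
qed

lemma bop_tensor3_unique:
  fixes R R' :: "(('a :: chilbert_space \<otimes>\<^sub>H 'b :: chilbert_space) \<otimes>\<^sub>H 'c :: chilbert_space) bop"
  assumes "\<And>x y z. R *\<^sub>V ((x \<otimes>\<^sub>h y) \<otimes>\<^sub>h z) = R' *\<^sub>V ((x \<otimes>\<^sub>h y) \<otimes>\<^sub>h z)"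
  shows "R = R'"
proof (rule bop_eqI)
  fix v
  have "v \<in> {v. R *\<^sub>V v = R' *\<^sub>V v}"
  proof (rule dense_span_subspace[OF dense_span_htens3])
    show "closed {v. R *\<^sub>V v = R' *\<^sub>V v}"
      by (intro closed_Collect_eq bounded_linear.continuous_on[OF bop_bounded_linear]
          continuous_on_id)
    show "cvs.subspace {v. R *\<^sub>V v = R' *\<^sub>V v}"
      by (auto simp: cvs.subspace_def bop_add bop_scaleC)
  qed (auto simp: assms)
  then show "R *\<^sub>V v = R' *\<^sub>V v" by simp
qed

lemma star_hom_tensor_one: "star_hom (\<lambda>T. T \<otimes>\<^sub>o 1)"
  by (rule star_homI)
    (simp_all add: bop_tensor_add_left bop_tensor_scaleC_left bop_tensor_mult bop_tensor_star)

lemma conj_by_iso_tensor: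
  assumes V: "isometry V" and W: "isometry W"
  shows "conj_by (iso_tensor V W) (S \<otimes>\<^sub>o T) = conj_by V S \<otimes>\<^sub>o conj_by W T"
  by (rule bop_tensor_unique)
    (simp add: conj_by_apply V W isometry_iso_tensor iso_adj_tensor_htens iso_tensor_htens
      bop_tensor_apply)

section \<open>Positive operators\<close>

text \<open>Positive semidefinite: positivity in terms of the quadratic form. This is easier to verify than
  \<open>positive_in\<close> and does not depend on a subalgebra; the two are compared below.\<close>

definition psd :: "'a :: chilbert_space bop \<Rightarrow> bool" where
  "psd T \<longleftrightarrow> T\<^sup>\<star> = T \<and> (\<forall>v. 0 \<le> inner v (T *\<^sub>V v))"

lemma inner_star: "inner (T\<^sup>\<star> *\<^sub>V x) y = inner x (T *\<^sub>V y)" for T :: "'a :: chilbert_space bop"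
  by (simp add: inner_eq_Re_cinner cinner_star)

lemma psd_add: "psd S \<Longrightarrow> psd T \<Longrightarrow> psd (S + T)"
  by (auto simp: psd_def star_add bop_rep_eqs inner_add_right)

lemma psd_conj: "psd T \<Longrightarrow> psd (S\<^sup>\<star> * T * S)"
  by (auto simp: psd_def star_mult mult.assoc bop_rep_eqs)
    (metis inner_star star_star)

lemma psd_square: "psd (S\<^sup>\<star> * S)"
  by (auto simp: psd_def star_mult bop_rep_eqs) (metis inner_star inner_ge_zero star_star)

lemma psd_mult_projection:
  assumes "psd T" "projection p" "T * p = p * T"
  shows "psd (T * p)"
proof -
  have "T * p = p\<^sup>\<star> * T * p"
    using assms(2,3) by (metis mult.assoc projection_def)
  then show ?thesis using psd_conj[OF assms(1)] by metis
qed

lemma psd_minus_bounded: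
  assumes T: "T\<^sup>\<star> = T" "norm T \<le> r"
  shows "psd (r *\<^sub>R 1 - T)"
  unfolding psd_def
proof (intro conjI allI)
  show "(r *\<^sub>R 1 - T)\<^sup>\<star> = r *\<^sub>R 1 - T" by (simp add: star_diff star_scaleR T)
  fix v
  have "inner v (T *\<^sub>V v) \<le> norm v * norm (T *\<^sub>V v)" by (rule norm_cauchy_schwarz)
  also have "\<dots> \<le> norm v * (r * norm v)"
    using norm_bop_apply[of T v] mult_right_mono[OF T(2) norm_ge_zero[of v]]
    by (intro mult_left_mono) auto
  finally show "0 \<le> inner v ((r *\<^sub>R 1 - T) *\<^sub>V v)"
    by (simp add: bop_rep_eqs inner_diff_right power2_norm_eq_inner[symmetric] power2_eq_square
        mult.left_commute)
qed

text \<open>If \<open>0 \<le> T\<close> and \<open>norm T \<le> 1\<close>, then \<open>T\<^sup>2 \<le> T\<close> as quadratic forms, so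
  \<open>(norm (v - T v))\<^sup>2 = (norm v)\<^sup>2 - 2 \<langle>v, T v\<rangle> + (norm (T v))\<^sup>2 \<le> (norm v)\<^sup>2\<close>.\<close>

lemma psd_norm_le:
  assumes T: "psd T" "norm T \<le> 1"
  shows "norm (1 - T) \<le> 1"
proof (rule norm_bop_bound)
  fix v
  let ?w = "T *\<^sub>V v"
  have s: "inner (T *\<^sub>V x) y = inner x (T *\<^sub>V y)" for x y
    using inner_star[of T x y] T(1) by (simp add: psd_def)
  \<comment> \<open>Positivity of \<open>T\<close> at \<open>v - T v\<close> gives \<open>(norm (T v))\<^sup>2 \<le> \<langle>v, T v\<rangle>\<close>.\<close>
  have "0 \<le> inner (v - ?w) (T *\<^sub>V (v - ?w))" using T(1) by (auto simp: psd_def)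
  also have "\<dots> = inner v ?w - 2 * inner ?w ?w + inner ?w (T *\<^sub>V ?w)"
    using s[of v ?w] by (simp add: bop_diff inner_diff_left inner_diff_right)
  also have "inner ?w (T *\<^sub>V ?w) \<le> norm ?w * norm (T *\<^sub>V ?w)" by (rule norm_cauchy_schwarz)
  also have "\<dots> \<le> norm ?w * (1 * norm ?w)"
    using norm_bop_apply[of T ?w] mult_right_mono[OF T(2) norm_ge_zero[of ?w]]
    by (intro mult_left_mono) auto
  finally have "inner ?w ?w \<le> inner v ?w"
    by (simp add: power2_norm_eq_inner[symmetric] power2_eq_square)
  then have "inner (v - ?w) (v - ?w) \<le> inner v v"
    using inner_commute[of v ?w] inner_ge_zero[of ?w]
    unfolding inner_diff_left inner_diff_right by linarith
  then show "norm ((1 - T) *\<^sub>V v) \<le> 1 * norm v"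
    by (simp add: bop_rep_eqs norm_le)
qed simp

subsection \<open>Square roots\<close>

text \<open>All coefficients of \<open>(1 - x)\<^bsup>1/2\<^esup>\<close> except the first one are negative, and the partial sums of the
  coefficients have the closed form \<open>(-1)\<^bsup>n\<^esup> (-1/2 gchoose n) \<ge> 0\<close>. So the absolute values
  of the negative coefficients add up to at most \<open>1\<close>.\<close>

lemma summable_abs_gbinomial_half: "summable (\<lambda>n. \<bar>(1/2 :: real) gchoose n\<bar>)"
proof -
  let ?c = "\<lambda>n. (1/2 :: real) gchoose n"
  have sgn: "(-1) ^ n * ((-1/2 :: real) gchoose n) \<ge> 0" for n
  proof -
    have "(-1) ^ n * ((-1/2 :: real) gchoose n) = (1/2 + real n - 1) gchoose n"
      using gbinomial_minus[of "1/2 :: real" n] by simp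
    also have "\<dots> = pochhammer (1/2) n / fact n" 
      by (simp add: gbinomial_pochhammer' algebra_simps)
    also have "\<dots> \<ge> 0" by (intro divide_nonneg_pos pochhammer_nonneg) auto
    finally show ?thesis .
  qed
  have abs: "\<bar>?c (Suc n)\<bar> = - ((-1) ^ Suc n * ?c (Suc n))" for n
  proof -
    have "?c (Suc n) = (1/2) / real (Suc n) * ((-1/2) gchoose n)"
      using gbinomial_absorption[of n "1/2 :: real"] by (simp add: field_simps)
    then have "- ((-1) ^ Suc n * ?c (Suc n)) = (1/2) / real (Suc n) * ((-1) ^ n * ((-1/2) gchoose n))"
      by simp
    also have "\<dots> \<ge> 0" by (rule mult_nonneg_nonneg[OF _ sgn]) simp
    finally show ?thesis
      by (cases "even n") auto
  qed
  have "summable (\<lambda>n. \<bar>?c (Suc n)\<bar>)"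
  proof (rule summableI_nonneg_bounded)
    fix n
    have "(\<Sum>i<n. \<bar>?c (Suc i)\<bar>) = - (\<Sum>i<n. (-1) ^ Suc i * ?c (Suc i))"
      unfolding abs sum_negf ..
    also have "(\<Sum>i<n. (-1) ^ Suc i * ?c (Suc i)) = (\<Sum>i\<le>n. (-1) ^ i * ?c i) - 1"
      by (subst lessThan_Suc_atMost[symmetric], subst sum.lessThan_Suc_shift) simp
    also have "(\<Sum>i\<le>n. (-1) ^ i * ?c i) = (-1) ^ n * ((-1/2) gchoose n)"
      using gbinomial_sum_lower_neg[of "1/2 :: real" n] by (simp add: mult.commute)
    finally show "(\<Sum>i<n. \<bar>?c (Suc i)\<bar>) \<le> 1" using sgn[of n] by simp
  qed simp
  then show ?thesis by (subst summable_Suc_iff[symmetric])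
qed

definition star_subalgebra :: "'a :: unital_cstar_algebra set \<Rightarrow> bool" where
  "star_subalgebra B \<longleftrightarrow> 1 \<in> B \<and> cvs.subspace B \<and> (\<forall>x\<in>B. \<forall>y\<in>B. x * y \<in> B) \<and> (\<forall>x\<in>B. x\<^sup>\<star> \<in> B)"

lemma star_subalgebraD:
  assumes "star_subalgebra B"
  shows "1 \<in> B" "0 \<in> B" "x \<in> B \<Longrightarrow> y \<in> B \<Longrightarrow> x + y \<in> B" "x \<in> B \<Longrightarrow> y \<in> B \<Longrightarrow> x - y \<in> B"
    "x \<in> B \<Longrightarrow> c *\<^sub>C x \<in> B" "x \<in> B \<Longrightarrow> r *\<^sub>R x \<in> B" "x \<in> B \<Longrightarrow> y \<in> B \<Longrightarrow> x * y \<in> B"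
    "x \<in> B \<Longrightarrow> x\<^sup>\<star> \<in> B"
  using assms
  by (auto simp: star_subalgebra_def scaleR_scaleC cvs.subspace_0 cvs.subspace_add
      cvs.subspace_diff cvs.subspace_scale)

text \<open>The binomial series of \<open>(1 + X)\<^bsup>1/2\<^esup>\<close> converges absolutely even if \<open>norm X = 1\<close>. Its square is
  \<open>1 + X\<close> by the Cauchy product and the Vandermonde identity
  \<open>(\<Sum>i\<le>k. (1/2 gchoose i) * (1/2 gchoose (k - i))) = (1 gchoose k)\<close>.\<close>

lemma sqrt_one_plus:
  fixes X :: "'a :: unital_cstar_algebra"
  assumes B: "star_subalgebra B" "closed B" and X: "X \<in> B" "X\<^sup>\<star> = X" "norm X \<le> 1"
  shows "\<exists>Y\<in>B. Y\<^sup>\<star> = Y \<and> Y * Y = 1 + X"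
proof -
  let ?c = "\<lambda>n. (1/2 :: real) gchoose n"
  let ?f = "\<lambda>n. ?c n *\<^sub>R X ^ n"
  \<comment> \<open>In the zero algebra \<open>norm 1 = 0\<close>.\<close>
  have one: "norm (1 :: 'a) \<le> 1"
  proof -
    have "norm (1 :: 'a) * norm (1 :: 'a) = norm (1 :: 'a)"
      using cstar_identity[of "1 :: 'a"] by (simp add: power2_eq_square)
    then show ?thesis by (metis mult_cancel_left1 norm_eq_zero order.refl zero_le_one)
  qed
  have pow: "norm (X ^ n) \<le> 1" for n
  proof (induction n)
    case (Suc n)
    have "norm (X ^ Suc n) \<le> norm X * norm (X ^ n)" by (simp add: norm_mult_ineq)
    also have "\<dots> \<le> 1" using Suc X(3) by (simp add: mult_le_one)
    finally show ?case .
  qed (simp add: one)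
  have ns: "summable (\<lambda>n. norm (?f n))"
    by (rule summable_comparison_test'[OF summable_abs_gbinomial_half, of 0])
      (use pow in \<open>auto simp: mult_left_le\<close>)
  then have sf: "summable ?f" by (rule summable_norm_cancel)
  define Y where "Y = suminf ?f"
  have powB: "X ^ n \<in> B" for n
    by (induction n) (auto intro: star_subalgebraD[OF B(1)] X)
  have pows: "(X ^ n)\<^sup>\<star> = X ^ n" for n
    by (induction n) (simp_all add: star_mult X power_commutes)
  have "(\<lambda>n. sum ?f {..<n}) \<longlonglongrightarrow> Y"
    using summable_LIMSEQ[OF sf] by (simp add: Y_def)
  moreover have "sum ?f {..<n} \<in> B" for n
    by (induction n) (auto intro: star_subalgebraD[OF B(1)] powB)
  ultimately have "Y \<in> B"
    by (rule closed_sequentially[OF B(2), rotated])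
  moreover have "Y\<^sup>\<star> = Y"
    unfolding Y_def bounded_linear.suminf[OF bounded_linear_star sf]
    by (simp add: star_scaleR pows)
  moreover have "Y * Y = 1 + X"
  proof -
    have conv: "(\<Sum>i\<le>k. ?f i * ?f (k - i)) = (if k \<in> {0, 1} then X ^ k else 0)" for k
    proof -
      have "(\<Sum>i\<le>k. ?f i * ?f (k - i)) = (\<Sum>i\<le>k. (?c i * ?c (k - i)) *\<^sub>R X ^ k)"
        by (intro sum.cong) (auto simp flip: power_add)
      also have "\<dots> = (\<Sum>i\<le>k. ?c i * ?c (k - i)) *\<^sub>R X ^ k" by (rule scaleR_left.sum[symmetric])
      also have "(\<Sum>i\<le>k. ?c i * ?c (k - i)) = real (1 choose k)"
        using gbinomial_Vandermonde[of "1/2 :: real" "1/2" k] binomial_gbinomial[of 1 k, where 'a = real]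
        by (simp add: atLeast0AtMost)
      finally show ?thesis by (cases k) (auto simp: binomial_eq_0)
    qed
    have "Y * Y = (\<Sum>k. \<Sum>i\<le>k. ?f i * ?f (k - i))"
      unfolding Y_def by (rule Cauchy_product[OF ns ns])
    also have "\<dots> = (\<Sum>k. if k \<in> {0, 1} then X ^ k else 0)" unfolding conv ..
    also have "\<dots> = (\<Sum>k\<in>{0, 1}. X ^ k)"
      by (subst suminf_finite[of "{0, 1}"]) auto
    finally show ?thesis by simp
  qed
  ultimately show ?thesis by blast
qed

text \<open>After scaling to norm \<open>1\<close>, \<open>T = 1 + (T - 1)\<close> with \<open>norm (T - 1) \<le> 1\<close>, so that \<open>T\<close> has a self-adjoint
  square root in \<open>B\<close>.\<close>

lemma psd_imp_positive_in:
  assumes B: "star_subalgebra B" "closed B" and T: "T \<in> B" "psd T"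
  shows "positive_in B T"
proof (cases "T = 0")
  case True
  then show ?thesis
    using star_subalgebraD(2)[OF B(1)] by (auto simp: positive_in_def intro: bexI[of _ 0])
next
  case False
  define t where "t = norm T"
  have t: "t > 0" using False by (simp add: t_def)
  define S where "S = (1 / t) *\<^sub>R T"
  have psdS: "psd S" using T(2) t by (simp add: psd_def S_def star_scaleR bop_rep_eqs)
  have "norm S \<le> 1" using t by (simp add: S_def t_def)
  from psd_norm_le[OF psdS this] have "norm (S - 1) \<le> 1" by (simp add: norm_minus_commute)
  moreover have "S - 1 \<in> B"
    unfolding S_def by (intro star_subalgebraD[OF B(1)] T)
  moreover have "(S - 1)\<^sup>\<star> = S - 1" using psdS by (simp add: psd_def star_diff)
  ultimately obtain Y where Y: "Y \<in> B" "Y\<^sup>\<star> = Y" "Y * Y = S"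
    using sqrt_one_plus[OF B, of "S - 1"] by auto
  have "T = (sqrt t *\<^sub>R Y)\<^sup>\<star> * (sqrt t *\<^sub>R Y)"
    using t by (simp add: star_scaleR Y S_def)
  moreover have "sqrt t *\<^sub>R Y \<in> B" by (intro star_subalgebraD[OF B(1)] Y)
  ultimately show ?thesis unfolding positive_in_def by blast
qed

lemma positive_in_imp_psd: "positive_in B T \<Longrightarrow> psd T"
  by (auto simp: positive_in_def psd_square)

text \<open>The operator \<open>(norm T)\<^sup>2 - T\<^sup>* T\<close> is positive, hence of the form \<open>S\<^sup>* S\<close>; the image of this
  identity under \<open>\<phi>\<close> bounds \<open>\<phi> T\<close>. Since \<open>\<phi>\<close> need not be unital, the contraction \<open>\<phi> 1\<close> takes the
  place of the identity.\<close>

lemma star_hom_contractive: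
  fixes \<phi> :: "'a :: chilbert_space bop \<Rightarrow> 'b :: chilbert_space bop"
  assumes \<phi>: "star_hom \<phi>"
  shows "norm (\<phi> T) \<le> norm T"
proof -
  note simps = star_hom_simps[OF \<phi>]
  have "norm (T\<^sup>\<star> * T) \<le> (norm T)\<^sup>2" by (simp add: cstar_identity)
  then have "psd ((norm T)\<^sup>2 *\<^sub>R 1 - T\<^sup>\<star> * T)"
    by (intro psd_minus_bounded) (simp_all add: star_mult)
  moreover have "star_subalgebra (UNIV :: 'a bop set)"
    by (simp add: star_subalgebra_def)
  ultimately have "positive_in UNIV ((norm T)\<^sup>2 *\<^sub>R 1 - T\<^sup>\<star> * T)"
    by (intro psd_imp_positive_in) auto
  then obtain S where "(norm T)\<^sup>2 *\<^sub>R 1 - T\<^sup>\<star> * T = S\<^sup>\<star> * S"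
    by (auto simp: positive_in_def)
  then have "\<phi> ((norm T)\<^sup>2 *\<^sub>R 1 - T\<^sup>\<star> * T) = \<phi> (S\<^sup>\<star> * S)" by simp
  then have eq: "(norm T)\<^sup>2 *\<^sub>R \<phi> 1 - (\<phi> T)\<^sup>\<star> * \<phi> T = (\<phi> S)\<^sup>\<star> * \<phi> S"
    by (simp add: simps)
  have one: "\<phi> 1 = (\<phi> 1)\<^sup>\<star> * \<phi> 1" by (metis simps(3,4) mult_1_left star_one)
  have quad: "inner v ((R\<^sup>\<star> * R) *\<^sub>V v) = (norm (R *\<^sub>V v))\<^sup>2" for v and R :: "'b bop"
    using inner_star[of "R\<^sup>\<star>" v "R *\<^sub>V v"] by (simp add: bop_rep_eqs power2_norm_eq_inner)
  show ?thesis
  proof (rule norm_bop_bound)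
    fix v
    have n1: "norm (\<phi> 1 *\<^sub>V v) \<le> norm v"
    proof -
      have "(norm (\<phi> 1 *\<^sub>V v))\<^sup>2 = inner v (\<phi> 1 *\<^sub>V v)" using quad[of v "\<phi> 1"] one by simp
      also have "\<dots> \<le> norm v * norm (\<phi> 1 *\<^sub>V v)" by (rule norm_cauchy_schwarz)
      finally have "norm (\<phi> 1 *\<^sub>V v) * norm (\<phi> 1 *\<^sub>V v) \<le> norm v * norm (\<phi> 1 *\<^sub>V v)"
        by (simp add: power2_eq_square)
      then show ?thesis by (cases "norm (\<phi> 1 *\<^sub>V v) = 0") auto
    qed
    have "0 \<le> inner v (((\<phi> S)\<^sup>\<star> * \<phi> S) *\<^sub>V v)" unfolding quad by simp
    also have "\<dots> = (norm T)\<^sup>2 * inner v (\<phi> 1 *\<^sub>V v) - inner v (((\<phi> T)\<^sup>\<star> * \<phi> T) *\<^sub>V v)"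
      unfolding eq[symmetric] by (simp add: bop_rep_eqs inner_diff_right)
    also have "inner v (\<phi> 1 *\<^sub>V v) = (norm (\<phi> 1 *\<^sub>V v))\<^sup>2" using quad[of v "\<phi> 1"] one by simp
    finally have "(norm (\<phi> T *\<^sub>V v))\<^sup>2 \<le> (norm T * norm (\<phi> 1 *\<^sub>V v))\<^sup>2"
      by (simp add: quad power_mult_distrib)
    then have "norm (\<phi> T *\<^sub>V v) \<le> norm T * norm (\<phi> 1 *\<^sub>V v)"
      by (rule power2_le_imp_le) simp
    also have "\<dots> \<le> norm T * norm v" using n1 by (simp add: mult_left_mono)
    finally show "norm (\<phi> T *\<^sub>V v) \<le> norm T * norm v" .
  qed simp
qed

lemma star_hom_bounded_linear:
  fixes \<phi> :: "'a :: chilbert_space bop \<Rightarrow> 'b :: chilbert_space bop"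
  assumes \<phi>: "star_hom \<phi>"
  shows "bounded_linear \<phi>"
  by (rule bounded_linear_intro[where K = 1])
    (simp_all add: star_hom_simps[OF \<phi>] star_hom_contractive[OF \<phi>])

section \<open>Spatial tensor products\<close>

definition bounded_clinear ::
    "('a :: unital_cstar_algebra \<Rightarrow> 'b :: unital_cstar_algebra) \<Rightarrow> bool" where
  "bounded_clinear \<phi> \<longleftrightarrow> bounded_linear \<phi> \<and> (\<forall>c x. \<phi> (c *\<^sub>C x) = c *\<^sub>C \<phi> x)"

lemma star_hom_bounded_clinear:
  fixes \<phi> :: "'a :: chilbert_space bop \<Rightarrow> 'b :: chilbert_space bop"
  assumes "star_hom \<phi>"
  shows "bounded_clinear \<phi>"
  using star_hom_bounded_linear[OF assms] star_hom_simps(2)[OF assms]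
  by (simp add: bounded_clinear_def)

lemma bounded_clinear_mult:
  assumes "bounded_clinear \<phi>"
  shows "bounded_clinear (\<lambda>x. \<phi> x * a)" "bounded_clinear (\<lambda>x. a * \<phi> x)"
  using assms
  by (auto simp: bounded_clinear_def mult_scaleC_left mult_scaleC_right
      intro: bounded_linear_mult_left[THEN bounded_linear_compose]
        bounded_linear_mult_right[THEN bounded_linear_compose])

lemma bounded_clinear_add:
  "bounded_clinear \<phi> \<Longrightarrow> bounded_clinear \<psi> \<Longrightarrow> bounded_clinear (\<lambda>x. \<phi> x + \<psi> x)"
  by (auto simp: bounded_clinear_def scaleC_add_right intro: bounded_linear_add)

lemma bounded_clinear_diff:
  "bounded_clinear \<phi> \<Longrightarrow> bounded_clinear \<psi> \<Longrightarrow> bounded_clinear (\<lambda>x. \<phi> x - \<psi> x)"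
  by (auto simp: bounded_clinear_def cvs.scale_right_diff_distrib intro: bounded_linear_sub)

lemma closed_spatial_tensor: "closed (spatial_tensor A B)"
  by (simp add: spatial_tensor_def)

lemma subspace_spatial_tensor: "cvs.subspace (spatial_tensor A B)"
  unfolding spatial_tensor_def
  by (intro subspace_closure continuous_on_scaleC_cstar cvs.subspace_span)

lemma tensor_in_spatial_tensor: "a \<in> A \<Longrightarrow> b \<in> B \<Longrightarrow> a \<otimes>\<^sub>o b \<in> spatial_tensor A B"
  unfolding spatial_tensor_def by (intro subsetD[OF closure_subset] cvs.span_base) auto

lemma spatial_tensor_minimal:
  assumes "closed D" "cvs.subspace D" "\<And>a b. a \<in> A \<Longrightarrow> b \<in> B \<Longrightarrow> a \<otimes>\<^sub>o b \<in> D"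
  shows "spatial_tensor A B \<subseteq> D"
  unfolding spatial_tensor_def using assms by (intro closure_minimal cvs.span_minimal) auto

text \<open>The preimage of a closed subspace under a continuous linear map is a closed subspace, so it
  contains the spatial tensor product if it contains the elementary tensors.\<close>

lemma bounded_clinear_spatial_tensor_mem:
  fixes \<phi> :: "('a :: chilbert_space \<otimes>\<^sub>H 'b :: chilbert_space) bop \<Rightarrow> 'c :: unital_cstar_algebra"
  assumes \<phi>: "bounded_clinear \<phi>" and D: "closed D" "cvs.subspace D"
    and gen: "\<And>a b. a \<in> A \<Longrightarrow> b \<in> B \<Longrightarrow> \<phi> (a \<otimes>\<^sub>o b) \<in> D" and T: "T \<in> spatial_tensor A B"
  shows "\<phi> T \<in> D"
proof -
  have lin: "bounded_linear \<phi>" "\<And>c x. \<phi> (c *\<^sub>C x) = c *\<^sub>C \<phi> x"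
    using \<phi> by (auto simp: bounded_clinear_def)
  have "spatial_tensor A B \<subseteq> \<phi> -` D"
  proof (rule spatial_tensor_minimal)
    show "closed (\<phi> -` D)"
      by (intro continuous_closed_vimage D bounded_linear.isCont[OF lin(1)] continuous_ident)
    show "cvs.subspace (\<phi> -` D)"
      using D(2) linear_0[OF bounded_linear.linear[OF lin(1)]]
      by (auto simp: cvs.subspace_def lin(2) linear_add[OF bounded_linear.linear[OF lin(1)]])
  qed (simp add: gen)
  with T show ?thesis by auto
qed

lemma spatial_tensor_eqI:
  assumes "bounded_clinear \<phi>" "bounded_clinear \<psi>"
    and "\<And>a b. a \<in> A \<Longrightarrow> b \<in> B \<Longrightarrow> \<phi> (a \<otimes>\<^sub>o b) = \<psi> (a \<otimes>\<^sub>o b)" and "T \<in> spatial_tensor A B"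
  shows "\<phi> T = \<psi> T"
  using bounded_clinear_spatial_tensor_mem[OF bounded_clinear_diff[OF assms(1,2)], of "{0}" A B T] assms
  by (simp add: cvs.subspace_single_0)

text \<open>Closure under products follows by density in one factor at a time.\<close>

lemma star_subalgebra_spatial_tensor:
  assumes A: "star_subalgebra A" and B: "star_subalgebra B"
  shows "star_subalgebra (spatial_tensor A B)"
proof -
  let ?S = "spatial_tensor A B"
  note sub = subspace_spatial_tensor[of A B] and cl = closed_spatial_tensor[of A B]
  have id: "bounded_clinear (\<lambda>x :: ('a \<otimes>\<^sub>H 'b) bop. x)"
    by (simp add: bounded_clinear_def bounded_linear_ident)
  have "x * (a \<otimes>\<^sub>o b) \<in> ?S" if "x \<in> ?S" "a \<in> A" "b \<in> B" for x a b
    by (rule bounded_clinear_spatial_tensor_mem[OF bounded_clinear_mult(1)[OF id] cl sub _ that(1)])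
      (use that in \<open>auto simp: bop_tensor_mult intro!: tensor_in_spatial_tensor
        star_subalgebraD[OF A] star_subalgebraD[OF B]\<close>)
  then have "x * y \<in> ?S" if "x \<in> ?S" "y \<in> ?S" for x y
    by (rule bounded_clinear_spatial_tensor_mem[OF bounded_clinear_mult(2)[OF id] cl sub _ that(2)])
      (use that in auto)
  moreover have "1 \<in> ?S"
    using tensor_in_spatial_tensor[OF star_subalgebraD(1)[OF A] star_subalgebraD(1)[OF B]]
    by (simp add: bop_tensor_one)
  moreover have "?S \<subseteq> star -` ?S"
  proof (rule spatial_tensor_minimal)
    show "closed (star -` ?S)"
      by (intro continuous_closed_vimage cl bounded_linear.isCont[OF bounded_linear_star]
          continuous_ident)
    show "cvs.subspace (star -` ?S)"
      using sub by (auto simp: cvs.subspace_def star_add star_scaleC)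
    show "a \<otimes>\<^sub>o b \<in> star -` ?S" if "a \<in> A" "b \<in> B" for a b
      using that by (auto simp: bop_tensor_star intro!: tensor_in_spatial_tensor
          star_subalgebraD[OF A] star_subalgebraD[OF B])
  qed
  ultimately show ?thesis using sub by (auto simp: star_subalgebra_def)
qed

text \<open>The *-morphism selected by \<open>tensor_hom\<close> is determined by its values on elementary tensors. So any
  explicit *-homomorphism with these values shows existence and gives the value at every point.\<close>

lemma tensor_hom_eq:
  fixes \<phi> :: "('a :: chilbert_space \<otimes>\<^sub>H 'b :: chilbert_space) bop \<Rightarrow> 'c :: chilbert_space bop"
  assumes \<phi>: "star_hom \<phi>" and gen: "\<And>a b. a \<in> A \<Longrightarrow> b \<in> B \<Longrightarrow> \<phi> (a \<otimes>\<^sub>o b) = f a b"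
    and T: "T \<in> spatial_tensor A B"
  shows "tensor_hom A B f T = \<phi> T"
proof -
  let ?S = "spatial_tensor A B" and ?G = "{a \<otimes>\<^sub>o b |a b. a \<in> A \<and> b \<in> B}"
  let ?P = "\<lambda>\<psi>. star_hom_on ?S \<psi> \<and> continuous_on ?S \<psi> \<and> (\<forall>a\<in>A. \<forall>b\<in>B. \<psi> (a \<otimes>\<^sub>o b) = f a b)"
  define \<psi> where "\<psi> = tensor_hom A B f"
  have cont: "continuous_on ?S \<phi>"
    by (rule bounded_linear.continuous_on[OF star_hom_bounded_linear[OF \<phi>] continuous_on_id])
  then have "?P \<phi>"
    using \<phi> gen by (auto simp: star_hom_def star_hom_on_def)
  then have \<psi>: "?P \<psi>" unfolding \<psi>_def tensor_hom_def by (rule someI[where P = ?P])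
  have lin: "\<psi> (x + y) = \<psi> x + \<psi> y" "\<psi> (c *\<^sub>C x) = c *\<^sub>C \<psi> x" if "x \<in> ?S" "y \<in> ?S" for x y c
    using \<psi> that by (auto simp: star_hom_on_def)
  have S: "0 \<in> ?S" by (rule cvs.subspace_0[OF subspace_spatial_tensor])
  have "\<psi> T - \<phi> T = 0"
  proof (rule continuous_constant_on_closure[where f = "\<lambda>T. \<psi> T - \<phi> T"])
    show "continuous_on (closure (cvs.span ?G)) (\<lambda>T. \<psi> T - \<phi> T)"
      using \<psi> cont unfolding spatial_tensor_def by (intro continuous_on_diff) auto
    show "T \<in> closure (cvs.span ?G)" using T by (simp add: spatial_tensor_def)
    \<comment> \<open>\<open>\<psi>\<close> is known to be linear on \<open>?S\<close> only, so membership is carried along in the induction.\<close>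
    have "x \<in> ?S \<and> \<psi> x = \<phi> x" if "x \<in> cvs.span ?G" for x
      using that
    proof (induction rule: cvs.span_induct_alt)
      case base
      show ?case using lin(2)[OF S S, of 0] star_hom_simps(6)[OF \<phi>] S by simp
    next
      case (step c x y)
      then obtain a b where x: "x = a \<otimes>\<^sub>o b" "a \<in> A" "b \<in> B" by auto
      then have xS: "x \<in> ?S" by (simp add: tensor_in_spatial_tensor)
      then have cx: "c *\<^sub>C x \<in> ?S" by (rule cvs.subspace_scale[OF subspace_spatial_tensor])
      have "\<psi> x = \<phi> x" using \<psi> gen x by auto
      then show ?case
        using step lin(1)[OF cx, of y] lin(2)[OF xS xS, of c] star_hom_simps(1,2)[OF \<phi>]
          cvs.subspace_add[OF subspace_spatial_tensor cx, of y]
        by simp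
    qed
    then show "\<psi> x - \<phi> x = 0" if "x \<in> cvs.span ?G" for x using that by simp
  qed
  then show ?thesis by (simp add: \<psi>_def)
qed

section \<open>Flips and leg embeddings\<close>

lemma ex_tensor_permutation:
  fixes t :: "'h :: chilbert_space \<Rightarrow> 'k :: chilbert_space \<Rightarrow> 'l :: chilbert_space \<Rightarrow> 'm :: chilbert_space"
  assumes t: "\<And>x y z x' y' z'. cinner (t x y z) (t x' y' z') = cinner x x' * cinner y y' * cinner z z'"
  shows "\<exists>U. isometry U \<and> (\<forall>x y z. U ((x \<otimes>\<^sub>h y) \<otimes>\<^sub>h z) = t x y z)"
proof -
  let ?g = "\<lambda>(x :: 'h, y :: 'k, z :: 'l). (x \<otimes>\<^sub>h y) \<otimes>\<^sub>h z"
  have "range ?g = {(x \<otimes>\<^sub>h y) \<otimes>\<^sub>h z |x y z. True}"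
    by (auto simp: image_iff) metis
  then have "dense_span (range ?g)" by (simp only: dense_span_htens3)
  then have "\<exists>U. isometry U \<and> (\<forall>p. U (?g p) = (\<lambda>(x, y, z). t x y z) p)"
    by (rule isometry_extension) (auto simp: t cinner_htens)
  then show ?thesis by (simp add: split_paired_all)
qed

text \<open>Amplify to \<open>T \<otimes>\<^sub>o 1\<close> and permute the tensor factors by a unitary. Its adjoint is known on elementary
  tensors because these are images of elementary tensors.\<close>

lemma ex_leg13:
  "\<exists>\<phi> :: ('a :: chilbert_space \<otimes>\<^sub>H 'b :: chilbert_space) bop \<Rightarrow> (('a \<otimes>\<^sub>H 'c :: chilbert_space) \<otimes>\<^sub>H 'b) bop.
     star_hom \<phi> \<and> (\<forall>a b. \<phi> (a \<otimes>\<^sub>o b) = (a \<otimes>\<^sub>o 1) \<otimes>\<^sub>o b)"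
proof -
  obtain U :: "(('a \<otimes>\<^sub>H 'b) \<otimes>\<^sub>H 'c) \<Rightarrow> (('a \<otimes>\<^sub>H 'c) \<otimes>\<^sub>H 'b)" where
    U: "isometry U" "\<And>x y z. U ((x \<otimes>\<^sub>h y) \<otimes>\<^sub>h z) = (x \<otimes>\<^sub>h z) \<otimes>\<^sub>h y"
    using ex_tensor_permutation[of "\<lambda>(x :: 'a) (y :: 'b) (z :: 'c). (x \<otimes>\<^sub>h z) \<otimes>\<^sub>h y"]
    by (auto simp: cinner_htens)
  have adj: "iso_adj U ((x \<otimes>\<^sub>h z) \<otimes>\<^sub>h y) = (x \<otimes>\<^sub>h y) \<otimes>\<^sub>h z" for x y z
    using iso_adj_cancel[OF U(1), of "(x \<otimes>\<^sub>h y) \<otimes>\<^sub>h z"] by (simp add: U(2))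
  have "conj_by U ((a \<otimes>\<^sub>o b) \<otimes>\<^sub>o 1) = (a \<otimes>\<^sub>o 1) \<otimes>\<^sub>o b" for a b
    by (rule bop_tensor3_unique)
      (simp add: conj_by_apply[OF U(1)] adj U(2) bop_tensor_apply one_bop.rep_eq)
  moreover have "star_hom (\<lambda>T. conj_by U (T \<otimes>\<^sub>o 1))"
    by (rule star_hom_comp[OF star_hom_tensor_one star_hom_conj_by[OF U(1)]])
  ultimately show ?thesis by blast
qed

lemma ex_leg23:
  "\<exists>\<phi> :: ('a :: chilbert_space \<otimes>\<^sub>H 'b :: chilbert_space) bop \<Rightarrow> (('c :: chilbert_space \<otimes>\<^sub>H 'a) \<otimes>\<^sub>H 'b) bop.
     star_hom \<phi> \<and> (\<forall>a b. \<phi> (a \<otimes>\<^sub>o b) = (1 \<otimes>\<^sub>o a) \<otimes>\<^sub>o b)"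
proof -
  obtain U :: "(('a \<otimes>\<^sub>H 'b) \<otimes>\<^sub>H 'c) \<Rightarrow> (('c \<otimes>\<^sub>H 'a) \<otimes>\<^sub>H 'b)" where
    U: "isometry U" "\<And>x y z. U ((x \<otimes>\<^sub>h y) \<otimes>\<^sub>h z) = (z \<otimes>\<^sub>h x) \<otimes>\<^sub>h y"
    using ex_tensor_permutation[of "\<lambda>(x :: 'a) (y :: 'b) (z :: 'c). (z \<otimes>\<^sub>h x) \<otimes>\<^sub>h y"]
    by (auto simp: cinner_htens)
  have adj: "iso_adj U ((z \<otimes>\<^sub>h x) \<otimes>\<^sub>h y) = (x \<otimes>\<^sub>h y) \<otimes>\<^sub>h z" for x y z
    using iso_adj_cancel[OF U(1), of "(x \<otimes>\<^sub>h y) \<otimes>\<^sub>h z"] by (simp add: U(2))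
  have "conj_by U ((a \<otimes>\<^sub>o b) \<otimes>\<^sub>o 1) = (1 \<otimes>\<^sub>o a) \<otimes>\<^sub>o b" for a b
    by (rule bop_tensor3_unique)
      (simp add: conj_by_apply[OF U(1)] adj U(2) bop_tensor_apply one_bop.rep_eq)
  moreover have "star_hom (\<lambda>T. conj_by U (T \<otimes>\<^sub>o 1))"
    by (rule star_hom_comp[OF star_hom_tensor_one star_hom_conj_by[OF U(1)]])
  ultimately show ?thesis by blast
qed

lemma ex_flip:
  "\<exists>\<phi> :: ('a :: chilbert_space \<otimes>\<^sub>H 'b :: chilbert_space) bop \<Rightarrow> ('b \<otimes>\<^sub>H 'a) bop.
     star_hom \<phi> \<and> (\<forall>a b. \<phi> (a \<otimes>\<^sub>o b) = b \<otimes>\<^sub>o a)"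
proof -
  let ?g = "\<lambda>p :: 'a \<times> 'b. fst p \<otimes>\<^sub>h snd p"
  have "range ?g = {x \<otimes>\<^sub>h y |x y. True}"
    by (auto simp: image_iff) metis
  then have "dense_span (range ?g)" by (simp only: dense_span_htens)
  then have "\<exists>U. isometry U \<and> (\<forall>p. U (?g p) = snd p \<otimes>\<^sub>h fst p)"
    by (rule isometry_extension) (simp add: cinner_htens)
  then obtain U :: "('a \<otimes>\<^sub>H 'b) \<Rightarrow> ('b \<otimes>\<^sub>H 'a)" where
    U: "isometry U" "\<And>x y. U (x \<otimes>\<^sub>h y) = y \<otimes>\<^sub>h x" by auto
  have adj: "iso_adj U (y \<otimes>\<^sub>h x) = x \<otimes>\<^sub>h y" for x y
    using iso_adj_cancel[OF U(1), of "x \<otimes>\<^sub>h y"] by (simp add: U(2))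
  have "conj_by U (a \<otimes>\<^sub>o b) = b \<otimes>\<^sub>o a" for a b
    by (rule bop_tensor_unique) (simp add: conj_by_apply[OF U(1)] adj U(2) bop_tensor_apply)
  then show ?thesis using star_hom_conj_by[OF U(1)] by blast
qed

text \<open>The embeddings of the operators on two tensor factors into the operators on three factors; the
  indices name the factors that are acted upon. For the maps on a compact quantum metric space,
  \<open>leg12 \<rho>\<close> is \<open>\<rho> \<otimes> 1\<close>, \<open>leg23 \<rho>\<close> is \<open>1 \<otimes> \<rho>\<close>, and \<open>leg13 \<rho>\<close> is the middle map.\<close>

definition leg12 :: "('a :: chilbert_space \<otimes>\<^sub>H 'b :: chilbert_space) bop \<Rightarrow>
    (('a \<otimes>\<^sub>H 'b) \<otimes>\<^sub>H 'c :: chilbert_space) bop" where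
  "leg12 T = T \<otimes>\<^sub>o 1"

definition leg13 :: "('a :: chilbert_space \<otimes>\<^sub>H 'b :: chilbert_space) bop \<Rightarrow>
    (('a \<otimes>\<^sub>H 'c :: chilbert_space) \<otimes>\<^sub>H 'b) bop" where
  "leg13 = (SOME \<phi>. star_hom \<phi> \<and> (\<forall>a b. \<phi> (a \<otimes>\<^sub>o b) = (a \<otimes>\<^sub>o 1) \<otimes>\<^sub>o b))"

definition leg23 :: "('a :: chilbert_space \<otimes>\<^sub>H 'b :: chilbert_space) bop \<Rightarrow>
    (('c :: chilbert_space \<otimes>\<^sub>H 'a) \<otimes>\<^sub>H 'b) bop" where
  "leg23 = (SOME \<phi>. star_hom \<phi> \<and> (\<forall>a b. \<phi> (a \<otimes>\<^sub>o b) = (1 \<otimes>\<^sub>o a) \<otimes>\<^sub>o b))"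

definition flip :: "('a :: chilbert_space \<otimes>\<^sub>H 'b :: chilbert_space) bop \<Rightarrow> ('b \<otimes>\<^sub>H 'a) bop" where
  "flip = (SOME \<phi>. star_hom \<phi> \<and> (\<forall>a b. \<phi> (a \<otimes>\<^sub>o b) = b \<otimes>\<^sub>o a))"

lemma leg12: "star_hom leg12" "leg12 (a \<otimes>\<^sub>o b) = (a \<otimes>\<^sub>o b) \<otimes>\<^sub>o 1"
  using star_hom_tensor_one unfolding leg12_def[abs_def] by auto

lemma leg13: "star_hom leg13" "leg13 (a \<otimes>\<^sub>o b) = (a \<otimes>\<^sub>o 1) \<otimes>\<^sub>o b"
  using someI_ex[OF ex_leg13, folded leg13_def] by auto

lemma leg23: "star_hom leg23" "leg23 (a \<otimes>\<^sub>o b) = (1 \<otimes>\<^sub>o a) \<otimes>\<^sub>o b"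
  using someI_ex[OF ex_leg23, folded leg23_def] by auto

lemma flip: "star_hom flip" "flip (a \<otimes>\<^sub>o b) = b \<otimes>\<^sub>o a"
  using someI_ex[OF ex_flip, folded flip_def] by auto

section \<open>Projections and the diagonal projection\<close>

lemma inner_scaleC_i: "inner x (\<i> *\<^sub>C y) = - Im (cinner x y)"
  by (simp add: inner_eq_Re_cinner cinner_scaleC_right)

lemma parallelogram:
  fixes x y :: "'a :: real_inner"
  shows "(norm (x - y))\<^sup>2 = 2 * (norm x)\<^sup>2 + 2 * (norm y)\<^sup>2 - (norm (x + y))\<^sup>2"
  by (simp add: power2_norm_eq_inner inner_add_left inner_add_right inner_diff_left
      inner_diff_right inner_commute)

text \<open>By the parallelogram law, points of \<open>K\<close> that almost realise the distance to \<open>x\<close> are close to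
  each other, since their midpoint lies in \<open>K\<close> as well. So a minimising sequence is Cauchy.\<close>

lemma ex_closest_point:
  fixes K :: "'a :: chilbert_space set"
  assumes K: "closed K" "cvs.subspace K"
  shows "\<exists>y\<in>K. \<forall>z\<in>K. dist x y \<le> dist x z"
proof -
  define d where "d = infdist x K"
  have ne: "K \<noteq> {}" using cvs.subspace_0[OF K(2)] by auto
  have dle: "d \<le> dist x z" if "z \<in> K" for z unfolding d_def by (rule infdist_le[OF that])
  have d0: "d \<ge> 0" by (simp add: d_def infdist_nonneg)
  have "\<exists>y\<in>K. dist x y < d + 1 / real (Suc n)" for n
  proof -
    have "infdist x K < d + 1 / real (Suc n)" by (simp add: d_def)
    then show ?thesis
      unfolding infdist_notempty[OF ne] by (subst (asm) cINF_less_iff) (auto simp: ne)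
  qed
  then obtain y where y: "\<And>n. y n \<in> K" "\<And>n. dist x (y n) < d + 1 / real (Suc n)" by metis
  have close: "(norm (y m - y n))\<^sup>2 \<le> 4 * (2 * d + 1) * e"
    if e: "1 / real (Suc m) \<le> e" "1 / real (Suc n) \<le> e" "e \<le> 1" for m n e
  proof -
    have e0: "e \<ge> 0" using e(1) order_trans[of 0 "1 / real (Suc m)" e] by simp
    have sq: "(norm (x - y k))\<^sup>2 \<le> d\<^sup>2 + (2 * d + 1) * e" if "1 / real (Suc k) \<le> e" for k
    proof -
      have "norm (x - y k) \<le> d + e" using y(2)[of k] that by (simp add: dist_norm)
      then have "(norm (x - y k))\<^sup>2 \<le> (d + e)\<^sup>2" by (intro power_mono) auto
      also have "\<dots> \<le> d\<^sup>2 + (2 * d + 1) * e"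
        using mult_right_mono[OF e(3) e0] by (simp add: power2_eq_square algebra_simps)
      finally show ?thesis .
    qed
    have "(1/2) *\<^sub>R (y m + y n) \<in> K"
      unfolding scaleR_scaleC by (intro cvs.subspace_scale[OF K(2)] cvs.subspace_add[OF K(2)] y)
    then have "d \<le> norm (x - (1/2) *\<^sub>R (y m + y n))" using dle by (simp add: dist_norm)
    then have "d\<^sup>2 \<le> (norm (x - (1/2) *\<^sub>R (y m + y n)))\<^sup>2" using d0 by (intro power_mono)
    also have "(x - y m) + (x - y n) = 2 *\<^sub>R (x - (1/2) *\<^sub>R (y m + y n))"
      by (simp add: scaleR_diff_right scaleR_2)
    then have "(norm (x - (1/2) *\<^sub>R (y m + y n)))\<^sup>2 = (norm ((x - y m) + (x - y n)))\<^sup>2 / 4"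
      by (simp add: power_mult_distrib)
    finally have "4 * d\<^sup>2 \<le> (norm ((x - y m) + (x - y n)))\<^sup>2" by simp
    moreover have "(norm (y m - y n))\<^sup>2 = (norm ((x - y m) - (x - y n)))\<^sup>2"
      by (simp add: norm_minus_commute)
    ultimately show ?thesis
      using parallelogram[of "x - y m" "x - y n"] sq[OF e(1)] sq[OF e(2)]
      unfolding mult.assoc by linarith
  qed
  have "Cauchy y"
  proof (rule CauchyI)
    fix e :: real assume e: "e > 0"
    \<comment> \<open>Chosen such that the bound in \<open>close\<close> is at most \<open>e\<^sup>2 / 2\<close>.\<close>
    define c where "c = min 1 (e\<^sup>2 / (8 * (2 * d + 1)))"
    have c: "c > 0" "c \<le> 1" using e d0 by (auto simp: c_def)
    have "4 * (2 * d + 1) * c \<le> 4 * (2 * d + 1) * (e\<^sup>2 / (8 * (2 * d + 1)))"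
      using d0 by (intro mult_left_mono) (auto simp: c_def)
    also have "\<dots> = e\<^sup>2 / 2" using d0 by (simp add: field_simps)
    also have "\<dots> < e\<^sup>2" using e by simp
    finally have ce: "4 * (2 * d + 1) * c < e\<^sup>2" .
    obtain N where N: "1 / real (Suc N) < c"
      using c(1) by (metis inverse_eq_divide reals_Archimedean)
    have le: "1 / real (Suc n) \<le> c" if "n \<ge> N" for n
      using that N by (intro order_trans[OF _ less_imp_le[OF N]]) (simp add: frac_le)
    have "norm (y m - y n) < e" if "m \<ge> N" "n \<ge> N" for m n
      using close[OF le[OF that(1)] le[OF that(2)] c(2)] ce e
      by (intro power2_less_imp_less[of _ e]) auto
    then show "\<exists>M. \<forall>m\<ge>M. \<forall>n\<ge>M. norm (y m - y n) < e" by blast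
  qed
  then obtain l where l: "y \<longlonglongrightarrow> l" using Cauchy_convergent convergent_def by blast
  have "l \<in> K" using closed_sequentially[OF K(1) y(1) l] .
  moreover have "dist x l \<le> d"
  proof (rule LIMSEQ_le)
    show "(\<lambda>n. dist x (y n)) \<longlonglongrightarrow> dist x l" by (intro tendsto_intros l)
    show "(\<lambda>n. d + 1 / real (Suc n)) \<longlonglongrightarrow> d"
      using tendsto_add[OF tendsto_const LIMSEQ_inverse_real_of_nat, of d]
      by (simp add: inverse_eq_divide)
  qed (use y(2) less_imp_le in blast)
  ultimately show ?thesis using dle by (meson order_trans)
qed

text \<open>The closest point \<open>y\<close> works: moving from \<open>y\<close> in the direction \<open>z \<in> K\<close> would decrease the distance to
  \<open>x\<close> unless \<open>x - y\<close> and \<open>z\<close> are orthogonal. This gives real orthogonality; complex orthogonality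
  follows with \<open>\<i> z\<close> in place of \<open>z\<close>.\<close>

lemma ex_orthogonal_decomposition:
  fixes K :: "'a :: chilbert_space set"
  assumes K: "closed K" "cvs.subspace K"
  shows "\<exists>y\<in>K. \<forall>z\<in>K. cinner (x - y) z = 0"
proof -
  obtain y where y: "y \<in> K" "\<And>z. z \<in> K \<Longrightarrow> dist x y \<le> dist x z"
    using ex_closest_point[OF K, of x] by blast
  have inner0: "inner (x - y) z = 0" if z: "z \<in> K" for z
  proof (cases "z = 0")
    case False
    \<comment> \<open>The minimiser of \<open>norm (x - y - t z)\<close>.\<close>
    define t where "t = inner (x - y) z / (norm z)\<^sup>2"
    have "y + t *\<^sub>R z \<in> K"
      unfolding scaleR_scaleC by (intro cvs.subspace_add[OF K(2)] cvs.subspace_scale[OF K(2)] y z)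
    then have "norm (x - y) \<le> norm ((x - y) - t *\<^sub>R z)"
      using y(2)[of "y + t *\<^sub>R z"] by (simp add: dist_norm algebra_simps)
    then have "inner (x - y) (x - y) \<le> inner ((x - y) - t *\<^sub>R z) ((x - y) - t *\<^sub>R z)"
      by (simp add: norm_le)
    also have "\<dots> = inner (x - y) (x - y) - 2 * t * inner (x - y) z + t * t * (norm z)\<^sup>2"
    proof -
      have "inner (w - t *\<^sub>R z) (w - t *\<^sub>R z) = inner w w - 2 * t * inner w z + t * t * (norm z)\<^sup>2"
        for w
        using inner_commute[of z w]
        by (simp add: inner_diff_left inner_diff_right power2_norm_eq_inner algebra_simps)
      then show ?thesis .
    qed
    also have "t * t * (norm z)\<^sup>2 = t * inner (x - y) z"
    proof -
      have "t * (norm z)\<^sup>2 = inner (x - y) z" using False by (simp add: t_def)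
      then show ?thesis by simp
    qed
    finally have "t * inner (x - y) z \<le> 0" by simp
    moreover have "t * inner (x - y) z = (inner (x - y) z)\<^sup>2 / (norm z)\<^sup>2"
      by (simp add: t_def power2_eq_square)
    ultimately have "(inner (x - y) z)\<^sup>2 \<le> 0" using False by (simp add: divide_le_0_iff)
    then show ?thesis by simp
  qed simp
  have "cinner (x - y) z = 0" if z: "z \<in> K" for z
  proof (rule complex_eqI)
    show "Re (cinner (x - y) z) = Re 0" using inner0[OF z] by (simp add: inner_eq_Re_cinner)
    show "Im (cinner (x - y) z) = Im 0"
      using inner0[OF cvs.subspace_scale[OF K(2) z, of \<i>]] by (simp add: inner_scaleC_i)
  qed
  then show ?thesis using y(1) by blast
qed

lemma ex_projection_onto:
  fixes K :: "'a :: chilbert_space set"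
  assumes K: "closed K" "cvs.subspace K"
  shows "\<exists>P. projection P \<and> (\<forall>x. P *\<^sub>V x \<in> K) \<and> (\<forall>x\<in>K. P *\<^sub>V x = x)"
proof -
  obtain P where P: "\<And>x. P x \<in> K" "\<And>x z. z \<in> K \<Longrightarrow> cinner (x - P x) z = 0"
    using ex_orthogonal_decomposition[OF K] by metis
  have uniq: "P x = y" if y: "y \<in> K" "\<And>z. z \<in> K \<Longrightarrow> cinner (x - y) z = 0" for x y
  proof -
    have "P x - y \<in> K" by (intro cvs.subspace_diff[OF K(2)] P y)
    then have "cinner (x - y) (P x - y) - cinner (x - P x) (P x - y) = 0"
      using y(2) P(2) by simp
    then have "cinner (P x - y) (P x - y) = 0" by (simp flip: cinner_diff_left)
    then show ?thesis by (simp add: cinner_self)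
  qed
  have add: "P (x + y) = P x + P y" for x y
    by (rule uniq) (simp_all add: cvs.subspace_add[OF K(2)] P(1) add_diff_add cinner_add_left P(2))
  have sc: "P (c *\<^sub>C x) = c *\<^sub>C P x" for c x
    by (rule uniq) (simp_all add: cvs.subspace_scale[OF K(2)] P(1) cinner_scaleC_left P(2)
        flip: cvs.scale_right_diff_distrib)
  have inn: "cinner x (P y) = cinner (P x) (P y)" for x y
    using P(2)[OF P(1), of x y] by (simp add: cinner_diff_left)
  have bnd: "norm (P x) \<le> norm x" for x
  proof -
    have "norm (P x) * norm (P x) = cmod (cinner x (P x))"
      unfolding inn[of x x] by (simp add: cinner_self norm_mult power2_eq_square)
    also have "\<dots> \<le> norm x * norm (P x)" by (rule cmod_cinner_le)
    finally show ?thesis by (cases "P x = 0") auto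
  qed
  have "bounded_linear P"
    by (rule bounded_linear_intro[where K = 1]) (simp_all add: add sc scaleR_scaleC bnd)
  then have B: "bop_apply (Bop P) = P" by (intro Bop_inverse) (simp add: sc)
  have PK: "P x = x" if "x \<in> K" for x by (rule uniq[OF that]) simp
  have "(Bop P)\<^sup>\<star> = Bop P"
  proof (rule bop_star_eqI)
    show "cinner (Bop P *\<^sub>V x) y = cinner x (Bop P *\<^sub>V y)" for x y
      unfolding B inn[of x y] using inn[of y x] by (metis cinner_commute)
  qed
  moreover have "Bop P * Bop P = Bop P"
    by (rule bop_eqI) (simp add: B times_bop.rep_eq PK P(1))
  ultimately show ?thesis
    by (intro exI[of _ "Bop P"]) (simp add: projection_def B P(1) PK)
qed

definition star_closed :: "'a :: unital_cstar_algebra set \<Rightarrow> bool" where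
  "star_closed C \<longleftrightarrow> (\<forall>c\<in>C. c\<^sup>\<star> \<in> C)"

lemma star_closed_commutant:
  assumes "star_closed C"
  shows "star_closed (commutant C)"
  unfolding star_closed_def commutant_def
proof (intro ballI, elim CollectE, intro CollectI ballI)
  fix x c assume x: "\<forall>a\<in>C. x * a = a * x" and c: "c \<in> C"
  then have "x * c\<^sup>\<star> = c\<^sup>\<star> * x" using assms by (auto simp: star_closed_def)
  then have "(x * c\<^sup>\<star>)\<^sup>\<star> = (c\<^sup>\<star> * x)\<^sup>\<star>" by simp
  then show "x\<^sup>\<star> * c = c * x\<^sup>\<star>" by (simp add: star_mult)
qed

lemma subset_bicommutant: "S \<subseteq> bicommutant S"
  by (auto simp: commutant_def)

lemma projection_apply_self: "projection p \<Longrightarrow> p *\<^sub>V p *\<^sub>V x = p *\<^sub>V x"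
  by (metis projection_def times_bop.rep_eq)

text \<open>Let \<open>Q\<close> be the projection onto the common kernel \<open>K\<close>. Elements of \<open>C\<close> commute with the members of
  \<open>ps\<close> and hence map \<open>K\<close> to itself. As \<open>C\<close> is closed under adjoints, \<open>Q\<close> commutes with \<open>C\<close>, and
  \<open>1 - Q\<close> is the required projection.\<close>

lemma ex_projection_with_common_kernel:
  fixes C :: "'a :: chilbert_space bop set"
  assumes C: "star_closed C" and ps: "ps \<subseteq> commutant C"
  shows "\<exists>P\<in>commutant C. projection P \<and> (\<forall>x. P *\<^sub>V x = 0 \<longleftrightarrow> (\<forall>p\<in>ps. p *\<^sub>V x = 0))"
proof -
  define K where "K = {x. \<forall>p\<in>ps. p *\<^sub>V x = 0}"
  have "K = (\<Inter>p\<in>ps. {x. p *\<^sub>V x = 0})" by (auto simp: K_def)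
  moreover have "closed {x. p *\<^sub>V x = 0}" for p :: "'a bop"
    by (intro closed_Collect_eq bounded_linear.continuous_on[OF bop_bounded_linear]
        continuous_on_id continuous_on_const)
  ultimately have cl: "closed K" by (auto intro: closed_INT)
  have sub: "cvs.subspace K" by (auto simp: K_def cvs.subspace_def bop_add bop_scaleC)
  obtain Q where Q: "projection Q" "\<And>x. Q *\<^sub>V x \<in> K" "\<And>x. x \<in> K \<Longrightarrow> Q *\<^sub>V x = x"
    using ex_projection_onto[OF cl sub] by blast
  have QcQ: "Q * c * Q = c * Q" if c: "c \<in> C" for c
  proof (rule bop_eqI)
    fix x
    have "p *\<^sub>V c *\<^sub>V Q *\<^sub>V x = 0" if p: "p \<in> ps" for p
    proof -
      have "p * c = c * p" using p ps c by (auto simp: commutant_def)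
      then have "p *\<^sub>V c *\<^sub>V Q *\<^sub>V x = c *\<^sub>V p *\<^sub>V Q *\<^sub>V x" by (metis times_bop.rep_eq)
      also have "p *\<^sub>V Q *\<^sub>V x = 0" using Q(2) p by (auto simp: K_def)
      finally show ?thesis by simp
    qed
    then have "c *\<^sub>V Q *\<^sub>V x \<in> K" by (simp add: K_def)
    then show "(Q * c * Q) *\<^sub>V x = (c * Q) *\<^sub>V x" by (simp add: times_bop.rep_eq Q(3))
  qed
  have "Q * c = c * Q" if c: "c \<in> C" for c
  proof -
    have "c\<^sup>\<star> \<in> C" using C c by (simp add: star_closed_def)
    from arg_cong[OF QcQ[OF this], of star] Q(1) have "Q * c * Q = Q * c"
      by (simp add: star_mult projection_def mult.assoc)
    with QcQ[OF c] show ?thesis by simp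
  qed
  then have "1 - Q \<in> commutant C" by (simp add: commutant_def algebra_simps)
  moreover have "projection (1 - Q)"
    using Q(1) by (simp add: projection_def star_diff algebra_simps)
  moreover have "(1 - Q) *\<^sub>V x = 0 \<longleftrightarrow> x \<in> K" for x
    using Q(2)[of x] Q(3)[of x] by (auto simp: bop_rep_eqs)
  ultimately show ?thesis by (auto simp: K_def intro!: bexI[of _ "1 - Q"])
qed

text \<open>\<open>p (1 - q) = 0\<close> says that \<open>p\<close> vanishes on the range of \<open>1 - q\<close>, which is the kernel of \<open>q\<close>.\<close>

lemma proj_le_iff_kernel:
  fixes p q :: "'a :: chilbert_space bop"
  assumes p: "projection p" and q: "projection q"
  shows "proj_le p q \<longleftrightarrow> (\<forall>x. q *\<^sub>V x = 0 \<longrightarrow> p *\<^sub>V x = 0)"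
proof
  assume "proj_le p q"
  then have "p *\<^sub>V x = p *\<^sub>V q *\<^sub>V x" for x by (metis proj_le_def times_bop.rep_eq)
  then show "\<forall>x. q *\<^sub>V x = 0 \<longrightarrow> p *\<^sub>V x = 0" by (metis bop_zero)
next
  assume ker: "\<forall>x. q *\<^sub>V x = 0 \<longrightarrow> p *\<^sub>V x = 0"
  show "proj_le p q"
    unfolding proj_le_def
  proof (rule bop_eqI)
    fix x
    have "q *\<^sub>V (x - q *\<^sub>V x) = 0" by (simp add: bop_diff projection_apply_self[OF q])
    then have "p *\<^sub>V (x - q *\<^sub>V x) = 0" using ker by blast
    then show "(p * q) *\<^sub>V x = p *\<^sub>V x" by (simp add: bop_diff times_bop.rep_eq)
  qed
qed

lemma proj_le_antisym:
  assumes "projection p" "projection q" "proj_le p q" "proj_le q p"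
  shows "p = q"
proof -
  have "(p * q)\<^sup>\<star> = q * p" using assms by (simp add: projection_def star_mult)
  then show ?thesis using assms by (simp add: proj_le_def projection_def)
qed

text \<open>In terms of kernels, upper bounds of \<open>ps\<close> are the projections whose kernel is contained in the
  kernel of every member. So the projection with the common kernel is the least upper bound; by
  antisymmetry it is the only one.\<close>

lemma proj_Sup_commutant:
  fixes C :: "'a :: chilbert_space bop set"
  assumes C: "star_closed C" and ps: "ps \<subseteq> commutant C" "\<And>p. p \<in> ps \<Longrightarrow> projection p"
  shows "projection (proj_Sup (commutant C) ps)"
    and "proj_Sup (commutant C) ps *\<^sub>V x = 0 \<longleftrightarrow> (\<forall>p\<in>ps. p *\<^sub>V x = 0)"
proof -
  let ?N = "commutant C"
  let ?sup = "\<lambda>P. P \<in> ?N \<and> projection P \<and> (\<forall>p\<in>ps. proj_le p P) \<and>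
     (\<forall>Q\<in>?N. projection Q \<and> (\<forall>p\<in>ps. proj_le p Q) \<longrightarrow> proj_le P Q)"
  obtain P where P: "P \<in> ?N" "projection P" "\<And>x. P *\<^sub>V x = 0 \<longleftrightarrow> (\<forall>p\<in>ps. p *\<^sub>V x = 0)"
    using ex_projection_with_common_kernel[OF C ps(1)] by blast
  have sup: "?sup P"
    using P ps(2) by (auto simp: proj_le_iff_kernel)
  have "proj_Sup ?N ps = P"
    unfolding proj_Sup_def
  proof (rule the_equality)
    show "?sup P" by (rule sup)
    show "P' = P" if "?sup P'" for P'
      using that sup by (intro proj_le_antisym) auto
  qed
  then show "projection (proj_Sup ?N ps)"
    "proj_Sup ?N ps *\<^sub>V x = 0 \<longleftrightarrow> (\<forall>p\<in>ps. p *\<^sub>V x = 0)"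
    using P by simp_all
qed

lemma projection_tensor: "projection p \<Longrightarrow> projection q \<Longrightarrow> projection (p \<otimes>\<^sub>o q)"
  by (simp add: projection_def bop_tensor_mult bop_tensor_star)

lemma P_delta:
  assumes "star_closed (range \<pi>)"
  shows projection_P_delta: "projection (P_delta \<pi>)"
    and P_delta_kernel: "P_delta \<pi> *\<^sub>V x = 0 \<longleftrightarrow>
      (\<forall>p. minimal_projection (bicommutant (range \<pi>)) p \<longrightarrow> (p \<otimes>\<^sub>o p) *\<^sub>V x = 0)"
proof -
  let ?M = "bicommutant (range \<pi>)"
  let ?G = "{S \<otimes>\<^sub>o T |S T. S \<in> ?M \<and> T \<in> ?M}" and ?ps = "{p \<otimes>\<^sub>o p |p. minimal_projection ?M p}"
  have "star_closed ?M" by (intro star_closed_commutant assms)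
  then have "star_closed ?G" by (fastforce simp: star_closed_def bop_tensor_star)
  then have C: "star_closed (commutant ?G)" by (rule star_closed_commutant)
  have "?G \<subseteq> bicommutant ?G" by (rule subset_bicommutant)
  moreover have "?ps \<subseteq> ?G" by (auto simp: minimal_projection_def)
  ultimately have ps: "?ps \<subseteq> commutant (commutant ?G)" by blast
  have pr: "projection p" if "p \<in> ?ps" for p
    using that by (auto simp: minimal_projection_def projection_tensor)
  have eq: "P_delta \<pi> = proj_Sup (commutant (commutant ?G)) ?ps"
    by (simp add: P_delta_def Let_def vn_tensor_def)
  show "projection (P_delta \<pi>)"
    unfolding eq by (rule proj_Sup_commutant(1)[OF C ps pr])
  have "P_delta \<pi> *\<^sub>V x = 0 \<longleftrightarrow> (\<forall>p\<in>?ps. p *\<^sub>V x = 0)"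
    unfolding eq by (rule proj_Sup_commutant(2)[OF C ps pr])
  then show "P_delta \<pi> *\<^sub>V x = 0 \<longleftrightarrow> (\<forall>p. minimal_projection ?M p \<longrightarrow> (p \<otimes>\<^sub>o p) *\<^sub>V x = 0)"
    by auto
qed

text \<open>\<open>T p = 0\<close> means that the range of \<open>T\<^sup>*\<close> lies in the kernel of the projection \<open>p\<close>, and the kernel of
  \<open>P_delta \<pi>\<close> is known.\<close>

lemma mult_P_delta_eq_0_iff:
  assumes \<pi>: "star_closed (range \<pi>)"
  shows "T * P_delta \<pi> = 0 \<longleftrightarrow>
    (\<forall>p. minimal_projection (bicommutant (range \<pi>)) p \<longrightarrow> T * (p \<otimes>\<^sub>o p) = 0)"
proof -
  have star0: "T * p = 0 \<longleftrightarrow> (\<forall>x. p *\<^sub>V T\<^sup>\<star> *\<^sub>V x = 0)" if "projection p" for p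
  proof -
    have "T * p = 0 \<longleftrightarrow> (T * p)\<^sup>\<star> = 0" by (metis star_star star_zero)
    also have "(T * p)\<^sup>\<star> = p * T\<^sup>\<star>" using that by (simp add: star_mult projection_def)
    also have "p * T\<^sup>\<star> = 0 \<longleftrightarrow> (\<forall>x. p *\<^sub>V T\<^sup>\<star> *\<^sub>V x = 0)"
    proof
      show "p * T\<^sup>\<star> = 0" if "\<forall>x. p *\<^sub>V T\<^sup>\<star> *\<^sub>V x = 0"
        using that by (intro bop_eqI) (simp add: bop_rep_eqs)
      show "\<forall>x. p *\<^sub>V T\<^sup>\<star> *\<^sub>V x = 0" if "p * T\<^sup>\<star> = 0"
      proof
        fix x
        have "(p * T\<^sup>\<star>) *\<^sub>V x = 0" by (simp add: that zero_bop.rep_eq)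
        then show "p *\<^sub>V T\<^sup>\<star> *\<^sub>V x = 0" by (simp add: times_bop.rep_eq)
      qed
    qed
    finally show ?thesis .
  qed
  have min: "projection (p \<otimes>\<^sub>o p)" if "minimal_projection (bicommutant (range \<pi>)) p" for p
    using that by (simp add: minimal_projection_def projection_tensor)
  show ?thesis
    unfolding star0[OF projection_P_delta[OF \<pi>]] P_delta_kernel[OF \<pi>]
    using star0[OF min] by blast
qed

lemma orthogonal_complement_H_delta:
  assumes \<pi>: "star_closed (range \<pi>)"
  shows "v \<in> orthogonal_complement (H_delta \<pi>) \<longleftrightarrow>
    (\<forall>p. minimal_projection (bicommutant (range \<pi>)) p \<longrightarrow> (p \<otimes>\<^sub>o p) *\<^sub>V v = 0)"
proof -
  have star: "(P_delta \<pi>)\<^sup>\<star> = P_delta \<pi>"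
    using projection_P_delta[OF \<pi>] by (simp add: projection_def)
  have "cinner (P_delta \<pi> *\<^sub>V x) v = cinner x (P_delta \<pi> *\<^sub>V v)" for x
    using cinner_star[of "P_delta \<pi>" x v] by (simp add: star)
  then have "v \<in> orthogonal_complement (H_delta \<pi>) \<longleftrightarrow> (\<forall>x. cinner x (P_delta \<pi> *\<^sub>V v) = 0)"
    by (auto simp: orthogonal_complement_def H_delta_def)
  also have "\<dots> \<longleftrightarrow> P_delta \<pi> *\<^sub>V v = 0"
    by (metis cinner_self cinner_zero_right norm_eq_zero of_real_eq_0_iff zero_eq_power2)
  finally show ?thesis unfolding P_delta_kernel[OF \<pi>] .
qed

section \<open>Direct sums\<close>

definition emb_fst :: "'h :: complex_inner \<Rightarrow> 'h \<times> 'k :: complex_inner" where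
  "emb_fst x = (x, 0)"

definition emb_snd :: "'k :: complex_inner \<Rightarrow> 'h :: complex_inner \<times> 'k" where
  "emb_snd y = (0, y)"

lemma isometry_emb: "isometry emb_fst" "isometry emb_snd"
  by (auto simp: isometry_def emb_fst_def emb_snd_def scaleC_prod_def cinner_prod_def)

lemma iso_adj_emb: "iso_adj emb_fst v = fst v" "iso_adj emb_snd v = snd v"
  by (rule iso_adj_eqI[OF isometry_emb(1)], simp add: emb_fst_def cinner_prod_def)
    (rule iso_adj_eqI[OF isometry_emb(2)], simp add: emb_snd_def cinner_prod_def)

lemma bop_sum_apply: "(S \<oplus>\<^sub>o T) *\<^sub>V v = (S *\<^sub>V fst v, T *\<^sub>V snd v)"
  by (simp add: bop_sum.rep_eq)

lemma bop_sum_eq_iff: "S \<oplus>\<^sub>o T = S' \<oplus>\<^sub>o T' \<longleftrightarrow> S = S' \<and> T = T'"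
proof
  assume eq: "S \<oplus>\<^sub>o T = S' \<oplus>\<^sub>o T'"
  have "(S *\<^sub>V x, T *\<^sub>V y) = (S' *\<^sub>V x, T' *\<^sub>V y)" for x y
    using arg_cong[OF eq, of "\<lambda>R. R *\<^sub>V (x, y)"] by (simp add: bop_sum_apply)
  then show "S = S' \<and> T = T'" by (auto intro: bop_eqI)
qed simp

lemma bop_sum_add: "(S \<oplus>\<^sub>o T) + (S' \<oplus>\<^sub>o T') = (S + S') \<oplus>\<^sub>o (T + T')"
  and bop_sum_scaleC: "c *\<^sub>C (S \<oplus>\<^sub>o T) = (c *\<^sub>C S) \<oplus>\<^sub>o (c *\<^sub>C T)"
  and bop_sum_mult: "(S \<oplus>\<^sub>o T) * (S' \<oplus>\<^sub>o T') = (S * S') \<oplus>\<^sub>o (T * T')"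
  and bop_sum_zero: "0 \<oplus>\<^sub>o 0 = 0"
  and bop_sum_one: "1 \<oplus>\<^sub>o 1 = 1"
  by (rule bop_eqI; simp add: bop_rep_eqs bop_sum_apply scaleC_prod_def zero_prod_def)+

lemma bop_sum_star: "(S \<oplus>\<^sub>o T)\<^sup>\<star> = S\<^sup>\<star> \<oplus>\<^sub>o T\<^sup>\<star>"
  by (rule bop_star_eqI) (simp add: bop_sum_apply cinner_prod_def cinner_star)

lemma in_fst_conj_by: "in_fst = conj_by emb_fst"
  and in_snd_conj_by: "in_snd = conj_by emb_snd"
  by (rule ext, rule bop_eqI,
      simp add: in_fst_def in_snd_def conj_by_apply isometry_emb iso_adj_emb bop_sum_apply
        emb_fst_def emb_snd_def zero_bop.rep_eq)+

lemma projection_bop_sum: "projection (S \<oplus>\<^sub>o T) \<longleftrightarrow> projection S \<and> projection T"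
  by (auto simp: projection_def bop_sum_mult bop_sum_star bop_sum_eq_iff)

subsection \<open>Commutants and minimal projections\<close>

text \<open>An operator that commutes with \<open>1 \<oplus>\<^sub>o 0\<close> preserves both summands.\<close>

lemma ex_bop_sum_of_commute:
  fixes X :: "('h :: chilbert_space \<times> 'k :: chilbert_space) bop"
  assumes comm: "X * (1 \<oplus>\<^sub>o 0) = (1 \<oplus>\<^sub>o 0) * X"
  shows "\<exists>S T. X = S \<oplus>\<^sub>o T"
proof -
  define S where "S = Bop (\<lambda>x. fst (X *\<^sub>V (x, 0)))"
  define T where "T = Bop (\<lambda>y. snd (X *\<^sub>V (0, y)))"
  have "bounded_linear (\<lambda>x. fst (X *\<^sub>V (x, 0)))"
    by (intro bounded_linear_compose[OF bounded_linear_fst]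
        bounded_linear_compose[OF bop_bounded_linear] bounded_linear_Pair
        bounded_linear_ident bounded_linear_zero)
  moreover have "bounded_linear (\<lambda>y. snd (X *\<^sub>V (0, y)))"
    by (intro bounded_linear_compose[OF bounded_linear_snd]
        bounded_linear_compose[OF bop_bounded_linear] bounded_linear_Pair
        bounded_linear_ident bounded_linear_zero)
  moreover have "X *\<^sub>V (c *\<^sub>C x, 0) = c *\<^sub>C (X *\<^sub>V (x, 0))" "X *\<^sub>V (0, c *\<^sub>C y) = c *\<^sub>C (X *\<^sub>V (0, y))" for c x y
    using bop_scaleC[of X c "(x, 0)"] bop_scaleC[of X c "(0, y)"] by (simp_all add: scaleC_prod_def)
  ultimately have ST: "S *\<^sub>V x = fst (X *\<^sub>V (x, 0))" "T *\<^sub>V y = snd (X *\<^sub>V (0, y))" for x y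
    unfolding S_def T_def by (subst Bop_inverse; simp add: scaleC_prod_def)+
  have c: "X *\<^sub>V (fst v, 0) = (fst (X *\<^sub>V v), 0)" for v
    using arg_cong[OF comm, of "\<lambda>R. R *\<^sub>V v"]
    by (simp add: bop_rep_eqs bop_sum_apply)
  have "X *\<^sub>V v = (S *\<^sub>V fst v, T *\<^sub>V snd v)" for v
  proof -
    have "X *\<^sub>V v = X *\<^sub>V (fst v, 0) + X *\<^sub>V (0, snd v)" by (simp flip: bop_add)
    moreover have "fst (X *\<^sub>V (0, snd v)) = 0" using c[of "(0, snd v)"] by (simp flip: zero_prod_def) (simp add: zero_prod_def)
    moreover have "snd (X *\<^sub>V (fst v, 0)) = 0" using c[of v] by simp
    ultimately show ?thesis by (simp add: ST prod_eq_iff)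
  qed
  then have "X = S \<oplus>\<^sub>o T" by (intro bop_eqI) (simp add: bop_sum_apply)
  then show ?thesis by blast
qed

lemma commutant_bop_sum:
  assumes A: "0 \<in> A" "1 \<in> A" and B: "0 \<in> B" "1 \<in> B"
  shows "commutant {a \<oplus>\<^sub>o b |a b. a \<in> A \<and> b \<in> B} = {S \<oplus>\<^sub>o T |S T. S \<in> commutant A \<and> T \<in> commutant B}"
    (is "commutant ?AB = ?R")
proof (intro equalityI subsetI)
  fix X assume X: "X \<in> commutant ?AB"
  have "1 \<oplus>\<^sub>o 0 \<in> ?AB" using A B by blast
  then have "X * (1 \<oplus>\<^sub>o 0) = (1 \<oplus>\<^sub>o 0) * X" using X unfolding commutant_def by blast
  then obtain S T where ST: "X = S \<oplus>\<^sub>o T" using ex_bop_sum_of_commute by blast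
  have "S * a = a * S \<and> T * b = b * T" if "a \<in> A" "b \<in> B" for a b
  proof -
    have "a \<oplus>\<^sub>o b \<in> ?AB" using that by blast
    then have "X * (a \<oplus>\<^sub>o b) = (a \<oplus>\<^sub>o b) * X" using X unfolding commutant_def by blast
    then show ?thesis by (simp add: ST bop_sum_mult bop_sum_eq_iff)
  qed
  then have "S \<in> commutant A" "T \<in> commutant B" using A B unfolding commutant_def by blast+
  then show "X \<in> ?R" using ST by blast
qed (auto simp: commutant_def bop_sum_mult)

lemma zero_one_commutant: "0 \<in> commutant C" "1 \<in> commutant C"
  by (simp_all add: commutant_def)

lemma bicommutant_bop_sum:
  assumes "0 \<in> A" "1 \<in> A" "0 \<in> B" "1 \<in> B"
  shows "bicommutant {a \<oplus>\<^sub>o b |a b. a \<in> A \<and> b \<in> B} =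
    {S \<oplus>\<^sub>o T |S T. S \<in> bicommutant A \<and> T \<in> bicommutant B}"
  unfolding commutant_bop_sum[OF assms]
  by (rule commutant_bop_sum[OF zero_one_commutant zero_one_commutant])

text \<open>A projection of the direct sum is a pair \<open>S \<oplus>\<^sub>o T\<close> of projections. It dominates \<open>S \<oplus>\<^sub>o 0\<close>, so if it is
  minimal, one of the components vanishes.\<close>

lemma minimal_projection_bop_sum:
  assumes M: "0 \<in> M" and N: "0 \<in> N"
  shows "minimal_projection {S \<oplus>\<^sub>o T |S T. S \<in> M \<and> T \<in> N} p \<longleftrightarrow>
    (\<exists>q. minimal_projection M q \<and> p = in_fst q) \<or> (\<exists>q. minimal_projection N q \<and> p = in_snd q)"
    (is "minimal_projection ?MN p \<longleftrightarrow> _")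
proof
  assume p: "minimal_projection ?MN p"
  then obtain S T where ST: "p = S \<oplus>\<^sub>o T" "S \<in> M" "T \<in> N"
    by (auto simp: minimal_projection_def)
  have pr: "projection S" "projection T" and p0: "p \<noteq> 0"
    using p by (auto simp: minimal_projection_def ST(1) projection_bop_sum)
  have min: "S' \<oplus>\<^sub>o T' = 0 \<oplus>\<^sub>o 0 \<or> S' \<oplus>\<^sub>o T' = S \<oplus>\<^sub>o T"
    if "S' \<in> M" "T' \<in> N" "projection S'" "projection T'" "proj_le S' S" "proj_le T' T" for S' T'
  proof -
    have "S' \<oplus>\<^sub>o T' \<in> ?MN" using that by blast
    moreover have "projection (S' \<oplus>\<^sub>o T')" "proj_le (S' \<oplus>\<^sub>o T') p"
      using that by (simp_all add: projection_bop_sum proj_le_def ST(1) bop_sum_mult)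
    ultimately show ?thesis
      using p unfolding minimal_projection_def ST(1) bop_sum_zero by blast
  qed
  have z: "projection (0 :: 'c :: chilbert_space bop)" "proj_le (0 :: 'c bop) x" for x
    by (simp_all add: projection_def proj_le_def)
  have s: "proj_le S S" "proj_le T T" using pr by (simp_all add: proj_le_def projection_def)
  have m1: "S' = 0 \<or> S' = S" if "S' \<in> M" "projection S'" "proj_le S' S" for S'
    using min[OF that(1) ST(3) that(2) pr(2) that(3) s(2)] min[OF that(1) N that(2) z(1) that(3) z(2)]
    by (auto simp: bop_sum_eq_iff)
  have m2: "T' = 0 \<or> T' = T" if "T' \<in> N" "projection T'" "proj_le T' T" for T'
    using min[OF ST(2) that(1) pr(1) that(2) s(1) that(3)] min[OF M that(1) z(1) that(2) z(2) that(3)]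
    by (auto simp: bop_sum_eq_iff)
  consider "S \<noteq> 0" "T = 0" | "S = 0" "T \<noteq> 0"
    using min[OF ST(2) N pr(1) z(1) s(1) z(2)] p0[unfolded ST(1) bop_sum_zero[symmetric]]
    unfolding bop_sum_eq_iff by blast
  then show "(\<exists>q. minimal_projection M q \<and> p = in_fst q) \<or> (\<exists>q. minimal_projection N q \<and> p = in_snd q)"
  proof cases
    case 1
    then have "minimal_projection M S \<and> p = in_fst S"
      using ST pr m1 by (simp add: minimal_projection_def in_fst_def)
    then show ?thesis by blast
  next
    case 2
    then have "minimal_projection N T \<and> p = in_snd T"
      using ST pr m2 by (simp add: minimal_projection_def in_snd_def)
    then show ?thesis by blast
  qed
next
  have z: "projection (0 :: 'c :: chilbert_space bop)" by (simp add: projection_def)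
  assume "(\<exists>q. minimal_projection M q \<and> p = in_fst q) \<or> (\<exists>q. minimal_projection N q \<and> p = in_snd q)"
  then show "minimal_projection ?MN p"
  proof (elim disjE exE conjE)
    fix q assume q: "minimal_projection M q" "p = in_fst q"
    show ?thesis
      unfolding minimal_projection_def
    proof (intro conjI ballI impI)
      show "p \<in> ?MN" using q N by (auto simp: minimal_projection_def in_fst_def)
      show "projection p" using q z by (auto simp: minimal_projection_def in_fst_def projection_bop_sum)
      show "p \<noteq> 0"
        using q bop_sum_eq_iff[of q 0 0 0] by (auto simp: minimal_projection_def in_fst_def bop_sum_zero)
      fix r assume "r \<in> ?MN" "projection r \<and> proj_le r p"
      then obtain S T where r: "r = S \<oplus>\<^sub>o T" "S \<in> M" "projection S" "proj_le S q" "T = 0"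
        by (auto simp: q(2) in_fst_def projection_bop_sum proj_le_def bop_sum_mult bop_sum_eq_iff)
      then have "S = 0 \<or> S = q" using q(1) by (auto simp: minimal_projection_def)
      then show "r = 0 \<or> r = p" by (auto simp: r q(2) in_fst_def bop_sum_zero)
    qed
  next
    fix q assume q: "minimal_projection N q" "p = in_snd q"
    show ?thesis
      unfolding minimal_projection_def
    proof (intro conjI ballI impI)
      show "p \<in> ?MN" using q M by (auto simp: minimal_projection_def in_snd_def)
      show "projection p" using q z by (auto simp: minimal_projection_def in_snd_def projection_bop_sum)
      show "p \<noteq> 0"
        using q bop_sum_eq_iff[of 0 q 0 0] by (auto simp: minimal_projection_def in_snd_def bop_sum_zero)
      fix r assume "r \<in> ?MN" "projection r \<and> proj_le r p"
      then obtain S T where r: "r = S \<oplus>\<^sub>o T" "T \<in> N" "projection T" "proj_le T q" "S = 0"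
        by (auto simp: q(2) in_snd_def projection_bop_sum proj_le_def bop_sum_mult bop_sum_eq_iff)
      then have "T = 0 \<or> T = q" using q(1) by (auto simp: minimal_projection_def)
      then show "r = 0 \<or> r = p" by (auto simp: r q(2) in_snd_def bop_sum_zero)
    qed
  qed
qed

subsection \<open>Atomic representations\<close>

lemma representation_simps:
  assumes "representation \<pi>"
  shows "\<pi> (x + y) = \<pi> x + \<pi> y" "\<pi> (c *\<^sub>C x) = c *\<^sub>C \<pi> x" "\<pi> (x * y) = \<pi> x * \<pi> y"
    "\<pi> (x\<^sup>\<star>) = (\<pi> x)\<^sup>\<star>" "\<pi> 1 = 1" "\<pi> 0 = 0"
  using assms star_hom_simps[of \<pi>] by (auto simp: representation_def star_hom_def)

lemma star_subalgebra_range: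
  assumes "representation \<pi>"
  shows "star_subalgebra (range \<pi>)"
proof -
  note s = representation_simps[OF assms, symmetric]
  show ?thesis
    unfolding star_subalgebra_def cvs.subspace_def
    using s(5,6) by (auto simp: s(1,2,3,4))
qed

lemma representation_rep_sum:
  assumes "representation \<pi>\<^sub>1" "representation \<pi>\<^sub>2"
  shows "representation (rep_sum \<pi>\<^sub>1 \<pi>\<^sub>2)"
proof -
  note s = representation_simps[OF assms(1)] representation_simps[OF assms(2)]
  show ?thesis
    unfolding representation_def star_hom_on_def
    by (simp add: rep_sum_def s bop_sum_add bop_sum_scaleC bop_sum_mult bop_sum_star bop_sum_one
        times_dsum_def star_dsum_def one_dsum_def)
qed

lemma range_rep_sum: "range (rep_sum \<pi>\<^sub>1 \<pi>\<^sub>2) = {a \<oplus>\<^sub>o b |a b. a \<in> range \<pi>\<^sub>1 \<and> b \<in> range \<pi>\<^sub>2}"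
proof (intro equalityI subsetI)
  fix x assume "x \<in> {a \<oplus>\<^sub>o b |a b. a \<in> range \<pi>\<^sub>1 \<and> b \<in> range \<pi>\<^sub>2}"
  then obtain a b where "x = rep_sum \<pi>\<^sub>1 \<pi>\<^sub>2 (DSum a b)" by (auto simp: rep_sum_def)
  then show "x \<in> range (rep_sum \<pi>\<^sub>1 \<pi>\<^sub>2)" by blast
qed (auto simp: rep_sum_def)

lemma isometry_continuous_on: "isometry V \<Longrightarrow> continuous_on S V"
  by (rule bounded_linear.continuous_on[OF isometry_bounded_linear continuous_on_id])

lemma iso_adj_continuous_on:
  assumes V: "isometry V"
  shows "continuous_on S (iso_adj V)"
proof (rule bounded_linear.continuous_on[OF _ continuous_on_id])
  show "bounded_linear (iso_adj V)"
    by (rule bounded_linear_intro[where K = 1])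
      (simp_all add: iso_adj_linear[OF V] norm_iso_adj_le[OF V] scaleR_scaleC)
qed

lemma isometry_0: "isometry V \<Longrightarrow> V 0 = 0"
  by (metis isometry_norm norm_eq_zero)

lemma closed_isometry_image:
  fixes V :: "'h :: chilbert_space \<Rightarrow> 'k :: chilbert_space"
  assumes V: "isometry V" and K: "closed K"
  shows "closed (V ` K)"
proof -
  have "V ` K = {y. V (iso_adj V y) = y} \<inter> iso_adj V -` K"
  proof (intro equalityI subsetI)
    fix y assume "y \<in> V ` K"
    then show "y \<in> {y. V (iso_adj V y) = y} \<inter> iso_adj V -` K"
      by (auto simp: iso_adj_cancel[OF V])
  next
    fix y assume "y \<in> {y. V (iso_adj V y) = y} \<inter> iso_adj V -` K"
    then show "y \<in> V ` K" by (intro image_eqI[of _ _ "iso_adj V y"]) auto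
  qed
  moreover have "closed {y. V (iso_adj V y) = y}"
    by (intro closed_Collect_eq continuous_on_compose2[OF isometry_continuous_on[OF V]]
        iso_adj_continuous_on[OF V] continuous_on_id) auto
  moreover have "closed (iso_adj V -` K)"
    using iso_adj_continuous_on[OF V, of UNIV] K by (simp add: continuous_on_closed_vimage)
  ultimately show ?thesis by auto
qed

text \<open>In the following lemmas \<open>V\<close> intertwines \<open>\<sigma> \<circ> f\<close> with \<open>\<pi>\<close>. They are applied to the direct sum \<open>\<pi>\<close> of
  two representations, a summand \<open>\<sigma>\<close>, the embedding \<open>V\<close> of its space and the projection \<open>f\<close> of the direct sum
  of the algebras. If \<open>f\<close> is surjective, \<open>\<sigma>\<close> and \<open>\<sigma> \<circ> f\<close> have the same invariant subspaces.\<close>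

lemma invariant_subspace_image:
  assumes V: "isometry V" and tw: "\<And>a x. \<pi> a *\<^sub>V V x = V (\<sigma> (f a) *\<^sub>V x)"
    and K: "invariant_subspace \<sigma> K"
  shows "invariant_subspace \<pi> (V ` K)"
  unfolding invariant_subspace_def
proof (intro conjI allI ballI)
  have sub: "cvs.subspace K" using K by (simp add: invariant_subspace_def)
  show "cvs.subspace (V ` K)"
  proof (rule cvs.subspaceI)
    show "0 \<in> V ` K"
      using cvs.subspace_0[OF sub] isometry_0[OF V] by (intro image_eqI[of _ _ 0]) auto
    show "x + y \<in> V ` K" if "x \<in> V ` K" "y \<in> V ` K" for x y
      using that cvs.subspace_add[OF sub] by (auto simp flip: isometry_simps(1)[OF V])
    show "c *\<^sub>C x \<in> V ` K" if "x \<in> V ` K" for x c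
      using that cvs.subspace_scale[OF sub] by (auto simp flip: isometry_simps(2)[OF V])
  qed
  show "closed (V ` K)" using K by (intro closed_isometry_image V) (simp add: invariant_subspace_def)
  show "\<pi> a *\<^sub>V x \<in> V ` K" if "x \<in> V ` K" for a x
    using that K by (auto simp: tw invariant_subspace_def)
qed

lemma invariant_subspace_vimage:
  assumes V: "isometry V" and tw: "\<And>a x. \<pi> a *\<^sub>V V x = V (\<sigma> (f a) *\<^sub>V x)" and f: "surj f"
    and L: "invariant_subspace \<pi> L"
  shows "invariant_subspace \<sigma> (V -` L)"
  unfolding invariant_subspace_def
proof (intro conjI allI ballI)
  have sub: "cvs.subspace L" and cl: "closed L" using L by (simp_all add: invariant_subspace_def)
  show "cvs.subspace (V -` L)"
    using sub by (auto simp: cvs.subspace_def isometry_simps[OF V] isometry_0[OF V])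
  show "closed (V -` L)"
    using isometry_continuous_on[OF V, of UNIV] cl by (simp add: continuous_on_closed_vimage)
  show "\<sigma> b *\<^sub>V x \<in> V -` L" if "x \<in> V -` L" for b x
  proof -
    obtain a where "b = f a" using f by (metis surjD)
    then show ?thesis using that L by (auto simp: invariant_subspace_def simp flip: tw)
  qed
qed

lemma irreducible_on_image:
  assumes V: "isometry V" and tw: "\<And>a x. \<pi> a *\<^sub>V V x = V (\<sigma> (f a) *\<^sub>V x)" and f: "surj f"
    and K: "irreducible_on \<sigma> K"
  shows "irreducible_on \<pi> (V ` K)"
  unfolding irreducible_on_def
proof (intro conjI allI impI; (elim conjE)?)
  show "invariant_subspace \<pi> (V ` K)"
    using K by (intro invariant_subspace_image[where \<pi> = \<pi> and \<sigma> = \<sigma> and f = f, OF V tw]) (simp add: irreducible_on_def)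
  show "V ` K \<noteq> {0}"
  proof
    assume eq: "V ` K = {0}"
    have "x = 0" if "x \<in> K" for x
    proof -
      have "V x = 0" using eq that by blast
      then show ?thesis using isometry_norm[OF V, of x] by simp
    qed
    moreover have "0 \<in> K"
      using K by (simp add: irreducible_on_def invariant_subspace_def cvs.subspace_0)
    ultimately show False using K by (auto simp: irreducible_on_def)
  qed
  fix L assume L: "invariant_subspace \<pi> L" "L \<subseteq> V ` K"
  have inj: "x = y" if "V x = V y" for x y using that iso_adj_cancel[OF V] by metis
  have eq: "V ` (V -` L) = L" using L(2) by auto
  have "V -` L \<subseteq> K" using L(2) inj by auto
  then have "V -` L = {0} \<or> V -` L = K"
    using invariant_subspace_vimage[where \<pi> = \<pi> and \<sigma> = \<sigma> and f = f, OF V tw f L(1)] K by (simp add: irreducible_on_def)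
  then have "V ` (V -` L) = V ` {0} \<or> V ` (V -` L) = V ` K" by metis
  then show "L = {0} \<or> L = V ` K" unfolding eq by (simp add: isometry_0[OF V])
qed

text \<open>An intertwiner \<open>U\<close> of the images gives the intertwiner \<open>V\<^sup>* U V\<close>.\<close>

lemma equivalent_on_image:
  assumes V: "isometry V" and tw: "\<And>a x. \<pi> a *\<^sub>V V x = V (\<sigma> (f a) *\<^sub>V x)" and f: "surj f"
    and eq: "equivalent_on \<pi> (V ` K) (V ` L)"
  shows "equivalent_on \<sigma> K L"
proof -
  obtain U where U: "U ` (V ` K) = V ` L"
    "\<And>x y. x \<in> K \<Longrightarrow> y \<in> K \<Longrightarrow> U (V x + V y) = U (V x) + U (V y)"
    "\<And>c x. x \<in> K \<Longrightarrow> U (c *\<^sub>C V x) = c *\<^sub>C U (V x)"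
    "\<And>x y. x \<in> K \<Longrightarrow> y \<in> K \<Longrightarrow> cinner (U (V x)) (U (V y)) = cinner x y"
    "\<And>a x. x \<in> K \<Longrightarrow> U (\<pi> a *\<^sub>V V x) = \<pi> a *\<^sub>V U (V x)"
    using eq unfolding equivalent_on_def by (auto simp: isometry_simps(3)[OF V])
  define W where "W x = iso_adj V (U (V x))" for x
  have W: "V (W x) = U (V x)" "W x \<in> L" if "x \<in> K" for x
  proof -
    have "U (V x) \<in> V ` L" using U(1) that by blast
    then show "V (W x) = U (V x)" "W x \<in> L" by (auto simp: W_def iso_adj_cancel[OF V])
  qed
  show ?thesis
    unfolding equivalent_on_def
  proof (intro exI[of _ W] conjI ballI allI)
    have "L = iso_adj V ` (V ` L)" by (simp add: image_image iso_adj_cancel[OF V])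
    then show "W ` K = L" by (simp add: W_def image_image flip: U(1))
    show "W (x + y) = W x + W y" if "x \<in> K" "y \<in> K" for x y
      by (simp add: W_def isometry_simps[OF V] U(2)[OF that] iso_adj_linear[OF V])
    show "W (c *\<^sub>C x) = c *\<^sub>C W x" if "x \<in> K" for x c
      by (simp add: W_def isometry_simps[OF V] U(3)[OF that] iso_adj_linear[OF V])
    show "cinner (W x) (W y) = cinner x y" if "x \<in> K" "y \<in> K" for x y
      using U(4)[OF that] W(1)[OF that(1)] W(1)[OF that(2)] isometry_simps(3)[OF V, of "W x" "W y"]
      by simp
    show "W (\<sigma> b *\<^sub>V x) = \<sigma> b *\<^sub>V W x" if x: "x \<in> K" for b x
    proof -
      obtain a where b: "b = f a" using f by (metis surjD)
      have "U (V (\<sigma> b *\<^sub>V x)) = V (\<sigma> b *\<^sub>V W x)"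
        using U(5)[OF x, of a] W(1)[OF x] by (simp add: tw b flip: tw)
      then show ?thesis by (simp add: W_def iso_adj_cancel[OF V])
    qed
  qed
qed

text \<open>An intertwiner would carry the action of \<open>a\<close>, which is the identity on \<open>K\<close>, to its action on \<open>L\<close>, which
  is zero.\<close>

lemma not_equivalent_on:
  assumes K: "cvs.subspace K" "K \<noteq> {0}" and a: "\<And>x. x \<in> K \<Longrightarrow> \<pi> a *\<^sub>V x = x" "\<And>y. y \<in> L \<Longrightarrow> \<pi> a *\<^sub>V y = 0"
  shows "\<not> equivalent_on \<pi> K L" "\<not> equivalent_on \<pi> L K"
proof -
  obtain x where x: "x \<in> K" "x \<noteq> 0" using K cvs.subspace_0 by blast
  show "\<not> equivalent_on \<pi> K L"
  proof
    assume "equivalent_on \<pi> K L"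
    then obtain U where U: "U ` K = L" "\<forall>x\<in>K. \<forall>y\<in>K. cinner (U x) (U y) = cinner x y"
      "\<forall>a. \<forall>x\<in>K. U (\<pi> a *\<^sub>V x) = \<pi> a *\<^sub>V U x"
      unfolding equivalent_on_def by blast
    have "U x = \<pi> a *\<^sub>V U x" using U(3) x a(1) by metis
    also have "\<dots> = 0" using U(1) x a(2) by blast
    finally show False using U(2) x by (metis cinner_self cinner_zero_left norm_eq_zero of_real_eq_0_iff power_eq_0_iff)
  qed
  show "\<not> equivalent_on \<pi> L K"
  proof
    assume "equivalent_on \<pi> L K"
    then obtain U where U: "U ` L = K" "\<forall>x\<in>L. \<forall>y\<in>L. cinner (U x) (U y) = cinner x y"
      "\<forall>c. \<forall>x\<in>L. U (c *\<^sub>C x) = c *\<^sub>C U x" "\<forall>a. \<forall>x\<in>L. U (\<pi> a *\<^sub>V x) = \<pi> a *\<^sub>V U x"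
      unfolding equivalent_on_def by blast
    obtain y where y: "y \<in> L" "x = U y" using U(1) x by blast
    have "x = \<pi> a *\<^sub>V U y" using a(1)[OF x(1)] y by simp
    also have "\<dots> = U (0 *\<^sub>C y)" using U(4) y a(2) by (metis cvs.scale_zero_left)
    also have "\<dots> = 0 *\<^sub>C U y" using U(3) y by blast
    also have "\<dots> = 0" by simp
    finally show False using x by simp
  qed
qed

lemma atomicE:
  assumes "atomic \<pi>"
  obtains \<K> where "\<And>K. K \<in> \<K> \<Longrightarrow> irreducible_on \<pi> K"
    "\<And>K L. K \<in> \<K> \<Longrightarrow> L \<in> \<K> \<Longrightarrow> K \<noteq> L \<Longrightarrow> \<not> equivalent_on \<pi> K L"
    "\<And>K L x y. K \<in> \<K> \<Longrightarrow> L \<in> \<K> \<Longrightarrow> K \<noteq> L \<Longrightarrow> x \<in> K \<Longrightarrow> y \<in> L \<Longrightarrow> cinner x y = 0"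
    "dense_span (\<Union>\<K>)"
proof -
  obtain \<K> where \<K>: "(\<forall>K\<in>\<K>. irreducible_on \<pi> K) \<and>
     (\<forall>K\<in>\<K>. \<forall>L\<in>\<K>. K \<noteq> L \<longrightarrow> \<not> equivalent_on \<pi> K L) \<and>
     (\<forall>K\<in>\<K>. \<forall>L\<in>\<K>. K \<noteq> L \<longrightarrow> (\<forall>x\<in>K. \<forall>y\<in>L. cinner x y = 0)) \<and>
     closure (cvs.span (\<Union>\<K>)) = UNIV"
    using assms unfolding atomic_def by (rule exE)
  show ?thesis
    by (rule that[of \<K>]) (use \<K> in \<open>simp_all add: dense_span_def\<close>)
qed

lemma atomic_rep_sum:
  fixes \<pi>\<^sub>1 :: "'a :: unital_cstar_algebra \<Rightarrow> 'h :: chilbert_space bop"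
    and \<pi>\<^sub>2 :: "'b :: unital_cstar_algebra \<Rightarrow> 'k :: chilbert_space bop"
  assumes rep: "representation \<pi>\<^sub>1" "representation \<pi>\<^sub>2" and at: "atomic \<pi>\<^sub>1" "atomic \<pi>\<^sub>2"
  shows "atomic (rep_sum \<pi>\<^sub>1 \<pi>\<^sub>2)"
proof -
  let ?\<pi> = "rep_sum \<pi>\<^sub>1 \<pi>\<^sub>2"
  let ?V = "emb_fst :: 'h \<Rightarrow> 'h \<times> 'k" and ?W = "emb_snd :: 'k \<Rightarrow> 'h \<times> 'k"
  have V: "isometry ?V" and W: "isometry ?W" by (rule isometry_emb)+
  obtain K1 where K1: "\<And>K. K \<in> K1 \<Longrightarrow> irreducible_on \<pi>\<^sub>1 K"
    "\<And>K L. K \<in> K1 \<Longrightarrow> L \<in> K1 \<Longrightarrow> K \<noteq> L \<Longrightarrow> \<not> equivalent_on \<pi>\<^sub>1 K L"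
    "\<And>K L x y. K \<in> K1 \<Longrightarrow> L \<in> K1 \<Longrightarrow> K \<noteq> L \<Longrightarrow> x \<in> K \<Longrightarrow> y \<in> L \<Longrightarrow> cinner x y = 0"
    "dense_span (\<Union>K1)"
    by (rule atomicE[OF at(1)]) (rule that; assumption?)
  obtain K2 where K2: "\<And>K. K \<in> K2 \<Longrightarrow> irreducible_on \<pi>\<^sub>2 K"
    "\<And>K L. K \<in> K2 \<Longrightarrow> L \<in> K2 \<Longrightarrow> K \<noteq> L \<Longrightarrow> \<not> equivalent_on \<pi>\<^sub>2 K L"
    "\<And>K L x y. K \<in> K2 \<Longrightarrow> L \<in> K2 \<Longrightarrow> K \<noteq> L \<Longrightarrow> x \<in> K \<Longrightarrow> y \<in> L \<Longrightarrow> cinner x y = 0"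
    "dense_span (\<Union>K2)"
    by (rule atomicE[OF at(2)]) (rule that; assumption?)
  have tw1: "?\<pi> a *\<^sub>V ?V x = ?V (\<pi>\<^sub>1 (dfst a) *\<^sub>V x)" and tw2: "?\<pi> a *\<^sub>V ?W y = ?W (\<pi>\<^sub>2 (dsnd a) *\<^sub>V y)" for a x y
    by (simp_all add: rep_sum_def bop_sum_apply emb_fst_def emb_snd_def)
  have surj1: "surj (dfst :: 'a \<oplus>\<^sub>A 'b \<Rightarrow> 'a)" and surj2: "surj (dsnd :: 'a \<oplus>\<^sub>A 'b \<Rightarrow> 'b)"
    by (rule surjI[of dfst "\<lambda>a. DSum a 0"], simp) (rule surjI[of dsnd "\<lambda>b. DSum 0 b"], simp)
  \<comment> \<open>This element acts as \<open>1\<close> on the first summand and as \<open>0\<close> on the second, so it separates their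
    irreducible subrepresentations.\<close>
  let ?e = "DSum 1 0 :: 'a \<oplus>\<^sub>A 'b"
  have e: "?\<pi> ?e *\<^sub>V ?V x = ?V x" "?\<pi> ?e *\<^sub>V ?W y = 0" for x y
    by (simp_all add: tw1 tw2 representation_simps[OF rep(1)] representation_simps[OF rep(2)]
        one_bop.rep_eq zero_bop.rep_eq isometry_0[OF W])
  let ?K = "(`) ?V ` K1 \<union> (`) ?W ` K2"
  have irr: "irreducible_on ?\<pi> K" if "K \<in> ?K" for K
    using that
    by (auto intro!: irreducible_on_image[where \<pi> = ?\<pi> and \<sigma> = \<pi>\<^sub>1 and f = dfst, OF V tw1 surj1 K1(1)]
        irreducible_on_image[where \<pi> = ?\<pi> and \<sigma> = \<pi>\<^sub>2 and f = dsnd, OF W tw2 surj2 K2(1)])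
  have cross: "\<not> equivalent_on ?\<pi> (?V ` K) (?W ` L) \<and> \<not> equivalent_on ?\<pi> (?W ` L) (?V ` K)"
    if "K \<in> K1" for K L
  proof -
    have "irreducible_on ?\<pi> (?V ` K)" using irr that by blast
    then have VK: "cvs.subspace (?V ` K)" "?V ` K \<noteq> {0}"
      by (simp_all add: irreducible_on_def invariant_subspace_def)
    have "?\<pi> ?e *\<^sub>V v = v" if "v \<in> ?V ` K" for v using e(1) that by force
    moreover have "?\<pi> ?e *\<^sub>V v = 0" if "v \<in> ?W ` L" for v using e(2) that by force
    ultimately show ?thesis by (intro conjI not_equivalent_on[OF VK])
  qed
  have orth: "cinner (?V x) (?W y) = 0" "cinner (?W y) (?V x) = 0" for x y
    by (simp_all add: emb_fst_def emb_snd_def cinner_prod_def)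
  have pairs: thesis if "K \<in> ?K" "L \<in> ?K"
    "\<And>K' L'. K' \<in> K1 \<Longrightarrow> K = ?V ` K' \<Longrightarrow> L' \<in> K1 \<Longrightarrow> L = ?V ` L' \<Longrightarrow> thesis"
    "\<And>K' L'. K' \<in> K2 \<Longrightarrow> K = ?W ` K' \<Longrightarrow> L' \<in> K2 \<Longrightarrow> L = ?W ` L' \<Longrightarrow> thesis"
    "\<And>K' L'. K' \<in> K1 \<Longrightarrow> K = ?V ` K' \<Longrightarrow> L = ?W ` L' \<Longrightarrow> thesis"
    "\<And>K' L'. L' \<in> K1 \<Longrightarrow> K = ?W ` K' \<Longrightarrow> L = ?V ` L' \<Longrightarrow> thesis" for K L thesis
    by (insert that(1,2), elim UnE imageE; (rule that(3); assumption | rule that(4); assumption |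
        rule that(5); assumption | rule that(6); assumption))
  have inequiv: "\<not> equivalent_on ?\<pi> K L" if KL: "K \<in> ?K" "L \<in> ?K" "K \<noteq> L" for K L
  proof -
    show ?thesis
    proof (rule pairs[OF KL(1,2)], goal_cases)
      case (1 K' L')
      then have "\<not> equivalent_on \<pi>\<^sub>1 K' L'" using KL(3) by (intro K1(2)) auto
      then show ?thesis
        using equivalent_on_image[where \<pi> = ?\<pi> and \<sigma> = \<pi>\<^sub>1 and f = dfst, OF V tw1 surj1] 1 by metis
    next
      case (2 K' L')
      then have "\<not> equivalent_on \<pi>\<^sub>2 K' L'" using KL(3) by (intro K2(2)) auto
      then show ?thesis
        using equivalent_on_image[where \<pi> = ?\<pi> and \<sigma> = \<pi>\<^sub>2 and f = dsnd, OF W tw2 surj2] 2 by metis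
    qed (use cross in simp_all)
  qed
  have ortho: "cinner x y = 0" if KL: "K \<in> ?K" "L \<in> ?K" "K \<noteq> L" and xy: "x \<in> K" "y \<in> L" for K L x y
  proof (rule pairs[OF KL(1,2)], goal_cases)
    case (1 K' L')
    then have "K' \<noteq> L'" using KL(3) by blast
    with 1 xy show ?case by (auto simp: isometry_simps(3)[OF V] intro: K1(3))
  next
    case (2 K' L')
    then have "K' \<noteq> L'" using KL(3) by blast
    with 2 xy show ?case by (auto simp: isometry_simps(3)[OF W] intro: K2(3))
  qed (use xy orth in auto)
  have "dense_span (\<Union>?K)"
  proof (rule dense_spanI)
    fix N :: "('h \<times> 'k) set" assume N: "closed N" "cvs.subspace N" "\<Union>?K \<subseteq> N"
    have vim: "closed (J -` N)" "cvs.subspace (J -` N)" if J: "isometry J" for J :: "'c :: chilbert_space \<Rightarrow> 'h \<times> 'k"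
    proof -
      show "closed (J -` N)"
        using isometry_continuous_on[OF J, of UNIV] N(1) by (simp add: continuous_on_closed_vimage)
      show "cvs.subspace (J -` N)"
        using N(2) by (auto simp: cvs.subspace_def isometry_simps[OF J] isometry_0[OF J])
    qed
    have 1: "x \<in> ?V -` N" for x
      by (rule dense_span_subspace[OF K1(4) vim[OF V]]) (use N(3) in blast)
    have 2: "y \<in> ?W -` N" for y
      by (rule dense_span_subspace[OF K2(4) vim[OF W]]) (use N(3) in blast)
    have "v \<in> N" for v
    proof -
      have "v = ?V (fst v) + ?W (snd v)" by (simp add: emb_fst_def emb_snd_def)
      then show ?thesis using cvs.subspace_add[OF N(2)] 1 2 by (metis vimageE)
    qed
    then show "N = UNIV" by blast
  qed
  then show ?thesis
    unfolding atomic_def using irr inequiv ortho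
    by (intro exI[of _ ?K]) (auto simp: dense_span_def)
qed

lemma faithful_atomic_rep_sum:
  assumes "faithful_atomic \<pi>\<^sub>1" "faithful_atomic \<pi>\<^sub>2"
  shows "faithful_atomic (rep_sum \<pi>\<^sub>1 \<pi>\<^sub>2)"
  using assms atomic_rep_sum[of \<pi>\<^sub>1 \<pi>\<^sub>2] representation_rep_sum[of \<pi>\<^sub>1 \<pi>\<^sub>2]
  by (auto simp: faithful_atomic_def rep_sum_def inj_def bop_sum_eq_iff dsum.expand)

section \<open>Compact quantum metric spaces in terms of operators\<close>

lemma star_hom_psd:
  fixes \<phi> :: "'a :: chilbert_space bop \<Rightarrow> 'b :: chilbert_space bop"
  assumes \<phi>: "star_hom \<phi>" and T: "psd T"
  shows "psd (\<phi> T)"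
proof -
  have "star_subalgebra (UNIV :: 'a bop set)" by (simp add: star_subalgebra_def)
  then obtain S where "T = S\<^sup>\<star> * S"
    using psd_imp_positive_in[of UNIV T] T by (auto simp: positive_in_def)
  then have "\<phi> T = (\<phi> S)\<^sup>\<star> * \<phi> S" by (simp add: star_hom_simps[OF \<phi>])
  then show ?thesis by (simp add: psd_square)
qed

lemma psd_projection: "projection p \<Longrightarrow> psd p"
  using psd_square[of p] by (simp add: projection_def)

lemma psd_scaleR: "psd T \<Longrightarrow> 0 \<le> r \<Longrightarrow> psd (r *\<^sub>R T)"
  by (simp add: psd_def star_scaleR bop_rep_eqs)

lemma positive_in_iff_psd:
  assumes "star_subalgebra B" "closed B" "T \<in> B"
  shows "positive_in B T \<longleftrightarrow> psd T"
  using psd_imp_positive_in[OF assms] positive_in_imp_psd by blast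

lemma leg_maps:
  assumes T: "T \<in> spatial_tensor A A"
  shows flip_map_eq: "flip_map A T = flip T"
    and middle_map_eq: "middle_map A T = leg13 T"
    and one_tensor_eq: "one_tensor A T = leg23 T"
  unfolding flip_map_def middle_map_def one_tensor_def
  by (rule tensor_hom_eq[OF _ _ T]; simp add: flip leg13 leg23)+

lemma leg_in_spatial_tensor:
  assumes A: "star_subalgebra A" and T: "T \<in> spatial_tensor A A"
  shows "leg12 T \<in> spatial_tensor (spatial_tensor A A) A"
    and "leg13 T \<in> spatial_tensor (spatial_tensor A A) A"
    and "leg23 T \<in> spatial_tensor (spatial_tensor A A) A"
  by (rule bounded_clinear_spatial_tensor_mem[OF star_hom_bounded_clinear[OF leg12(1)]
        closed_spatial_tensor subspace_spatial_tensor _ T]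
      bounded_clinear_spatial_tensor_mem[OF star_hom_bounded_clinear[OF leg13(1)]
        closed_spatial_tensor subspace_spatial_tensor _ T]
      bounded_clinear_spatial_tensor_mem[OF star_hom_bounded_clinear[OF leg23(1)]
        closed_spatial_tensor subspace_spatial_tensor _ T];
      simp add: leg12 leg13 leg23 tensor_in_spatial_tensor star_subalgebraD[OF A])+

text \<open>The definition without references to C*-algebras of threefold tensors, suprema and morphisms that
  are given by a choice: the positivity conditions become conditions on quadratic forms, and
  the conditions on \<open>P_delta \<pi>\<close> become conditions for each minimal projection.\<close>

lemma compact_quantum_metric_space_iff:
  fixes \<pi> :: "'a :: unital_cstar_algebra \<Rightarrow> 'h :: chilbert_space bop"
  defines "minproj \<equiv> minimal_projection (bicommutant (range \<pi>))"
  shows "compact_quantum_metric_space \<rho> \<pi> \<longleftrightarrow>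
    faithful_atomic \<pi> \<and> \<rho> \<in> spatial_tensor (range \<pi>) (range \<pi>) \<and> psd \<rho> \<and>
    (\<forall>p. minproj p \<longrightarrow> \<rho> * (p \<otimes>\<^sub>o p) = 0) \<and>
    (\<forall>v. (\<forall>p. minproj p \<longrightarrow> (p \<otimes>\<^sub>o p) *\<^sub>V v = 0) \<and> \<rho> *\<^sub>V v = 0 \<longrightarrow> v = 0) \<and>
    flip \<rho> = \<rho> \<and> psd (leg12 \<rho> + leg23 \<rho> - leg13 \<rho>)"
proof (cases "faithful_atomic \<pi> \<and> \<rho> \<in> spatial_tensor (range \<pi>) (range \<pi>)")
  case True
  let ?A = "range \<pi>"
  let ?AA = "spatial_tensor ?A ?A"
  let ?AAA = "spatial_tensor ?AA ?A"
  have A: "star_subalgebra ?A"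
    using True by (simp add: faithful_atomic_def star_subalgebra_range)
  then have cl: "star_closed ?A" by (simp add: star_closed_def star_subalgebra_def)
  have AA: "star_subalgebra ?AA" and AAA: "star_subalgebra ?AAA"
    by (intro star_subalgebra_spatial_tensor A)+
  have \<rho>: "\<rho> \<in> ?AA" using True by simp
  have leg12_eq: "\<rho> \<otimes>\<^sub>o 1 = leg12 \<rho>" by (simp add: leg12_def)
  have pos: "positive_in ?AA \<rho> \<longleftrightarrow> psd \<rho>"
    by (rule positive_in_iff_psd[OF AA closed_spatial_tensor \<rho>])
  have tri: "positive_in ?AAA (\<rho> \<otimes>\<^sub>o 1 + one_tensor ?A \<rho> - middle_map ?A \<rho>) \<longleftrightarrow>
      psd (leg12 \<rho> + leg23 \<rho> - leg13 \<rho>)"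
    unfolding leg12_eq leg_maps[OF \<rho>]
    by (intro positive_in_iff_psd AAA closed_spatial_tensor star_subalgebraD[OF AAA]
        leg_in_spatial_tensor[OF A \<rho>])
  have P_delta: "P_delta \<pi> * \<rho> = 0 \<longleftrightarrow> \<rho> * P_delta \<pi> = 0" if "psd \<rho>"
  proof -
    have "P_delta \<pi> * \<rho> = (\<rho> * P_delta \<pi>)\<^sup>\<star>"
      using that projection_P_delta[OF cl] by (simp add: psd_def projection_def star_mult)
    then show ?thesis by (metis star_star star_zero)
  qed
  have eig: "\<not> eigenvalue_on (orthogonal_complement (H_delta \<pi>)) \<rho> 0 \<longleftrightarrow>
      (\<forall>v. (\<forall>p. minproj p \<longrightarrow> (p \<otimes>\<^sub>o p) *\<^sub>V v = 0) \<and> \<rho> *\<^sub>V v = 0 \<longrightarrow> v = 0)"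
    unfolding eigenvalue_on_def Bex_def orthogonal_complement_H_delta[OF cl] minproj_def by auto
  show ?thesis
    unfolding compact_quantum_metric_space_def Let_def pos tri eig flip_map_eq[OF \<rho>]
    using True P_delta mult_P_delta_eq_0_iff[OF cl, of \<rho>] unfolding minproj_def by blast
qed (auto simp: compact_quantum_metric_space_def Let_def)

section \<open>The triangle inequality\<close>

text \<open>The contribution of one summand to the triangle inequality. With \<open>F = 1 - E\<close>, the operator
  \<open>leg12 R\<close> lives on the blocks \<open>EEE\<close> and \<open>EEF\<close>, \<open>leg23 R\<close> on \<open>EEE\<close> and \<open>FEE\<close>, and \<open>leg13 R\<close> on
  \<open>EEE\<close> and \<open>EFE\<close>. On \<open>EEE\<close> the three combine to a copy of the triangle inequality
  for \<open>\<rho>\<close>; on \<open>EFE\<close> the negative term is dominated by \<open>2 r\<close>; the other two contributions are positive.\<close>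

lemma triangle_block:
  fixes V :: "'h :: chilbert_space \<Rightarrow> 'k :: chilbert_space"
  assumes V: "isometry V" and \<rho>: "\<rho> \<in> spatial_tensor A B" "psd \<rho>"
    and tri: "psd (leg12 \<rho> + leg23 \<rho> - leg13 \<rho>)" and r: "norm \<rho> \<le> 2 * r"
  defines "E \<equiv> conj_by V 1" and "R \<equiv> conj_by (iso_tensor V V) \<rho>"
  shows "psd (leg12 R + leg23 R - leg13 R + (2 * r) *\<^sub>R ((E \<otimes>\<^sub>o (1 - E)) \<otimes>\<^sub>o E))"
proof -
  define F where "F = 1 - E"
  define J where "J = iso_tensor V V"
  have J: "isometry J" unfolding J_def by (rule isometry_iso_tensor[OF V V])
  note c = star_hom_simps[OF star_hom_conj_by[OF V]]
  note cJ = star_hom_simps[OF star_hom_conj_by[OF J]]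
  have EE: "E * E = E" "E\<^sup>\<star> = E" by (simp_all add: E_def flip: c)
  have aE: "conj_by V a * E = conj_by V a" "E * conj_by V a = conj_by V a" for a
    by (simp_all add: E_def flip: c)
  have aF: "conj_by V a * F = 0" "F * conj_by V a = 0" for a
    by (simp_all add: F_def algebra_simps aE)
  have FF: "F * F = F" "F\<^sup>\<star> = F" by (simp_all add: F_def algebra_simps EE star_diff)
  have one: "1 = E + F" by (simp add: F_def)
  have Jt: "conj_by J (a \<otimes>\<^sub>o b) = conj_by V a \<otimes>\<^sub>o conj_by V b" for a b
    unfolding J_def by (rule conj_by_iso_tensor[OF V V])
  have RE: "R * (E \<otimes>\<^sub>o E) = R"
  proof -
    have "E \<otimes>\<^sub>o E = conj_by J 1" using Jt[of 1 1] by (simp add: E_def bop_tensor_one)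
    then show ?thesis by (simp add: R_def flip: J_def cJ)
  qed
  let ?e = "\<lambda>x y z. (x \<otimes>\<^sub>o y) \<otimes>\<^sub>o z :: (('k \<otimes>\<^sub>H 'k) \<otimes>\<^sub>H 'k) bop"
  let ?l12 = "leg12 :: ('k \<otimes>\<^sub>H 'k) bop \<Rightarrow> (('k \<otimes>\<^sub>H 'k) \<otimes>\<^sub>H 'k) bop"
  let ?l13 = "leg13 :: ('k \<otimes>\<^sub>H 'k) bop \<Rightarrow> (('k \<otimes>\<^sub>H 'k) \<otimes>\<^sub>H 'k) bop"
  let ?l23 = "leg23 :: ('k \<otimes>\<^sub>H 'k) bop \<Rightarrow> (('k \<otimes>\<^sub>H 'k) \<otimes>\<^sub>H 'k) bop"
  note hom = leg12(1) leg13(1) leg23(1)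
  have bc: "bounded_clinear (\<lambda>T. \<phi> (conj_by J T))" if "star_hom \<phi>"
    for \<phi> :: "('k \<otimes>\<^sub>H 'k) bop \<Rightarrow> (('k \<otimes>\<^sub>H 'k) \<otimes>\<^sub>H 'k) bop"
    by (intro star_hom_bounded_clinear star_hom_comp[OF star_hom_conj_by[OF J] that])
  have proj: "projection (?e x y z)" if "x \<in> {E, F}" "y \<in> {E, F}" "z \<in> {E, F}" for x y z
    using that by (auto simp: projection_def bop_tensor_mult bop_tensor_star EE FF)
  \<comment> \<open>By density it is enough to consider an elementary tensor in place of \<open>\<rho>\<close>; each of \<open>E\<close> and \<open>F\<close> commutes with
    the operators \<open>conj_by V a\<close>.\<close>
  have comm: "\<phi> R * ?e x y z = ?e x y z * \<phi> R"
    if \<phi>: "\<phi> = ?l12 \<or> \<phi> = ?l13 \<or> \<phi> = ?l23" and xyz: "x \<in> {E, F}" "y \<in> {E, F}" "z \<in> {E, F}"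
    for \<phi> x y z
    unfolding R_def J_def[symmetric]
  proof (rule spatial_tensor_eqI[OF _ _ _ \<rho>(1)])
    have "star_hom \<phi>" using \<phi> hom by auto
    then show "bounded_clinear (\<lambda>T. \<phi> (conj_by J T) * ?e x y z)"
      "bounded_clinear (\<lambda>T. ?e x y z * \<phi> (conj_by J T))"
      by (intro bounded_clinear_mult bc; assumption)+
    show "\<phi> (conj_by J (a \<otimes>\<^sub>o b)) * ?e x y z = ?e x y z * \<phi> (conj_by J (a \<otimes>\<^sub>o b))" for a b
      using \<phi> xyz by (auto simp: Jt leg12(2) leg13(2) leg23(2) bop_tensor_mult aE aF)
  qed
  have split12: "?l12 R = ?l12 R * ?e E E E + ?l12 R * ?e E E F"
  proof -
    have "?l12 R = ?l12 R * ?l12 (E \<otimes>\<^sub>o E)" by (simp add: RE flip: star_hom_simps(3)[OF leg12(1)])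
    also have "?l12 (E \<otimes>\<^sub>o E) = ?e E E E + ?e E E F"
      by (simp add: leg12(2) one flip: bop_tensor_add_right)
    finally show ?thesis by (simp add: distrib_left)
  qed
  have split13: "?l13 R = ?l13 R * ?e E E E + ?l13 R * ?e E F E"
  proof -
    have "?l13 R = ?l13 R * ?l13 (E \<otimes>\<^sub>o E)" by (simp add: RE flip: star_hom_simps(3)[OF leg13(1)])
    also have "?l13 (E \<otimes>\<^sub>o E) = ?e E E E + ?e E F E"
      by (simp add: leg13(2) one flip: bop_tensor_add_right bop_tensor_add_left)
    finally show ?thesis by (simp add: distrib_left)
  qed
  have split23: "?l23 R = ?l23 R * ?e E E E + ?l23 R * ?e F E E"
  proof -
    have "?l23 R = ?l23 R * ?l23 (E \<otimes>\<^sub>o E)" by (simp add: RE flip: star_hom_simps(3)[OF leg23(1)])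
    also have "?l23 (E \<otimes>\<^sub>o E) = ?e E E E + ?e F E E"
      by (simp add: leg23(2) one flip: bop_tensor_add_right bop_tensor_add_left)
    finally show ?thesis by (simp add: distrib_left)
  qed
  have J3: "isometry (iso_tensor J V)" by (rule isometry_iso_tensor[OF J V])
  have "(?l12 R + ?l23 R - ?l13 R) * ?e E E E =
      conj_by (iso_tensor J V) (leg12 \<rho> + leg23 \<rho> - leg13 \<rho>)"
    unfolding R_def J_def[symmetric]
  proof (rule spatial_tensor_eqI[OF _ _ _ \<rho>(1)])
    show "bounded_clinear (\<lambda>T. (?l12 (conj_by J T) + ?l23 (conj_by J T) - ?l13 (conj_by J T)) * ?e E E E)"
      by (intro bounded_clinear_mult bounded_clinear_add bounded_clinear_diff bc hom)
    show "bounded_clinear (\<lambda>T. conj_by (iso_tensor J V) (leg12 T + leg23 T - leg13 T))"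
      unfolding star_hom_simps[OF star_hom_conj_by[OF J3]]
      by (intro bounded_clinear_add bounded_clinear_diff star_hom_bounded_clinear
          star_hom_comp[OF _ star_hom_conj_by[OF J3]] hom)
    show "(?l12 (conj_by J (a \<otimes>\<^sub>o b)) + ?l23 (conj_by J (a \<otimes>\<^sub>o b)) - ?l13 (conj_by J (a \<otimes>\<^sub>o b))) * ?e E E E =
        conj_by (iso_tensor J V) (leg12 (a \<otimes>\<^sub>o b) + leg23 (a \<otimes>\<^sub>o b) - leg13 (a \<otimes>\<^sub>o b))" for a b
      by (simp add: Jt star_hom_simps[OF star_hom_conj_by[OF J3]] conj_by_iso_tensor[OF J V]
          leg12(2) leg13(2) leg23(2) bop_tensor_mult aE distrib_right left_diff_distrib flip: E_def)
  qed
  then have psd1: "psd ((?l12 R + ?l23 R - ?l13 R) * ?e E E E)"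
    using star_hom_psd[OF star_hom_conj_by[OF J3] tri] by simp
  have psdR: "psd R"
    unfolding R_def J_def[symmetric] by (rule star_hom_psd[OF star_hom_conj_by[OF J] \<rho>(2)])
  have psd2: "psd (?l12 R * ?e E E F)"
    using comm[of ?l12 E E F]
    by (intro psd_mult_projection star_hom_psd[OF leg12(1) psdR] proj) simp_all
  have psd3: "psd (?l23 R * ?e F E E)"
    using comm[of ?l23 F E E]
    by (intro psd_mult_projection star_hom_psd[OF leg23(1) psdR] proj) simp_all
  have "norm (?l13 R) \<le> norm R" by (rule star_hom_contractive[OF leg13(1)])
  also have "\<dots> \<le> norm \<rho>"
    unfolding R_def J_def[symmetric] by (rule star_hom_contractive[OF star_hom_conj_by[OF J]])
  finally have "psd ((2 * r) *\<^sub>R 1 - ?l13 R)"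
    using r star_hom_psd[OF leg13(1) psdR] by (intro psd_minus_bounded) (auto simp: psd_def)
  then have psd4: "psd (((2 * r) *\<^sub>R 1 - ?l13 R) * ?e E F E)"
    using comm[of ?l13 E F E] proj[of E F E]
    by (intro psd_mult_projection) (simp_all add: left_diff_distrib right_diff_distrib)
  have "?l12 R + ?l23 R - ?l13 R + (2 * r) *\<^sub>R ?e E F E =
      (?l12 R + ?l23 R - ?l13 R) * ?e E E E + ?l12 R * ?e E E F + ?l23 R * ?e F E E
      + ((2 * r) *\<^sub>R 1 - ?l13 R) * ?e E F E"
    using split12 split13 split23 by (simp add: algebra_simps)
  then show ?thesis using psd_add[OF psd_add[OF psd_add[OF psd1 psd2] psd3] psd4] by (simp add: F_def)
qed

text \<open>Expand \<open>1 = P + Q\<close> in the idle leg. The terms with two equal adjacent factors, like \<open>PPQ\<close>, occur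
  once with each sign, whereas \<open>PQP\<close> and \<open>QPQ\<close> occur twice and only with positive sign.\<close>

lemma leg_cross_terms:
  fixes P Q :: "'k :: chilbert_space bop"
  assumes "P + Q = 1"
  shows "leg12 (P \<otimes>\<^sub>o Q) + leg12 (Q \<otimes>\<^sub>o P) + (leg23 (P \<otimes>\<^sub>o Q) + leg23 (Q \<otimes>\<^sub>o P))
     - (leg13 (P \<otimes>\<^sub>o Q) + leg13 (Q \<otimes>\<^sub>o P)) = 2 *\<^sub>R ((P \<otimes>\<^sub>o Q) \<otimes>\<^sub>o P) + 2 *\<^sub>R ((Q \<otimes>\<^sub>o P) \<otimes>\<^sub>o Q)"
proof -
  have one: "1 = P + Q" using assms by simp
  show ?thesis
    unfolding leg12(2) leg13(2) leg23(2) one bop_tensor_add_left bop_tensor_add_right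
    by (simp add: scaleR_2 algebra_simps)
qed

section \<open>The direct sum of two compact quantum metric spaces\<close>

text \<open>With \<open>J = V \<otimes> V\<close>, the vector \<open>J\<^sup>* v\<close> satisfies the hypotheses of \<open>inj\<close>, so it vanishes, and so does
  \<open>J J\<^sup>* v\<close>.\<close>

lemma diagonal_block_vanishes:
  fixes V :: "'h :: chilbert_space \<Rightarrow> 'k :: chilbert_space"
  assumes V: "isometry V"
    and inj: "\<And>w. (\<And>q. minproj q \<Longrightarrow> (q \<otimes>\<^sub>o q) *\<^sub>V w = 0) \<Longrightarrow> \<rho> *\<^sub>V w = 0 \<Longrightarrow> w = 0"
    and v: "\<And>q. minproj q \<Longrightarrow> (conj_by V q \<otimes>\<^sub>o conj_by V q) *\<^sub>V v = 0"
      "conj_by (iso_tensor V V) \<rho> *\<^sub>V v = 0"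
  shows "(conj_by V 1 \<otimes>\<^sub>o conj_by V 1) *\<^sub>V v = 0"
proof -
  define J where "J = iso_tensor V V"
  have J: "isometry J" unfolding J_def by (rule isometry_iso_tensor[OF V V])
  have J0: "T *\<^sub>V iso_adj J v = 0" if "conj_by J T *\<^sub>V v = 0" for T
    using that isometry_norm[OF J, of "T *\<^sub>V iso_adj J v"] by (simp add: conj_by_apply[OF J])
  have "iso_adj J v = 0"
  proof (rule inj)
    show "(q \<otimes>\<^sub>o q) *\<^sub>V iso_adj J v = 0" if "minproj q" for q
      using v(1)[OF that] by (intro J0) (simp only: J_def conj_by_iso_tensor[OF V V])
    show "\<rho> *\<^sub>V iso_adj J v = 0" using v(2) by (intro J0) (simp only: J_def)
  qed
  then have "conj_by J (1 \<otimes>\<^sub>o 1) *\<^sub>V v = 0" by (simp add: conj_by_apply[OF J] isometry_0[OF J])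
  then show ?thesis by (simp add: J_def conj_by_iso_tensor[OF V V])
qed

lemma flip_conj_by:
  assumes V: "isometry V" and T: "T \<in> spatial_tensor A B"
  shows "flip (conj_by (iso_tensor V V) T) = conj_by (iso_tensor V V) (flip T)"
proof (rule spatial_tensor_eqI[OF _ _ _ T])
  note J = star_hom_conj_by[OF isometry_iso_tensor[OF V V]]
  show "bounded_clinear (\<lambda>T. flip (conj_by (iso_tensor V V) T))"
    "bounded_clinear (\<lambda>T. conj_by (iso_tensor V V) (flip T))"
    by (intro star_hom_bounded_clinear star_hom_comp[OF J flip(1)] star_hom_comp[OF flip(1) J])+
qed (simp add: conj_by_iso_tensor[OF V V] flip(2))

lemma summand_eq_conj_by:
  assumes V: "isometry V" and W: "isometry W" and T: "T \<in> spatial_tensor A B"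
  shows "summand A B (conj_by V) (conj_by W) T = conj_by (iso_tensor V W) T"
  unfolding summand_def
  by (rule tensor_hom_eq[OF star_hom_conj_by[OF isometry_iso_tensor[OF V W]] _ T])
    (rule conj_by_iso_tensor[OF V W])

theorem theorem2:
  fixes \<pi>\<^sub>1 :: "'a\<^sub>1 :: unital_cstar_algebra \<Rightarrow> 'h\<^sub>1 :: chilbert_space bop"
    and \<pi>\<^sub>2 :: "'a\<^sub>2 :: unital_cstar_algebra \<Rightarrow> 'h\<^sub>2 :: chilbert_space bop"
    and \<rho>\<^sub>1 :: "('h\<^sub>1 \<otimes>\<^sub>H 'h\<^sub>1) bop"
    and \<rho>\<^sub>2 :: "('h\<^sub>2 \<otimes>\<^sub>H 'h\<^sub>2) bop"
    and r :: real
  assumes "compact_quantum_metric_space \<rho>\<^sub>1 \<pi>\<^sub>1"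
    and "compact_quantum_metric_space \<rho>\<^sub>2 \<pi>\<^sub>2"
    and "r \<ge> 1 / 2 * max (norm \<rho>\<^sub>1) (norm \<rho>\<^sub>2)"
    and "r \<noteq> 0 \<or> (1 :: 'a\<^sub>1) = 0 \<or> (1 :: 'a\<^sub>2) = 0"
  shows "compact_quantum_metric_space
    (summand (range \<pi>\<^sub>1) (range \<pi>\<^sub>1) in_fst in_fst \<rho>\<^sub>1 +
     summand (range \<pi>\<^sub>2) (range \<pi>\<^sub>2) in_snd in_snd \<rho>\<^sub>2 +
     r *\<^sub>R summand (range \<pi>\<^sub>1) (range \<pi>\<^sub>2) in_fst in_snd 1 +
     r *\<^sub>R summand (range \<pi>\<^sub>2) (range \<pi>\<^sub>1) in_snd in_fst 1)
    (rep_sum \<pi>\<^sub>1 \<pi>\<^sub>2)" (is "compact_quantum_metric_space ?\<rho> ?\<pi>")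
proof -
  let ?A1 = "range \<pi>\<^sub>1" and ?A2 = "range \<pi>\<^sub>2" and ?A = "range ?\<pi>"
  let ?V = "emb_fst :: 'h\<^sub>1 \<Rightarrow> 'h\<^sub>1 \<times> 'h\<^sub>2" and ?W = "emb_snd :: 'h\<^sub>2 \<Rightarrow> 'h\<^sub>1 \<times> 'h\<^sub>2"
  have V: "isometry ?V" and W: "isometry ?W" by (rule isometry_emb)+
  note VV = isometry_iso_tensor[OF V V] and WW = isometry_iso_tensor[OF W W]
  have cqms: "faithful_atomic \<pi>\<^sub>1" "\<rho>\<^sub>1 \<in> spatial_tensor ?A1 ?A1" "psd \<rho>\<^sub>1" "flip \<rho>\<^sub>1 = \<rho>\<^sub>1"
    "psd (leg12 \<rho>\<^sub>1 + leg23 \<rho>\<^sub>1 - leg13 \<rho>\<^sub>1)"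
    "faithful_atomic \<pi>\<^sub>2" "\<rho>\<^sub>2 \<in> spatial_tensor ?A2 ?A2" "psd \<rho>\<^sub>2" "flip \<rho>\<^sub>2 = \<rho>\<^sub>2"
    "psd (leg12 \<rho>\<^sub>2 + leg23 \<rho>\<^sub>2 - leg13 \<rho>\<^sub>2)"
    using assms(1,2) by (simp_all add: compact_quantum_metric_space_iff)
  let ?min1 = "minimal_projection (bicommutant ?A1)" and ?min2 = "minimal_projection (bicommutant ?A2)"
  have kill: "?min1 p \<Longrightarrow> \<rho>\<^sub>1 * (p \<otimes>\<^sub>o p) = 0" "?min2 q \<Longrightarrow> \<rho>\<^sub>2 * (q \<otimes>\<^sub>o q) = 0" for p q
    using assms(1,2) by (simp_all add: compact_quantum_metric_space_iff)
  have inj1: "w = 0" if "\<And>q. ?min1 q \<Longrightarrow> (q \<otimes>\<^sub>o q) *\<^sub>V w = 0" "\<rho>\<^sub>1 *\<^sub>V w = 0" for w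
    using assms(1) that unfolding compact_quantum_metric_space_iff by blast
  have inj2: "w = 0" if "\<And>q. ?min2 q \<Longrightarrow> (q \<otimes>\<^sub>o q) *\<^sub>V w = 0" "\<rho>\<^sub>2 *\<^sub>V w = 0" for w
    using assms(2) that unfolding compact_quantum_metric_space_iff by blast
  have rep: "representation \<pi>\<^sub>1" "representation \<pi>\<^sub>2" "representation ?\<pi>"
    using cqms(1,6) representation_rep_sum by (auto simp: faithful_atomic_def)
  note A1 = star_subalgebra_range[OF rep(1)] and A2 = star_subalgebra_range[OF rep(2)]
    and A = star_subalgebra_range[OF rep(3)]
  note AA = star_subalgebra_spatial_tensor[OF A A]
  define E1 where "E1 = (in_fst 1 :: ('h\<^sub>1 \<times> 'h\<^sub>2) bop)"
  define E2 where "E2 = (in_snd 1 :: ('h\<^sub>1 \<times> 'h\<^sub>2) bop)"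
  have EV: "conj_by ?V 1 = E1" and EW: "conj_by ?W 1 = E2"
    by (simp_all add: E1_def E2_def in_fst_conj_by in_snd_conj_by)
  have sum1: "E1 + E2 = 1" and E12: "E1 * E2 = 0" "E2 * E1 = 0"
    and EE: "E1 * E1 = E1" "E2 * E2 = E2" "projection E1" "projection E2"
    by (simp_all add: E1_def E2_def in_fst_def in_snd_def bop_sum_add bop_sum_mult bop_sum_one
        bop_sum_zero projection_def bop_sum_star)
  have E_in: "E1 * in_fst a = in_fst a" "E2 * in_fst a = 0" "E1 * in_snd b = 0" "E2 * in_snd b = in_snd b"
    for a b
    by (simp_all add: E1_def E2_def in_fst_def in_snd_def bop_sum_mult bop_sum_zero)
  define R1 where "R1 = conj_by (iso_tensor ?V ?V) \<rho>\<^sub>1"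
  define R2 where "R2 = conj_by (iso_tensor ?W ?W) \<rho>\<^sub>2"
  have one_mem: "1 \<in> spatial_tensor ?A1 ?A2" "1 \<in> spatial_tensor ?A2 ?A1"
    by (intro star_subalgebraD(1) star_subalgebra_spatial_tensor A1 A2)+
  have \<rho>_eq: "?\<rho> = R1 + R2 + r *\<^sub>R (E1 \<otimes>\<^sub>o E2) + r *\<^sub>R (E2 \<otimes>\<^sub>o E1)"
    using summand_eq_conj_by[OF V W one_mem(1)] conj_by_iso_tensor[OF V W, of 1 1]
      summand_eq_conj_by[OF W V one_mem(2)] conj_by_iso_tensor[OF W V, of 1 1]
      summand_eq_conj_by[OF V V cqms(2)] summand_eq_conj_by[OF W W cqms(7)]
    by (simp add: in_fst_conj_by in_snd_conj_by bop_tensor_one EV EW R1_def R2_def)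
  have ER: "R1 = R1 * (E1 \<otimes>\<^sub>o E1)" "R1 = (E1 \<otimes>\<^sub>o E1) * R1"
    "R2 = R2 * (E2 \<otimes>\<^sub>o E2)" "R2 = (E2 \<otimes>\<^sub>o E2) * R2"
    using star_hom_simps(3)[OF star_hom_conj_by[OF VV], of \<rho>\<^sub>1 1]
      star_hom_simps(3)[OF star_hom_conj_by[OF VV], of 1 \<rho>\<^sub>1]
      star_hom_simps(3)[OF star_hom_conj_by[OF WW], of \<rho>\<^sub>2 1]
      star_hom_simps(3)[OF star_hom_conj_by[OF WW], of 1 \<rho>\<^sub>2]
      conj_by_iso_tensor[OF V V, of 1 1] conj_by_iso_tensor[OF W W, of 1 1]
    by (simp_all add: R1_def R2_def EV EW bop_tensor_one)
  have absorb_left: "(x \<otimes>\<^sub>o y) * T = ((x * e) \<otimes>\<^sub>o (y * e)) * T" if "T = (e \<otimes>\<^sub>o e) * T"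
    for x y e :: "('h\<^sub>1 \<times> 'h\<^sub>2) bop" and T
  proof -
    have "(x \<otimes>\<^sub>o y) * T = (x \<otimes>\<^sub>o y) * ((e \<otimes>\<^sub>o e) * T)" by (rule arg_cong[OF that])
    then show ?thesis by (simp only: bop_tensor_mult flip: mult.assoc)
  qed
  have absorb_right: "T * (x \<otimes>\<^sub>o y) = T * ((e * x) \<otimes>\<^sub>o (e * y))" if "T = T * (e \<otimes>\<^sub>o e)"
    for x y e :: "('h\<^sub>1 \<times> 'h\<^sub>2) bop" and T
  proof -
    have "T * (x \<otimes>\<^sub>o y) = T * (e \<otimes>\<^sub>o e) * (x \<otimes>\<^sub>o y)"
      by (rule arg_cong[OF that, of "\<lambda>T. T * (x \<otimes>\<^sub>o y)"])
    then show ?thesis by (simp only: bop_tensor_mult mult.assoc)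
  qed
  note cross = absorb_left[OF ER(2)] absorb_left[OF ER(4)] absorb_right[OF ER(1)] absorb_right[OF ER(3)]
  have in_A: "a \<in> ?A1 \<Longrightarrow> in_fst a \<in> ?A" "b \<in> ?A2 \<Longrightarrow> in_snd b \<in> ?A" for a b
    unfolding range_rep_sum in_fst_def in_snd_def
    using star_subalgebraD(2)[OF A1] star_subalgebraD(2)[OF A2] by blast+
  have E_A: "E1 \<in> ?A" "E2 \<in> ?A"
    unfolding E1_def E2_def by (intro in_A star_subalgebraD(1) A1 A2)+
  have min_iff: "minimal_projection (bicommutant ?A) p \<longleftrightarrow>
      (\<exists>q. ?min1 q \<and> p = in_fst q) \<or> (\<exists>q. ?min2 q \<and> p = in_snd q)" for p
    unfolding range_rep_sum
      bicommutant_bop_sum[OF star_subalgebraD(2,1)[OF A1] star_subalgebraD(2,1)[OF A2]]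
    by (rule minimal_projection_bop_sum[OF zero_one_commutant(1) zero_one_commutant(1)])
  have r: "norm \<rho>\<^sub>1 \<le> 2 * r" "norm \<rho>\<^sub>2 \<le> 2 * r" using assms(3) by auto
  then have r0: "0 \<le> r" using norm_ge_zero[of \<rho>\<^sub>1] by linarith
  have R1_A: "R1 \<in> spatial_tensor ?A ?A"
    unfolding R1_def
    by (rule bounded_clinear_spatial_tensor_mem[OF star_hom_bounded_clinear[OF star_hom_conj_by[OF VV]]
          closed_spatial_tensor subspace_spatial_tensor _ cqms(2)])
      (use in_A star_subalgebraD(2)[OF A2] in
        \<open>auto simp: conj_by_iso_tensor[OF V V] simp flip: in_fst_conj_by intro!: tensor_in_spatial_tensor\<close>)
  have R2_A: "R2 \<in> spatial_tensor ?A ?A"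
    unfolding R2_def
    by (rule bounded_clinear_spatial_tensor_mem[OF star_hom_bounded_clinear[OF star_hom_conj_by[OF WW]]
          closed_spatial_tensor subspace_spatial_tensor _ cqms(7)])
      (use in_A star_subalgebraD(2)[OF A1] in
        \<open>auto simp: conj_by_iso_tensor[OF W W] simp flip: in_snd_conj_by intro!: tensor_in_spatial_tensor\<close>)
  show ?thesis
    unfolding compact_quantum_metric_space_iff \<rho>_eq
  proof (intro conjI allI impI)
    show "faithful_atomic ?\<pi>" by (rule faithful_atomic_rep_sum[OF cqms(1,6)])
    show "R1 + R2 + r *\<^sub>R (E1 \<otimes>\<^sub>o E2) + r *\<^sub>R (E2 \<otimes>\<^sub>o E1) \<in> spatial_tensor ?A ?A"
      by (intro star_subalgebraD[OF AA] R1_A R2_A tensor_in_spatial_tensor E_A)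
    show "psd (R1 + R2 + r *\<^sub>R (E1 \<otimes>\<^sub>o E2) + r *\<^sub>R (E2 \<otimes>\<^sub>o E1))"
      unfolding R1_def R2_def
      by (intro psd_add psd_scaleR psd_projection projection_tensor EE r0
          star_hom_psd[OF star_hom_conj_by[OF VV]] star_hom_psd[OF star_hom_conj_by[OF WW]] cqms(3,8))
    show "flip (R1 + R2 + r *\<^sub>R (E1 \<otimes>\<^sub>o E2) + r *\<^sub>R (E2 \<otimes>\<^sub>o E1)) =
        R1 + R2 + r *\<^sub>R (E1 \<otimes>\<^sub>o E2) + r *\<^sub>R (E2 \<otimes>\<^sub>o E1)"
      by (simp add: star_hom_simps[OF flip(1)] flip(2) R1_def R2_def flip_conj_by[OF V cqms(2)]
          flip_conj_by[OF W cqms(7)] cqms(4,9))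
  next
    fix p assume "minimal_projection (bicommutant ?A) p"
    then consider q where "?min1 q" "p = in_fst q" | q where "?min2 q" "p = in_snd q"
      unfolding min_iff by blast
    then show "(R1 + R2 + r *\<^sub>R (E1 \<otimes>\<^sub>o E2) + r *\<^sub>R (E2 \<otimes>\<^sub>o E1)) * (p \<otimes>\<^sub>o p) = 0"
    proof cases
      case 1
      have "R1 * (p \<otimes>\<^sub>o p) = conj_by (iso_tensor ?V ?V) (\<rho>\<^sub>1 * (q \<otimes>\<^sub>o q))"
        by (simp add: R1_def 1 in_fst_conj_by star_hom_simps(3)[OF star_hom_conj_by[OF VV]]
            conj_by_iso_tensor[OF V V])
      then have "R1 * (p \<otimes>\<^sub>o p) = 0"
        by (simp add: kill(1)[OF 1(1)] star_hom_simps(6)[OF star_hom_conj_by[OF VV]])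
      then show ?thesis
        using cross(4)[of p p] by (simp add: 1 distrib_right bop_tensor_mult E_in)
    next
      case 2
      have "R2 * (p \<otimes>\<^sub>o p) = conj_by (iso_tensor ?W ?W) (\<rho>\<^sub>2 * (q \<otimes>\<^sub>o q))"
        by (simp add: R2_def 2 in_snd_conj_by star_hom_simps(3)[OF star_hom_conj_by[OF WW]]
            conj_by_iso_tensor[OF W W])
      then have "R2 * (p \<otimes>\<^sub>o p) = 0"
        by (simp add: kill(2)[OF 2(1)] star_hom_simps(6)[OF star_hom_conj_by[OF WW]])
      then show ?thesis
        using cross(3)[of p p] by (simp add: 2 distrib_right bop_tensor_mult E_in)
    qed
  next
    let ?R = "R1 + R2 + r *\<^sub>R (E1 \<otimes>\<^sub>o E2) + r *\<^sub>R (E2 \<otimes>\<^sub>o E1)"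
    fix v
    assume v: "(\<forall>p. minimal_projection (bicommutant ?A) p \<longrightarrow> (p \<otimes>\<^sub>o p) *\<^sub>V v = 0) \<and> ?R *\<^sub>V v = 0"
    have apply0: "(S * ?R) *\<^sub>V v = 0" for S using v by (simp add: times_bop.rep_eq)
    \<comment> \<open>Multiplying by \<open>E\<^sub>i \<otimes> E\<^sub>j\<close> isolates one block of \<open>\<rho>\<close>.\<close>
    have blocks: "(E1 \<otimes>\<^sub>o E1) * ?R = R1" "(E2 \<otimes>\<^sub>o E2) * ?R = R2"
      "(E1 \<otimes>\<^sub>o E2) * ?R = r *\<^sub>R (E1 \<otimes>\<^sub>o E2)" "(E2 \<otimes>\<^sub>o E1) * ?R = r *\<^sub>R (E2 \<otimes>\<^sub>o E1)"
      using cross(1)[of E1 E2] cross(1)[of E2 E1] cross(1)[of E2 E2] cross(2)[of E1 E2]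
        cross(2)[of E2 E1] cross(2)[of E1 E1] ER(2,4)
      by (simp_all add: distrib_left bop_tensor_mult EE E12)
    have "(conj_by ?V 1 \<otimes>\<^sub>o conj_by ?V 1) *\<^sub>V v = 0"
    proof (rule diagonal_block_vanishes[OF V inj1])
      show "(conj_by ?V q \<otimes>\<^sub>o conj_by ?V q) *\<^sub>V v = 0" if "?min1 q" for q
        using v that unfolding min_iff in_fst_conj_by by blast
      show "conj_by (iso_tensor ?V ?V) \<rho>\<^sub>1 *\<^sub>V v = 0"
        using apply0[of "E1 \<otimes>\<^sub>o E1"] unfolding blocks unfolding R1_def .
    qed
    moreover have "(conj_by ?W 1 \<otimes>\<^sub>o conj_by ?W 1) *\<^sub>V v = 0"
    proof (rule diagonal_block_vanishes[OF W inj2])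
      show "(conj_by ?W q \<otimes>\<^sub>o conj_by ?W q) *\<^sub>V v = 0" if "?min2 q" for q
        using v that unfolding min_iff in_snd_conj_by by blast
      show "conj_by (iso_tensor ?W ?W) \<rho>\<^sub>2 *\<^sub>V v = 0"
        using apply0[of "E2 \<otimes>\<^sub>o E2"] unfolding blocks unfolding R2_def .
    qed
    moreover have "(E1 \<otimes>\<^sub>o E2) *\<^sub>V v = 0 \<and> (E2 \<otimes>\<^sub>o E1) *\<^sub>V v = 0"
    proof (cases "r = 0")
      case False
      have "r *\<^sub>R ((E1 \<otimes>\<^sub>o E2) *\<^sub>V v) = 0" "r *\<^sub>R ((E2 \<otimes>\<^sub>o E1) *\<^sub>V v) = 0"
        using apply0[of "E1 \<otimes>\<^sub>o E2"] apply0[of "E2 \<otimes>\<^sub>o E1"] unfolding blocks scaleR_bop.rep_eq by auto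
      then show ?thesis using False by simp
    next
      case True
      \<comment> \<open>One of the algebras is zero, so by unitality one of the Hilbert spaces is zero.\<close>
      then consider "(1 :: 'a\<^sub>1) = 0" | "(1 :: 'a\<^sub>2) = 0" using assms(4) by blast
      then have "E1 = 0 \<or> E2 = 0"
      proof cases
        case 1
        then have "(1 :: 'h\<^sub>1 bop) = 0"
          using representation_simps(5,6)[OF rep(1)] by metis
        then show ?thesis by (simp add: E1_def in_fst_def bop_sum_zero)
      next
        case 2
        then have "(1 :: 'h\<^sub>2 bop) = 0"
          using representation_simps(5,6)[OF rep(2)] by metis
        then show ?thesis by (simp add: E2_def in_snd_def bop_sum_zero)
      qed
      then show ?thesis by (auto simp: zero_bop.rep_eq)
    qed
    moreover have "v = ((E1 + E2) \<otimes>\<^sub>o (E1 + E2)) *\<^sub>V v"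
      by (simp add: sum1 bop_tensor_one one_bop.rep_eq)
    ultimately show "v = 0"
      unfolding EV EW bop_tensor_add_left bop_tensor_add_right plus_bop.rep_eq by simp
  next
    let ?R = "R1 + R2 + r *\<^sub>R (E1 \<otimes>\<^sub>o E2) + r *\<^sub>R (E2 \<otimes>\<^sub>o E1)"
    have E2: "1 - E1 = E2" and E1: "1 - E2 = E1" by (simp_all flip: sum1)
    let ?D1 = "leg12 R1 + leg23 R1 - leg13 R1 + (2 * r) *\<^sub>R ((E1 \<otimes>\<^sub>o E2) \<otimes>\<^sub>o E1)"
    let ?D2 = "leg12 R2 + leg23 R2 - leg13 R2 + (2 * r) *\<^sub>R ((E2 \<otimes>\<^sub>o E1) \<otimes>\<^sub>o E2)"
    have D: "psd ?D1" "psd ?D2"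
      using triangle_block[OF V cqms(2,3,5) r(1)] triangle_block[OF W cqms(7,8,10) r(2)]
      by (simp_all only: EV EW E1 E2 R1_def R2_def)
    have "leg12 ?R + leg23 ?R - leg13 ?R = leg12 R1 + leg23 R1 - leg13 R1 + (leg12 R2 + leg23 R2 - leg13 R2)
      + r *\<^sub>R (leg12 (E1 \<otimes>\<^sub>o E2) + leg12 (E2 \<otimes>\<^sub>o E1) + (leg23 (E1 \<otimes>\<^sub>o E2) + leg23 (E2 \<otimes>\<^sub>o E1))
        - (leg13 (E1 \<otimes>\<^sub>o E2) + leg13 (E2 \<otimes>\<^sub>o E1)))"
      by (simp add: star_hom_simps[OF leg12(1)] star_hom_simps[OF leg13(1)] star_hom_simps[OF leg23(1)]
          algebra_simps)
    also have "\<dots> = ?D1 + ?D2"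
      unfolding leg_cross_terms[OF sum1] by (simp add: algebra_simps)
    finally show "psd (leg12 ?R + leg23 ?R - leg13 ?R)" using psd_add[OF D] by simp
  qed
qed

end
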